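(* Let $(\mathcal{M},\eta)$ be a contact manifold with Reeb vector field $\mathcal{R}$. Define $$\beta^c:T\mathcal{M}\times\mathbb{R}\longrightarrow T^*\mathcal{M}\times\mathbb{R},\qquad (V,u)\mapsto\big(-\iota_V d\eta-u\,\eta,\ \eta(V)\big).$$ Then $\beta^c$ is a fiber preserving diffeomorphism over the identity of $\mathcal{M}$ and it satisfies $$(\beta^c)^*\eta_{\mathcal{M}}=\eta^{\mathcal{T}},$$ where $\eta_{\mathcal{M}}$ is the canonical contact form on $T^*\mathcal{M}\times\mathbb{R}$ and $\eta^{\mathcal{T}}$ is the tangent contact form on $T\mathcal{M}\times\mathbb{R}$. Moreover, for every smooth function $H:\mathcal{M}\to\mathbb{R}$ with contact Hamiltonian vector field $X^c_H$: (i) $\beta^c\circ(X^c_H,\mathcal{R}(H))=-(dH,H)$ as maps $\mathcal{M}\to T^*\mathcal{M}\times\mathbb{R}$; consequently the image $\mathcal{N}_{-H}$ of the section $(X^c_H,\mathcal{R}(H)):\mathcal{M}\to T\mathcal{M}\times\mathbb{R}$ equals $(\beta^c)^{-1}\big(\mathrm{im}(-(dH,H))\big)$ and is a Legendrian submanifold of $(T\mathcal{M}\times\mathbb{R},\eta^{\mathcal{T}})$. (ii) A smooth curve $\sigma:I\to\mathcal{M}$ is a solution of the contact Hamilton equations for $H$ (i.e. an integral curve of $X^c_H$) if and only if $\big(\dot\sigma(t),\mathcal{R}(H)(\sigma(t))\big)\in\mathcal{N}_{-H}$ for every $t\in I$.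
   Context: A contact manifold $(\mathcal{M},\eta)$ is a $(2n+1)$-dimensional manifold with a one-form $\eta$ such that $\eta\wedge(d\eta)^n$ is nowhere zero. The Reeb vector field $\mathcal{R}$ is the unique vector field with $\iota_{\mathcal{R}}\eta=1$, $\iota_{\mathcal{R}}d\eta=0$. For a smooth function $H$ on $\mathcal{M}$, the contact Hamiltonian vector field $X^c_H$ is the vector field determined by $\iota_{X^c_H}\eta=-H$ and $\iota_{X^c_H}d\eta=dH-\mathcal{R}(H)\eta$. For a one-form $\eta$ on $\mathcal{M}$ with local expression $\eta=\eta_i\,dx^i$, in the induced coordinates $(x^i,\dot x^i)$ on $T\mathcal{M}$ the vertical lift is $\eta^V=\eta_i\,dx^i$ (the pull-back of $\eta$ by $T\mathcal{M}\to\mathcal{M}$) and the complete lift is $\eta^C=\dot x^j\frac{\partial\eta_i}{\partial x^j}dx^i+\eta_i\,d\dot x^i$. The tangent contact form on $T\mathcal{M}\times\mathbb{R}$ is $\eta^{\mathcal{T}}=u\,\eta^V+\eta^C$, where $u$ is the standard coordinate on $\mathbb{R}$; it is a contact form. The canonical contact form on $T^*\mathcal{M}\times\mathbb{R}$ is $\eta_{\mathcal{M}}=dw-\theta_{\mathcal{M}}$, with $w$ the coordinate on $\mathbb{R}$ and $\theta_{\mathcal{M}}$ the canonical (Liouville) one-form on $T^*\mathcal{M}$. A Legendrian submanifold of a contact manifold of dimension $2m+1$ is an $m$-dimensional submanifold on which the contact form pulls back to zero. *)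

theory Defs
  imports "HOL-Analysis.Analysis"
begin

section \<open>Smooth maps between Euclidean spaces\<close>

text \<open>Only used for open \<open>S\<close> and for subsets \<open>S\<close> of the real line without isolated points, where
  the derivative within \<open>S\<close> is unique.\<close>

primrec Ck_on :: "nat \<Rightarrow> 'a::euclidean_space set \<Rightarrow> ('a \<Rightarrow> 'b::real_normed_vector) \<Rightarrow> bool" where
  "Ck_on 0 S f \<longleftrightarrow> continuous_on S f"
| "Ck_on (Suc k) S f \<longleftrightarrow>
     f differentiable_on S \<and> (\<forall>v. Ck_on k S (\<lambda>x. frechet_derivative f (at x within S) v))"

definition smooth_on :: "'a::euclidean_space set \<Rightarrow> ('a \<Rightarrow> 'b::real_normed_vector) \<Rightarrow> bool" where
  "smooth_on S f \<longleftrightarrow> (\<forall>k. Ck_on k S f)"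


section \<open>Smooth manifolds\<close>

text \<open>A manifold is given by an atlas (not necessarily maximal) modelled on a Euclidean space;
  its dimension is the dimension of the model space. Point set and topology are the
  ones determined by the atlas. A chart \<open>(U, \<phi>)\<close> is only meaningful on \<open>U\<close>.\<close>

type_synonym ('a, 'e) chart = "'a set \<times> ('a \<Rightarrow> 'e)"
type_synonym ('a, 'e) atlas = "('a, 'e) chart set"

definition points :: "('a, 'e) atlas \<Rightarrow> 'a set" where
  "points A = (\<Union>c\<in>A. fst c)"

definition chart_inv :: "('a, 'e) chart \<Rightarrow> 'e \<Rightarrow> 'a" where
  "chart_inv c = inv_into (fst c) (snd c)"

definition manifold_topology :: "('a, 'e::euclidean_space) atlas \<Rightarrow> 'a topology" where
  "manifold_topology A =
     topology (\<lambda>W. W \<subseteq> points A \<and> (\<forall>c\<in>A. open (snd c ` (W \<inter> fst c))))"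

definition smooth_manifold :: "('a, 'e::euclidean_space) atlas \<Rightarrow> bool" where
  "smooth_manifold A \<longleftrightarrow>
     (\<forall>c\<in>A. inj_on (snd c) (fst c)) \<and>
     (\<forall>c\<in>A. \<forall>c'\<in>A. open (snd c ` (fst c \<inter> fst c')) \<and>
        smooth_on (snd c ` (fst c \<inter> fst c')) (snd c' \<circ> chart_inv c)) \<and>
     Hausdorff_space (manifold_topology A) \<and>
     second_countable (manifold_topology A)"

definition chart_at :: "('a, 'e) atlas \<Rightarrow> 'a \<Rightarrow> ('a, 'e) chart" where
  "chart_at A p = (SOME c. c \<in> A \<and> p \<in> fst c)"

definition smooth_fun :: "('a, 'e::euclidean_space) atlas \<Rightarrow> ('a \<Rightarrow> real) \<Rightarrow> bool" where
  "smooth_fun A H \<longleftrightarrow> (\<forall>c\<in>A. smooth_on (snd c ` fst c) (H \<circ> chart_inv c))"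

definition smooth_map ::
  "('a, 'e::euclidean_space) atlas \<Rightarrow> ('b, 'f::euclidean_space) atlas \<Rightarrow> ('a \<Rightarrow> 'b) \<Rightarrow> bool" where
  "smooth_map A B F \<longleftrightarrow>
     F ` points A \<subseteq> points B \<and>
     continuous_map (manifold_topology A) (manifold_topology B) F \<and>
     (\<forall>c\<in>A. \<forall>c'\<in>B. smooth_on (snd c ` {p \<in> fst c. F p \<in> fst c'}) (snd c' \<circ> F \<circ> chart_inv c))"

definition diffeomorphism ::
  "('a, 'e::euclidean_space) atlas \<Rightarrow> ('b, 'f::euclidean_space) atlas \<Rightarrow> ('a \<Rightarrow> 'b) \<Rightarrow> bool" where
  "diffeomorphism A B F \<longleftrightarrow>
     bij_betw F (points A) (points B) \<and> smooth_map A B F \<and>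
     smooth_map B A (inv_into (points A) F)"

text \<open>The product of a manifold with the real line.\<close>

definition times_real :: "('a, 'e) atlas \<Rightarrow> ('a \<times> real, 'e \<times> real) atlas" where
  "times_real A = (\<lambda>c. (fst c \<times> UNIV, \<lambda>(p, u). (snd c p, u))) ` A"


section \<open>Tangent vectors\<close>

text \<open>A tangent vector is a base point together with the family of its components in all charts of
  the atlas around the base point (and \<open>0\<close> for all other charts), related by the
  derivatives of the coordinate changes.\<close>

type_synonym ('a, 'e) tvec = "'a \<times> (('a, 'e) chart \<Rightarrow> 'e)"

definition tangent_space :: "('a, 'e::euclidean_space) atlas \<Rightarrow> 'a \<Rightarrow> ('a, 'e) tvec set" where
  "tangent_space A p =
     {(q, v). q = p \<and> p \<in> points A \<and>
        (\<forall>c. \<not> (c \<in> A \<and> p \<in> fst c) \<longrightarrow> v c = 0) \<and>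
        (\<forall>c\<in>A. \<forall>c'\<in>A. p \<in> fst c \<inter> fst c' \<longrightarrow>
           v c' = frechet_derivative (snd c' \<circ> chart_inv c) (at (snd c p)) (v c))}"

text \<open>The tangent vector at \<open>p\<close> whose component in the chart \<open>c\<close> is \<open>h\<close>. The map
  \<open>coord_vec A c p\<close> from the model space onto the tangent space at \<open>p\<close> is the
  linear isomorphism defining the vector space structure of the latter.\<close>

definition coord_vec ::
  "('a, 'e::euclidean_space) atlas \<Rightarrow> ('a, 'e) chart \<Rightarrow> 'a \<Rightarrow> 'e \<Rightarrow> ('a, 'e) tvec" where
  "coord_vec A c p h =
     (p, \<lambda>c'. if c' \<in> A \<and> p \<in> fst c'
              then frechet_derivative (snd c' \<circ> chart_inv c) (at (snd c p)) h else 0)"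

definition tangent_chart ::
  "('a, 'e::euclidean_space) atlas \<Rightarrow> ('a, 'e) chart \<Rightarrow> (('a, 'e) tvec, 'e \<times> 'e) chart" where
  "tangent_chart A c =
     ((\<Union>p\<in>fst c. tangent_space A p), \<lambda>V. (snd c (fst V), snd V c))"

definition tangent_bundle ::
  "('a, 'e::euclidean_space) atlas \<Rightarrow> (('a, 'e) tvec, 'e \<times> 'e) atlas" where
  "tangent_bundle A = tangent_chart A ` A"

definition pushforward ::
  "('a, 'e::euclidean_space) atlas \<Rightarrow> ('b, 'f::euclidean_space) atlas \<Rightarrow> ('a \<Rightarrow> 'b) \<Rightarrow>
     ('a, 'e) tvec \<Rightarrow> ('b, 'f) tvec" where
  "pushforward A B F V =
     (let p = fst V; c = chart_at A p in
       (F p, \<lambda>c'. if c' \<in> B \<and> F p \<in> fst c'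
                  then frechet_derivative (snd c' \<circ> F \<circ> chart_inv c) (at (snd c p)) (snd V c)
                  else 0))"


section \<open>Cotangent vectors\<close>

text \<open>A covector is a base point together with a linear functional on the tangent space,
  extended by \<open>0\<close> to all other arguments.\<close>

type_synonym ('a, 'e) covec = "'a \<times> (('a, 'e) tvec \<Rightarrow> real)"

definition cotangent_space :: "('a, 'e::euclidean_space) atlas \<Rightarrow> 'a \<Rightarrow> ('a, 'e) covec set" where
  "cotangent_space A p =
     {(q, \<alpha>). q = p \<and> p \<in> points A \<and>
        (\<forall>c\<in>A. p \<in> fst c \<longrightarrow> linear (\<lambda>h. \<alpha> (coord_vec A c p h))) \<and>
        (\<forall>V. V \<notin> tangent_space A p \<longrightarrow> \<alpha> V = 0)}"

definition covector :: "('a, 'e::euclidean_space) atlas \<Rightarrow> 'a \<Rightarrow> (('a, 'e) tvec \<Rightarrow> real) \<Rightarrow> ('a, 'e) covec"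
  where "covector A p \<alpha> = (p, \<lambda>V. if V \<in> tangent_space A p then \<alpha> V else 0)"

definition cotangent_chart ::
  "('a, 'e::euclidean_space) atlas \<Rightarrow> ('a, 'e) chart \<Rightarrow> (('a, 'e) covec, 'e \<times> 'e) chart" where
  "cotangent_chart A c =
     ((\<Union>p\<in>fst c. cotangent_space A p),
      \<lambda>(p, \<alpha>). (snd c p, \<Sum>b\<in>Basis. \<alpha> (coord_vec A c p b) *\<^sub>R b))"

definition cotangent_bundle ::
  "('a, 'e::euclidean_space) atlas \<Rightarrow> (('a, 'e) covec, 'e \<times> 'e) atlas" where
  "cotangent_bundle A = cotangent_chart A ` A"


section \<open>Differential forms\<close>

text \<open>One-forms are functions on tangent vectors; only their values on tangent vectors of the
  manifold are relevant. The local representative sends \<open>x\<close> and \<open>h\<close> to the sum of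
  the \<open>\<eta>\<^sub>i(x) h\<^sup>i\<close>.\<close>

definition local_form ::
  "('a, 'e::euclidean_space) atlas \<Rightarrow> (('a, 'e) tvec \<Rightarrow> real) \<Rightarrow> ('a, 'e) chart \<Rightarrow> 'e \<Rightarrow> 'e \<Rightarrow> real"
  where "local_form A \<eta> c x h = \<eta> (coord_vec A c (chart_inv c x) h)"

definition one_form :: "('a, 'e::euclidean_space) atlas \<Rightarrow> (('a, 'e) tvec \<Rightarrow> real) \<Rightarrow> bool" where
  "one_form A \<eta> \<longleftrightarrow>
     (\<forall>c\<in>A. (\<forall>x \<in> snd c ` fst c. linear (local_form A \<eta> c x)) \<and>
            (\<forall>h. smooth_on (snd c ` fst c) (\<lambda>x. local_form A \<eta> c x h)))"

definition pullback ::
  "('a, 'e::euclidean_space) atlas \<Rightarrow> ('b, 'f::euclidean_space) atlas \<Rightarrow> ('a \<Rightarrow> 'b) \<Rightarrow>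
     (('b, 'f) tvec \<Rightarrow> real) \<Rightarrow> ('a, 'e) tvec \<Rightarrow> real" where
  "pullback A B F \<omega> V = \<omega> (pushforward A B F V)"

definition dfun :: "('a, 'e::euclidean_space) atlas \<Rightarrow> ('a \<Rightarrow> real) \<Rightarrow> ('a, 'e) tvec \<Rightarrow> real" where
  "dfun A H V =
     (let c = chart_at A (fst V) in
       frechet_derivative (H \<circ> chart_inv c) (at (snd c (fst V))) (snd V c))"

text \<open>For \<open>V\<close> and \<open>W\<close> with the same base point, this is the sum of the
  \<open>(\<partial>\<^sub>j \<eta>\<^sub>i) (V\<^sup>j W\<^sup>i - W\<^sup>j V\<^sup>i)\<close>; there is no factor one half.\<close>

definition ext_deriv ::
  "('a, 'e::euclidean_space) atlas \<Rightarrow> (('a, 'e) tvec \<Rightarrow> real) \<Rightarrow>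
     ('a, 'e) tvec \<Rightarrow> ('a, 'e) tvec \<Rightarrow> real" where
  "ext_deriv A \<eta> V W =
     (let c = chart_at A (fst V); x = snd c (fst V) in
       frechet_derivative (\<lambda>y. local_form A \<eta> c y (snd W c)) (at x) (snd V c) -
       frechet_derivative (\<lambda>y. local_form A \<eta> c y (snd V c)) (at x) (snd W c))"

text \<open>An alternating \<open>k\<close>-form is a function of a sequence of vectors that only depends on the
  first \<open>k\<close> entries. The wedge product of a \<open>k\<close>-form and an \<open>l\<close>-form:\<close>

definition wedge ::
  "nat \<Rightarrow> nat \<Rightarrow> ((nat \<Rightarrow> 'v) \<Rightarrow> real) \<Rightarrow> ((nat \<Rightarrow> 'v) \<Rightarrow> real) \<Rightarrow> (nat \<Rightarrow> 'v) \<Rightarrow> real" where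
  "wedge k l \<alpha> \<beta> v =
     (\<Sum>\<sigma> | \<sigma> permutes {..<k + l}.
        of_int (sign \<sigma>) * \<alpha> (\<lambda>i. v (\<sigma> i)) * \<beta> (\<lambda>i. v (\<sigma> (k + i)))) / (fact k * fact l)"

primrec two_form_power :: "((nat \<Rightarrow> 'v) \<Rightarrow> real) \<Rightarrow> nat \<Rightarrow> (nat \<Rightarrow> 'v) \<Rightarrow> real" where
  "two_form_power \<omega> 0 = (\<lambda>_. 1)"
| "two_form_power \<omega> (Suc n) = wedge 2 (2 * n) \<omega> (two_form_power \<omega> n)"


section \<open>Contact manifolds\<close>

definition contact_manifold ::
  "nat \<Rightarrow> ('a, 'e::euclidean_space) atlas \<Rightarrow> (('a, 'e) tvec \<Rightarrow> real) \<Rightarrow> bool" where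
  "contact_manifold n A \<eta> \<longleftrightarrow>
     smooth_manifold A \<and> DIM('e) = 2 * n + 1 \<and> one_form A \<eta> \<and>
     (\<forall>p \<in> points A. \<exists>v. (\<forall>i. v i \<in> tangent_space A p) \<and>
        wedge 1 (2 * n) (\<lambda>w. \<eta> (w 0)) (two_form_power (\<lambda>w. ext_deriv A \<eta> (w 0) (w 1)) n) v \<noteq> 0)"

definition reeb ::
  "('a, 'e::euclidean_space) atlas \<Rightarrow> (('a, 'e) tvec \<Rightarrow> real) \<Rightarrow> 'a \<Rightarrow> ('a, 'e) tvec" where
  "reeb A \<eta> p =
     (THE V. V \<in> tangent_space A p \<and> \<eta> V = 1 \<and> (\<forall>W \<in> tangent_space A p. ext_deriv A \<eta> V W = 0))"

definition reeb_deriv ::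
  "('a, 'e::euclidean_space) atlas \<Rightarrow> (('a, 'e) tvec \<Rightarrow> real) \<Rightarrow> ('a \<Rightarrow> real) \<Rightarrow> 'a \<Rightarrow> real" where
  "reeb_deriv A \<eta> H p = dfun A H (reeb A \<eta> p)"

definition contact_ham_field ::
  "('a, 'e::euclidean_space) atlas \<Rightarrow> (('a, 'e) tvec \<Rightarrow> real) \<Rightarrow> ('a \<Rightarrow> real) \<Rightarrow> 'a \<Rightarrow> ('a, 'e) tvec"
  where
  "contact_ham_field A \<eta> H p =
     (THE V. V \<in> tangent_space A p \<and> \<eta> V = - H p \<and>
        (\<forall>W \<in> tangent_space A p. ext_deriv A \<eta> V W = dfun A H W - reeb_deriv A \<eta> H p * \<eta> W))"

definition vertical_lift ::
  "('a, 'e::euclidean_space) atlas \<Rightarrow> (('a, 'e) tvec \<Rightarrow> real) \<Rightarrow> (('a, 'e) tvec, 'e \<times> 'e) tvec \<Rightarrow> real"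
  where "vertical_lift A \<eta> = pullback (tangent_bundle A) A fst \<eta>"

text \<open>In the chart of the tangent bundle induced by \<open>c\<close>, the components \<open>(dx, dxdot)\<close> of \<open>Z\<close>
  are the \<open>dx\<^sup>i\<close> and \<open>d xdot\<^sup>i\<close> of the coordinate expression of the complete lift.\<close>

definition complete_lift ::
  "('a, 'e::euclidean_space) atlas \<Rightarrow> (('a, 'e) tvec \<Rightarrow> real) \<Rightarrow> (('a, 'e) tvec, 'e \<times> 'e) tvec \<Rightarrow> real"
  where
  "complete_lift A \<eta> Z =
     (let V = fst Z; c = chart_at A (fst V); x = snd c (fst V); xdot = snd V c;
          (dx, dxdot) = snd Z (tangent_chart A c) in
       frechet_derivative (\<lambda>y. local_form A \<eta> c y dx) (at x) xdot + local_form A \<eta> c x dxdot)"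

definition tangent_contact_form ::
  "('a, 'e::euclidean_space) atlas \<Rightarrow> (('a, 'e) tvec \<Rightarrow> real) \<Rightarrow>
     (('a, 'e) tvec \<times> real, ('e \<times> 'e) \<times> real) tvec \<Rightarrow> real" where
  "tangent_contact_form A \<eta> Z =
     snd (fst Z) *
       pullback (times_real (tangent_bundle A)) (tangent_bundle A) fst (vertical_lift A \<eta>) Z +
     pullback (times_real (tangent_bundle A)) (tangent_bundle A) fst (complete_lift A \<eta>) Z"

definition liouville_form ::
  "('a, 'e::euclidean_space) atlas \<Rightarrow> (('a, 'e) covec, 'e \<times> 'e) tvec \<Rightarrow> real" where
  "liouville_form A Z = snd (fst Z) (pushforward (cotangent_bundle A) A fst Z)"

definition canonical_contact_form ::
  "('a, 'e::euclidean_space) atlas \<Rightarrow> (('a, 'e) covec \<times> real, ('e \<times> 'e) \<times> real) tvec \<Rightarrow> real" where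
  "canonical_contact_form A Z =
     dfun (times_real (cotangent_bundle A)) snd Z -
     pullback (times_real (cotangent_bundle A)) (cotangent_bundle A) fst (liouville_form A) Z"

definition contact_beta ::
  "('a, 'e::euclidean_space) atlas \<Rightarrow> (('a, 'e) tvec \<Rightarrow> real) \<Rightarrow>
     ('a, 'e) tvec \<times> real \<Rightarrow> ('a, 'e) covec \<times> real" where
  "contact_beta A \<eta> = (\<lambda>(V, u).
     (covector A (fst V) (\<lambda>W. - ext_deriv A \<eta> V W - u * \<eta> W), \<eta> V))"


section \<open>Legendrian submanifolds\<close>

text \<open>\<open>C\<close> is an atlas of the submanifold itself, whose inclusion into the ambient manifold
  is required to be a smooth embedding.\<close>

definition embedded_submanifold ::
  "('a, 'e::euclidean_space) atlas \<Rightarrow> ('a, 'f::euclidean_space) atlas \<Rightarrow> bool" where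
  "embedded_submanifold A C \<longleftrightarrow>
     smooth_manifold C \<and> smooth_map C A (\<lambda>x. x) \<and>
     (\<forall>p \<in> points C. inj_on (pushforward C A (\<lambda>x. x)) (tangent_space C p)) \<and>
     embedding_map (manifold_topology C) (manifold_topology A) (\<lambda>x. x)"

text \<open>The type argument is the model space of the submanifold; only its dimension matters.\<close>

definition legendrian_submanifold ::
  "'f::euclidean_space itself \<Rightarrow> ('a, 'e::euclidean_space) atlas \<Rightarrow> (('a, 'e) tvec \<Rightarrow> real) \<Rightarrow>
     'a set \<Rightarrow> bool" where
  "legendrian_submanifold _ A \<eta> N \<longleftrightarrow>
     DIM('e) = 2 * DIM('f) + 1 \<and>
     (\<exists>C :: ('a, 'f) atlas. points C = N \<and> embedded_submanifold A C \<and>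
        (\<forall>p \<in> points C. \<forall>V \<in> tangent_space C p. pullback C A (\<lambda>x. x) \<eta> V = 0))"


section \<open>Curves\<close>

definition smooth_curve :: "('a, 'e::euclidean_space) atlas \<Rightarrow> real set \<Rightarrow> (real \<Rightarrow> 'a) \<Rightarrow> bool" where
  "smooth_curve A I \<sigma> \<longleftrightarrow>
     \<sigma> ` I \<subseteq> points A \<and>
     continuous_map (top_of_set I) (manifold_topology A) \<sigma> \<and>
     (\<forall>c\<in>A. smooth_on {t \<in> I. \<sigma> t \<in> fst c} (snd c \<circ> \<sigma>))"

definition velocity ::
  "('a, 'e::euclidean_space) atlas \<Rightarrow> real set \<Rightarrow> (real \<Rightarrow> 'a) \<Rightarrow> real \<Rightarrow> ('a, 'e) tvec" where
  "velocity A I \<sigma> t =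
     (\<sigma> t, \<lambda>c. if c \<in> A \<and> \<sigma> t \<in> fst c
               then vector_derivative (snd c \<circ> \<sigma>) (at t within I) else 0)"

definition integral_curve ::
  "('a, 'e::euclidean_space) atlas \<Rightarrow> ('a \<Rightarrow> ('a, 'e) tvec) \<Rightarrow> real set \<Rightarrow> (real \<Rightarrow> 'a) \<Rightarrow> bool" where
  "integral_curve A X I \<sigma> \<longleftrightarrow> (\<forall>t\<in>I. velocity A I \<sigma> t = X (\<sigma> t))"

end

(*
  On every fibre the map (V, u) |-> (- i_V d eta - u eta, eta(V)) is linear between spaces of the same
  dimension, and the contact condition makes it injective. Hence it is a fibrewise isomorphism that
  depends smoothly on the base point, and so does its inverse; this gives the diffeomorphism. The Reeb
  field is characterised by beta(R, 0) = (0, 1) and the contact Hamiltonian field by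
  beta(X_H, R(H)) = - (dH, H), so existence and uniqueness of both fields, smoothness of X_H and (i) are
  read off from the inverse. The pullback formula is a computation in the charts induced by one chart of
  the base. In such a chart the restriction of the tangent contact form to the image of (X_H, R(H)) is
  the derivative of eta(X_H) = - H minus the same expression obtained from the equation for
  i_{X_H} d eta, hence zero. (ii) only uses that a velocity and the value of X_H have the same base
  point.
*)
theory Submission
  imports Defs
begin

section \<open>Calculus of smooth maps\<close>

text \<open>The forms are evaluated pointwise in the chart picked by \<open>chart_at\<close>, which
  may jump from point to point, whereas smoothness has to be seen in one fixed chart over a whole
  neighbourhood. Therefore the exterior derivative is first shown to have the same expression in all
  charts, which is where the symmetry of second derivatives enters. Afterwards the map is a single
  linear endomorphism per point, \<open>local_contact_beta\<close>, on the product of the model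
  space with the reals.

  The contact condition only says that some value of the top form is nonzero. This excludes a common
  kernel vector of \<eta> and d\<eta>, but injectivity must also control the scalar u. Odd dimension
  helps: a nondegenerate skew form lives in even dimension, so d\<eta> has a kernel vector, and
  pairing with it isolates u.

  The image of the section receives the atlas of the base, carried along the section. It is thus a
  manifold because the base is one; it is topologically embedded because projecting to the base and
  applying the section again is a continuous retraction onto it.\<close>

lemma has_derivative_within_cong:
  assumes "\<And>y. y \<in> S \<Longrightarrow> f y = g y" and "x \<in> S"
  shows "(f has_derivative D) (at x within S) \<longleftrightarrow> (g has_derivative D) (at x within S)"
  using assms has_derivative_transform[of x S f g] has_derivative_transform[of x S g f] by metis

text \<open>Derivatives within \<open>S\<close> see only the values on \<open>S\<close>. Since
  \<open>frechet_derivative\<close> is a choice from the set of all derivatives, equal sets give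
  equal choices, also at points without a derivative, and the induction goes through.\<close>

lemma Ck_on_cong:
  assumes "\<And>x. x \<in> S \<Longrightarrow> f x = g x"
  shows "Ck_on k S f \<longleftrightarrow> Ck_on k S g"
  using assms
proof (induction k arbitrary: f g)
  case 0
  then show ?case using continuous_on_cong[of S S f g] by simp
next
  case (Suc k)
  have *: "(f has_derivative D) (at x within S) \<longleftrightarrow> (g has_derivative D) (at x within S)"
    if "x \<in> S" for x D
    by (rule has_derivative_within_cong) (use Suc.prems that in auto)
  then have "f differentiable_on S \<longleftrightarrow> g differentiable_on S"
    by (simp add: differentiable_on_def differentiable_def)
  moreover have "Ck_on k S (\<lambda>x. frechet_derivative f (at x within S) v) \<longleftrightarrow>
      Ck_on k S (\<lambda>x. frechet_derivative g (at x within S) v)" for v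
    by (rule Suc.IH) (simp add: frechet_derivative_def *)
  ultimately show ?case by simp
qed

lemma smooth_on_cong:
  assumes "\<And>x. x \<in> S \<Longrightarrow> f x = g x"
  shows "smooth_on S f \<longleftrightarrow> smooth_on S g"
proof -
  have "Ck_on k S f \<longleftrightarrow> Ck_on k S g" for k
    by (rule Ck_on_cong) (rule assms)
  then show ?thesis by (simp add: smooth_on_def)
qed

section \<open>Closure properties of maps of class k on open sets\<close>

lemma Ck_on_Suc_open:
  assumes "open S"
  shows "Ck_on (Suc k) S f \<longleftrightarrow>
    (\<forall>x\<in>S. f differentiable (at x)) \<and> (\<forall>v. Ck_on k S (\<lambda>x. frechet_derivative f (at x) v))"
proof -
  have "Ck_on k S (\<lambda>x. frechet_derivative f (at x within S) v) \<longleftrightarrow>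
      Ck_on k S (\<lambda>x. frechet_derivative f (at x) v)" for v
    using assms by (intro Ck_on_cong) (simp add: at_within_open[of _ S])
  then show ?thesis using assms by (simp add: differentiable_on_eq_differentiable_at)
qed

text \<open>The explicit candidate \<open>f'\<close> lets each closure property below quote a rule
  of differentiation and then apply the induction hypothesis to the formula which that rule
  produces.\<close>

lemma Ck_on_SucI:
  assumes "open S" "\<And>x. x \<in> S \<Longrightarrow> (f has_derivative f' x) (at x)" "\<And>v. Ck_on k S (\<lambda>x. f' x v)"
  shows "Ck_on (Suc k) S f"
proof -
  have "frechet_derivative f (at x) = f' x" if "x \<in> S" for x
    using frechet_derivative_at[OF assms(2)[OF that]] by simp
  then have "Ck_on k S (\<lambda>x. frechet_derivative f (at x) v) \<longleftrightarrow> Ck_on k S (\<lambda>x. f' x v)" for v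
    by (intro Ck_on_cong) simp
  moreover have "\<forall>x\<in>S. f differentiable (at x)"
    using assms(2) differentiableI by blast
  ultimately show ?thesis
    using assms(3) unfolding Ck_on_Suc_open[OF assms(1)] by blast
qed

lemma Ck_on_SucD:
  assumes "open S" "Ck_on (Suc k) S f"
  shows "x \<in> S \<Longrightarrow> (f has_derivative frechet_derivative f (at x)) (at x)"
    and "Ck_on k S (\<lambda>x. frechet_derivative f (at x) v)"
  using assms by (auto simp: Ck_on_Suc_open frechet_derivative_works simp del: Ck_on.simps)

lemma Ck_on_Suc_imp:
  assumes "open S" "Ck_on (Suc k) S f"
  shows "Ck_on k S f"
  using assms(2)
proof (induction k arbitrary: f)
  case 0
  then show ?case by (simp add: differentiable_imp_continuous_on)
next
  case (Suc k)
  note f = Ck_on_SucD[OF assms(1) Suc.prems]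
  show ?case by (rule Ck_on_SucI[OF assms(1) f(1) Suc.IH[OF f(2)]])
qed

lemma Ck_on_subset:
  assumes "open S" "open T" "T \<subseteq> S" "Ck_on k S f"
  shows "Ck_on k T f"
  using assms(4)
proof (induction k arbitrary: f)
  case 0
  then show ?case using assms(3) continuous_on_subset by auto
next
  case (Suc k)
  note f = Ck_on_SucD[OF assms(1) Suc.prems]
  show ?case by (rule Ck_on_SucI[OF assms(2) f(1) Suc.IH[OF f(2)]]) (use assms(3) in auto)
qed

text \<open>The derivative at \<open>x\<close> does not depend on the neighbourhood
  \<open>T\<close>, so the local hypothesis on \<open>f\<close> passes to its directional
  derivatives.\<close>

lemma Ck_on_local:
  assumes "open S" and "\<And>x. x \<in> S \<Longrightarrow> \<exists>T. open T \<and> x \<in> T \<and> Ck_on k T f"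
  shows "Ck_on k S f"
  using assms(2)
proof (induction k arbitrary: f)
  case 0
  have "isCont f x" if "x \<in> S" for x
    using 0[OF that] by (auto simp: continuous_on_eq_continuous_at)
  then show ?case by (simp add: continuous_at_imp_continuous_on)
next
  case (Suc k)
  show ?case
  proof (rule Ck_on_SucI[OF assms(1)])
    fix x assume "x \<in> S"
    then show "(f has_derivative frechet_derivative f (at x)) (at x)"
      using Suc.prems Ck_on_SucD(1) by blast
  next
    fix v
    show "Ck_on k S (\<lambda>x. frechet_derivative f (at x) v)"
    proof (rule Suc.IH)
      fix x assume "x \<in> S"
      then obtain T where "open T" "x \<in> T" "Ck_on (Suc k) T f" using Suc.prems by blast
      then show "\<exists>T. open T \<and> x \<in> T \<and> Ck_on k T (\<lambda>x. frechet_derivative f (at x) v)"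
        using Ck_on_SucD(2) by blast
    qed
  qed
qed

lemma Ck_on_const: "open S \<Longrightarrow> Ck_on k S (\<lambda>_. c)"
proof (induction k arbitrary: c)
  case (Suc k)
  show ?case by (rule Ck_on_SucI[where f' = "\<lambda>_ _. 0"]) (use Suc in auto)
qed simp

lemma Ck_on_bounded_linear:
  assumes "bounded_linear g" "open S" "Ck_on k S f"
  shows "Ck_on k S (\<lambda>x. g (f x))"
  using assms(3)
proof (induction k arbitrary: f)
  case 0
  then show ?case using bounded_linear.continuous_on[OF assms(1)] by simp
next
  case (Suc k)
  note f = Ck_on_SucD[OF assms(2) Suc.prems]
  show ?case
    by (rule Ck_on_SucI[OF assms(2) bounded_linear.has_derivative[OF assms(1) f(1)] Suc.IH[OF f(2)]])
qed

lemma Ck_on_ident: "open S \<Longrightarrow> Ck_on k S (\<lambda>x. x)"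
proof (induction k)
  case (Suc k)
  show ?case
    by (rule Ck_on_SucI[where f' = "\<lambda>_ v. v"]) (use Suc.prems in \<open>auto intro: Ck_on_const\<close>)
qed simp

lemma Ck_on_add:
  assumes "open S" "Ck_on k S f" "Ck_on k S g"
  shows "Ck_on k S (\<lambda>x. f x + g x)"
  using assms(2,3)
proof (induction k arbitrary: f g)
  case 0
  then show ?case by (auto intro: continuous_on_add)
next
  case (Suc k)
  note f = Ck_on_SucD[OF assms(1) Suc.prems(1)] and g = Ck_on_SucD[OF assms(1) Suc.prems(2)]
  show ?case
    by (rule Ck_on_SucI[OF assms(1) has_derivative_add[OF f(1) g(1)] Suc.IH[OF f(2) g(2)]])
qed

lemma Ck_on_sum:
  assumes "open S" "\<And>i. i \<in> I \<Longrightarrow> Ck_on k S (f i)"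
  shows "Ck_on k S (\<lambda>x. \<Sum>i\<in>I. f i x)"
  using assms(2)
  by (induction I rule: infinite_finite_induct) (auto intro: Ck_on_const Ck_on_add assms(1))

text \<open>The product rule gives two summands, each pairing an undifferentiated factor with a
  differentiated one. Hence the induction also uses that the factors themselves are of class
  \<open>k\<close>.\<close>

lemma Ck_on_bilinear:
  assumes "bounded_bilinear pr" "open S" "Ck_on k S f" "Ck_on k S g"
  shows "Ck_on k S (\<lambda>x. pr (f x) (g x))"
  using assms(3,4)
proof (induction k arbitrary: f g)
  case 0
  then show ?case using bounded_bilinear.continuous_on[OF assms(1)] by auto
next
  case (Suc k)
  note f = Ck_on_SucD[OF assms(2) Suc.prems(1)] Ck_on_Suc_imp[OF assms(2) Suc.prems(1)]
  note g = Ck_on_SucD[OF assms(2) Suc.prems(2)] Ck_on_Suc_imp[OF assms(2) Suc.prems(2)]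
  show ?case
    by (rule Ck_on_SucI[OF assms(2) bounded_bilinear.FDERIV[OF assms(1) f(1) g(1)]
          Ck_on_add[OF assms(2) Suc.IH[OF f(3) g(2)] Suc.IH[OF f(2) g(3)]]])
qed

lemma Ck_on_Pair:
  assumes "open S" "Ck_on k S f" "Ck_on k S g"
  shows "Ck_on k S (\<lambda>x. (f x, g x))"
proof -
  have "bounded_linear (\<lambda>y::'b. (y, 0::'c))" "bounded_linear (\<lambda>y::'c. (0::'b, y))"
    by (auto intro!: bounded_linear_Pair bounded_linear_ident bounded_linear_zero)
  then have "Ck_on k S (\<lambda>x. (f x, 0) + (0, g x))"
    by (intro Ck_on_add[OF assms(1)] Ck_on_bounded_linear[OF _ assms(1) assms(2)]
        Ck_on_bounded_linear[OF _ assms(1) assms(3)])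
  then show ?thesis by simp
qed

lemma linear_eq_sum_Basis:
  fixes f :: "'a::euclidean_space \<Rightarrow> 'b::real_vector"
  assumes "linear f"
  shows "f v = (\<Sum>b\<in>Basis. (v \<bullet> b) *\<^sub>R f b)"
proof -
  have "f (\<Sum>b\<in>Basis. (v \<bullet> b) *\<^sub>R b) = (\<Sum>b\<in>Basis. (v \<bullet> b) *\<^sub>R f b)"
    by (simp add: linear_sum[OF assms] linear_scale[OF assms])
  then show ?thesis by (simp add: euclidean_representation)
qed

lemma Ck_on_compose:
  fixes f :: "'a::euclidean_space \<Rightarrow> 'b::euclidean_space" and g :: "'b \<Rightarrow> 'c::real_normed_vector"
  assumes "open S" "open T" "Ck_on k S f" "Ck_on k T g" "f ` S \<subseteq> T"
  shows "Ck_on k S (\<lambda>x. g (f x))"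
  using assms(3,4)
proof (induction k arbitrary: g)
  case 0
  then show ?case using assms(5) continuous_on_compose2[of T g S f] by simp
next
  case (Suc k)
  let ?D = "\<lambda>x v. frechet_derivative g (at (f x)) (frechet_derivative f (at x) v)"
  have lin: "linear (frechet_derivative g (at (f x)))" if "x \<in> S" for x
    using Ck_on_SucD(1)[OF assms(2) Suc.prems(2)] assms(5) that has_derivative_linear by blast
  \<comment> \<open>The chain rule evaluates the derivative of \<open>g\<close> in a direction that
    varies with \<open>x\<close>, whereas \<open>Ck_on\<close> speaks of fixed directions. Expanding
    the direction in the basis leaves sums of products that the induction hypothesis covers.\<close>
  have "Ck_on k S (\<lambda>x. \<Sum>b\<in>Basis. (frechet_derivative f (at x) v \<bullet> b) *\<^sub>R
      frechet_derivative g (at (f x)) b)" for v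
    by (intro assms(1) Ck_on_sum Ck_on_bilinear[OF bounded_bilinear_scaleR]
        Ck_on_bounded_linear[OF bounded_linear_inner_left] Ck_on_SucD(2)[OF assms(1) Suc.prems(1)]
        Suc.IH[OF Ck_on_Suc_imp[OF assms(1) Suc.prems(1)] Ck_on_SucD(2)[OF assms(2) Suc.prems(2)]])
  moreover have "?D x v = (\<Sum>b\<in>Basis. (frechet_derivative f (at x) v \<bullet> b) *\<^sub>R
      frechet_derivative g (at (f x)) b)" if "x \<in> S" for x v
    using linear_eq_sum_Basis[OF lin[OF that]] .
  ultimately have "Ck_on k S (\<lambda>x. ?D x v)" for v
    using Ck_on_cong[of S "\<lambda>x. ?D x v"] by simp
  moreover have "((\<lambda>x. g (f x)) has_derivative ?D x) (at x)" if "x \<in> S" for x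
    by (rule has_derivative_compose[OF Ck_on_SucD(1)[OF assms(1) Suc.prems(1) that]
        Ck_on_SucD(1)[OF assms(2) Suc.prems(2)]]) (use that assms(5) in auto)
  ultimately show ?case by (rule Ck_on_SucI[OF assms(1), rotated])
qed

text \<open>The vector on the right has the form of the component vector stored by
  \<open>cotangent_chart\<close>; the identity recovers the functional from it.\<close>

lemma linear_functional_eq_inner:
  fixes f :: "'e::euclidean_space \<Rightarrow> real"
  assumes "linear f"
  shows "f h = (\<Sum>b\<in>Basis. f b *\<^sub>R b) \<bullet> h"
  using linear_eq_sum_Basis[OF assms, of h]
  by (simp add: inner_sum_left inner_commute[of h] mult.commute)

lemma smooth_on_subset:
  "open S \<Longrightarrow> open T \<Longrightarrow> T \<subseteq> S \<Longrightarrow> smooth_on S f \<Longrightarrow> smooth_on T f"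
  unfolding smooth_on_def using Ck_on_subset by blast

lemma smooth_on_local:
  assumes "open S" and "\<And>x. x \<in> S \<Longrightarrow> \<exists>T. open T \<and> x \<in> T \<and> smooth_on T f"
  shows "smooth_on S f"
  unfolding smooth_on_def
proof
  fix k
  show "Ck_on k S f"
    by (rule Ck_on_local[OF assms(1)]) (use assms(2) in \<open>auto simp: smooth_on_def\<close>)
qed

lemma smooth_on_const: "open S \<Longrightarrow> smooth_on S (\<lambda>_. c)"
  by (simp add: smooth_on_def Ck_on_const)

lemma smooth_on_ident: "open S \<Longrightarrow> smooth_on S (\<lambda>x. x)"
  by (simp add: smooth_on_def Ck_on_ident)

lemma smooth_on_bounded_linear:
  "bounded_linear g \<Longrightarrow> open S \<Longrightarrow> smooth_on S f \<Longrightarrow> smooth_on S (\<lambda>x. g (f x))"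
  by (simp add: smooth_on_def Ck_on_bounded_linear)

lemma smooth_on_add:
  "open S \<Longrightarrow> smooth_on S f \<Longrightarrow> smooth_on S g \<Longrightarrow> smooth_on S (\<lambda>x. f x + g x)"
  by (simp add: smooth_on_def Ck_on_add)

lemma smooth_on_minus: "open S \<Longrightarrow> smooth_on S f \<Longrightarrow> smooth_on S (\<lambda>x. - f x)"
  by (rule smooth_on_bounded_linear[OF bounded_linear_minus[OF bounded_linear_ident]])

lemma smooth_on_diff:
  "open S \<Longrightarrow> smooth_on S f \<Longrightarrow> smooth_on S g \<Longrightarrow> smooth_on S (\<lambda>x. f x - g x)"
  using smooth_on_add[of S f "\<lambda>x. - g x"] by (simp add: smooth_on_minus)

lemma smooth_on_sum:
  "open S \<Longrightarrow> (\<And>i. i \<in> I \<Longrightarrow> smooth_on S (f i)) \<Longrightarrow> smooth_on S (\<lambda>x. \<Sum>i\<in>I. f i x)"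
  by (simp add: smooth_on_def Ck_on_sum)

lemma smooth_on_scaleR:
  "open S \<Longrightarrow> smooth_on S f \<Longrightarrow> smooth_on S g \<Longrightarrow> smooth_on S (\<lambda>x. f x *\<^sub>R g x)"
  by (simp add: smooth_on_def Ck_on_bilinear[OF bounded_bilinear_scaleR])

lemma smooth_on_mult:
  fixes f g :: "'a::euclidean_space \<Rightarrow> real"
  shows "open S \<Longrightarrow> smooth_on S f \<Longrightarrow> smooth_on S g \<Longrightarrow> smooth_on S (\<lambda>x. f x * g x)"
  by (simp add: smooth_on_def Ck_on_bilinear[OF bounded_bilinear_mult])

lemma smooth_on_inner:
  "open S \<Longrightarrow> smooth_on S f \<Longrightarrow> smooth_on S (\<lambda>x. f x \<bullet> b)"
  by (rule smooth_on_bounded_linear[OF bounded_linear_inner_left])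

lemma smooth_on_fst: "open S \<Longrightarrow> smooth_on S f \<Longrightarrow> smooth_on S (\<lambda>x. fst (f x))"
  by (rule smooth_on_bounded_linear[OF bounded_linear_fst])

lemma smooth_on_snd: "open S \<Longrightarrow> smooth_on S f \<Longrightarrow> smooth_on S (\<lambda>x. snd (f x))"
  by (rule smooth_on_bounded_linear[OF bounded_linear_snd])

lemma smooth_on_Pair:
  "open S \<Longrightarrow> smooth_on S f \<Longrightarrow> smooth_on S g \<Longrightarrow> smooth_on S (\<lambda>x. (f x, g x))"
  by (simp add: smooth_on_def Ck_on_Pair)

lemma smooth_on_compose:
  fixes f :: "'a::euclidean_space \<Rightarrow> 'b::euclidean_space" and g :: "'b \<Rightarrow> 'c::real_normed_vector"
  assumes "open S" "open T" "smooth_on S f" "smooth_on T g" "f ` S \<subseteq> T"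
  shows "smooth_on S (\<lambda>x. g (f x))"
  unfolding smooth_on_def
proof
  fix k
  show "Ck_on k S (\<lambda>x. g (f x))"
    by (rule Ck_on_compose[OF assms(1,2) _ _ assms(5)]) (use assms(3,4) in \<open>auto simp: smooth_on_def\<close>)
qed

lemma smooth_on_has_derivative:
  "open S \<Longrightarrow> smooth_on S f \<Longrightarrow> x \<in> S \<Longrightarrow> (f has_derivative frechet_derivative f (at x)) (at x)"
  unfolding smooth_on_def using Ck_on_SucD(1) by blast

lemma smooth_on_differentiable:
  "open S \<Longrightarrow> smooth_on S f \<Longrightarrow> x \<in> S \<Longrightarrow> f differentiable (at x)"
  using smooth_on_has_derivative differentiableI by blast

lemma smooth_on_linear_derivative:
  "open S \<Longrightarrow> smooth_on S f \<Longrightarrow> x \<in> S \<Longrightarrow> linear (frechet_derivative f (at x))"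
  using smooth_on_has_derivative has_derivative_linear by blast

lemma frechet_derivative_bounded_linear: "bounded_linear f \<Longrightarrow> frechet_derivative f (at x) = f"
  using frechet_derivative_at[OF bounded_linear_imp_has_derivative] by metis

lemma frechet_derivative_fst: "frechet_derivative fst (at x) = fst"
  by (rule frechet_derivative_bounded_linear[OF bounded_linear_fst])

lemma frechet_derivative_snd: "frechet_derivative snd (at x) = snd"
  by (rule frechet_derivative_bounded_linear[OF bounded_linear_snd])

lemma smooth_on_derivative:
  "open S \<Longrightarrow> smooth_on S f \<Longrightarrow> smooth_on S (\<lambda>x. frechet_derivative f (at x) v)"
  unfolding smooth_on_def using Ck_on_SucD(2) by blast

lemma smooth_on_continuous_on: "smooth_on S f \<Longrightarrow> continuous_on S f"
  unfolding smooth_on_def by (metis Ck_on.simps(1))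

section \<open>Families of linear maps depending smoothly on a parameter\<close>

text \<open>Smoothness is given for each fixed \<open>h\<close>. Linearity upgrades it to joint
  smoothness, because \<open>K x\<close> is determined by its values on the finitely many basis
  vectors.\<close>

lemma smooth_on_linear_apply:
  fixes K :: "'a::euclidean_space \<Rightarrow> 'b::euclidean_space \<Rightarrow> 'c::real_normed_vector"
    and a :: "'d::euclidean_space \<Rightarrow> 'a"
  assumes "open S" "open T" "\<And>x. x \<in> S \<Longrightarrow> linear (K x)" "\<And>h. smooth_on S (\<lambda>x. K x h)"
    and "smooth_on T a" "smooth_on T g" "a ` T \<subseteq> S"
  shows "smooth_on T (\<lambda>z. K (a z) (g z))"
proof -
  have "K (a z) (g z) = (\<Sum>b\<in>Basis. (g z \<bullet> b) *\<^sub>R K (a z) b)" if "z \<in> T" for z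
    using linear_eq_sum_Basis[OF assms(3)] that assms(7) by blast
  moreover have "smooth_on T (\<lambda>z. \<Sum>b\<in>Basis. (g z \<bullet> b) *\<^sub>R K (a z) b)"
    using assms smooth_on_compose[OF assms(2,1,5) assms(4) assms(7)]
    by (intro smooth_on_sum smooth_on_scaleR smooth_on_inner) auto
  ultimately show ?thesis using smooth_on_cong[of T "\<lambda>z. K (a z) (g z)"] by simp
qed

lemma frechet_derivative_linear_param:
  fixes K :: "'a::euclidean_space \<Rightarrow> 'b::euclidean_space \<Rightarrow> 'c::real_normed_vector"
  assumes "open S" "\<And>x. x \<in> S \<Longrightarrow> linear (K x)" "\<And>h. smooth_on S (\<lambda>x. K x h)" "x \<in> S"
  shows "frechet_derivative (\<lambda>y. K y h) (at x) w =
    (\<Sum>b\<in>Basis. (h \<bullet> b) *\<^sub>R frechet_derivative (\<lambda>y. K y b) (at x) w)"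
proof -
  have D: "((\<lambda>y. K y h) has_derivative frechet_derivative (\<lambda>y. K y h) (at x)) (at x)" for h
    using smooth_on_has_derivative assms(1,3,4) .
  have "((\<lambda>y. \<Sum>b\<in>Basis. (h \<bullet> b) *\<^sub>R K y b) has_derivative
     (\<lambda>w. \<Sum>b\<in>Basis. (h \<bullet> b) *\<^sub>R frechet_derivative (\<lambda>y. K y b) (at x) w)) (at x)"
    by (rule has_derivative_sum has_derivative_scaleR_right[OF D])+
  then have "((\<lambda>y. K y h) has_derivative
     (\<lambda>w. \<Sum>b\<in>Basis. (h \<bullet> b) *\<^sub>R frechet_derivative (\<lambda>y. K y b) (at x) w)) (at x)"
    by (rule has_derivative_transform_within_open[OF _ assms(1,4)])
      (use linear_eq_sum_Basis[OF assms(2)] in metis)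
  from frechet_derivative_at[OF this] show ?thesis by metis
qed

lemma linear_frechet_derivative_param:
  fixes K :: "'a::euclidean_space \<Rightarrow> 'b::euclidean_space \<Rightarrow> 'c::real_normed_vector"
  assumes "open S" "\<And>x. x \<in> S \<Longrightarrow> linear (K x)" "\<And>h. smooth_on S (\<lambda>x. K x h)" "x \<in> S"
  shows "linear (\<lambda>h. frechet_derivative (\<lambda>y. K y h) (at x) w)"
  by (subst frechet_derivative_linear_param[OF assms])
    (auto intro!: linear_compose_sum linearI simp: inner_add_left scaleR_add_left)

text \<open>A product rule for the pairing of \<open>K\<close> with its argument, obtained by
  expanding \<open>g z\<close> in the basis.\<close>

lemma has_derivative_linear_apply:
  fixes K :: "'a::euclidean_space \<Rightarrow> 'b::euclidean_space \<Rightarrow> 'c::real_normed_vector"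
  assumes "open S" "\<And>x. x \<in> S \<Longrightarrow> linear (K x)" "\<And>h. smooth_on S (\<lambda>x. K x h)" "a z \<in> S"
    and "(a has_derivative a') (at z)" "(g has_derivative g') (at z)"
  shows "((\<lambda>z. K (a z) (g z)) has_derivative
    (\<lambda>v. frechet_derivative (\<lambda>y. K y (g z)) (at (a z)) (a' v) + K (a z) (g' v))) (at z)"
proof -
  have D: "((\<lambda>y. K y h) has_derivative frechet_derivative (\<lambda>y. K y h) (at (a z))) (at (a z))" for h
    using smooth_on_has_derivative assms(1,3,4) .
  have Da: "((\<lambda>z. K (a z) h) has_derivative
      (\<lambda>v. frechet_derivative (\<lambda>y. K y h) (at (a z)) (a' v))) (at z)" for h
    by (rule has_derivative_compose[OF assms(5) D])
  have "((\<lambda>z. \<Sum>b\<in>Basis. (g z \<bullet> b) *\<^sub>R K (a z) b) has_derivative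
     (\<lambda>v. \<Sum>b\<in>Basis. (g z \<bullet> b) *\<^sub>R frechet_derivative (\<lambda>y. K y b) (at (a z)) (a' v) +
        (g' v \<bullet> b) *\<^sub>R K (a z) b)) (at z)"
    by (rule has_derivative_sum has_derivative_scaleR[OF has_derivative_inner_left[OF assms(6)] Da])+
  moreover have "K (a z) (g' v) = (\<Sum>b\<in>Basis. (g' v \<bullet> b) *\<^sub>R K (a z) b)" for v
    by (rule linear_eq_sum_Basis[OF assms(2)[OF assms(4)]])
  ultimately have D': "((\<lambda>z. \<Sum>b\<in>Basis. (g z \<bullet> b) *\<^sub>R K (a z) b) has_derivative
    (\<lambda>v. frechet_derivative (\<lambda>y. K y (g z)) (at (a z)) (a' v) + K (a z) (g' v))) (at z)"
    by (simp add: frechet_derivative_linear_param[OF assms(1-4), of "g z"] sum.distrib)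
  \<comment> \<open>Linearity of \<open>K (a z)\<close> is known for \<open>a z\<close> in
    \<open>S\<close>; continuity of \<open>a\<close> keeps nearby points there.\<close>
  have "eventually (\<lambda>w. a w \<in> S) (at z)"
    using has_derivative_continuous[OF assms(5)] assms(1,4)
    by (simp add: continuous_within topological_tendstoD)
  then have "eventually (\<lambda>z. (\<Sum>b\<in>Basis. (g z \<bullet> b) *\<^sub>R K (a z) b) = K (a z) (g z)) (at z)"
    by eventually_elim (rule linear_eq_sum_Basis[OF assms(2), symmetric])
  from has_derivative_transform_eventually[OF D' this] show ?thesis
    using linear_eq_sum_Basis[OF assms(2)[OF assms(4)], of "g z"] by simp
qed

text \<open>Differentiating \<open>K\<^sub>x (J\<^sub>x y) = y\<close> expresses the derivative of \<open>J\<close> through \<open>J\<close> itself and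
  derivatives of \<open>K\<close>, so \<open>J\<close> gains one degree of regularity at a time.\<close>

lemma smooth_on_linear_inverse:
  fixes K J :: "'a::euclidean_space \<Rightarrow> 'b::euclidean_space \<Rightarrow> 'b"
  assumes "open S" and lin: "\<And>x. x \<in> S \<Longrightarrow> linear (K x)" and smooth: "\<And>h. smooth_on S (\<lambda>x. K x h)"
    and JK: "\<And>x y. x \<in> S \<Longrightarrow> J x (K x y) = y"
  shows "smooth_on (S \<times> UNIV) (\<lambda>z. J (fst z) (snd z))"
proof -
  define T where "T = S \<times> (UNIV :: 'b set)"
  define g where "g z = J (fst z) (snd z)" for z
  define D where "D b z w = frechet_derivative (\<lambda>y. K y b) (at (fst z)) w" for b and z :: "'a \<times> 'b" and w
  define E where "E z w = frechet_derivative (\<lambda>y. K y (g z)) (at (fst z)) w" for z w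
  have "open T" using \<open>open S\<close> by (simp add: T_def open_Times)
  \<comment> \<open>\<open>J\<close> is given as a left inverse; as source and target of
    \<open>K x\<close> have the same finite dimension, it is two-sided.\<close>
  have KJ: "K x (J x y) = y" if "x \<in> S" for x y
  proof -
    have "inj (K x)" using JK[OF that] by (metis injI)
    then have "surj (K x)" using lin[OF that] linear_injective_imp_surjective by blast
    then show ?thesis using JK[OF that] by (metis surjD)
  qed
  have fst_T: "fst z \<in> S" if "z \<in> T" for z using that by (auto simp: T_def)
  have g_diff: "(g has_derivative (\<lambda>v. g (fst z, snd v - E z (fst v)))) (at z)" if z: "z \<in> T" for z
  proof -
    \<comment> \<open>\<open>f\<close> is the fibrewise map over the identity and \<open>G\<close>
      its inverse, to be differentiated by the inverse function theorem. The candidate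
      \<open>g'\<close> solves the triangular system \<open>f' (g' v) = v\<close>: the base
      component is kept, and the fibre component is \<open>J\<close> applied to what
      remains.\<close>
    define f where "f w = (fst w, K (fst w) (snd w))" for w
    define G where "G z = (fst z, g z)" for z :: "'a \<times> 'b"
    define f' where "f' v = (fst v, E z (fst v) + K (fst z) (snd v))" for v
    define g' where "g' v = (fst v, g (fst z, snd v - E z (fst v)))" for v
    have "smooth_on T f" unfolding f_def
      by (rule smooth_on_Pair[OF \<open>open T\<close>] smooth_on_linear_apply[OF \<open>open S\<close> \<open>open T\<close> lin smooth]
          smooth_on_fst smooth_on_snd smooth_on_ident \<open>open T\<close> | assumption | auto simp: T_def)+
    then have "continuous_on T f" by (rule smooth_on_continuous_on)
    moreover have "G (f w) = w" if "w \<in> T" for w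
      using that JK fst_T by (simp add: G_def f_def g_def)
    moreover have "(f has_derivative f') (at (G z))"
    proof -
      have fz: "fst (G z) \<in> S" using fst_T[OF z] by (simp add: G_def)
      have "((\<lambda>w. K (fst w) (snd w)) has_derivative
        (\<lambda>v. frechet_derivative (\<lambda>y. K y (snd (G z))) (at (fst (G z))) (fst v) +
            K (fst (G z)) (snd v))) (at (G z))"
        by (rule has_derivative_linear_apply[where a = fst and z = "G z" and K =
            K, OF \<open>open S\<close> lin smooth fz])
          (auto intro!: derivative_eq_intros)
      then have "((\<lambda>w. K (fst w) (snd w)) has_derivative
          (\<lambda>v. E z (fst v) + K (fst z) (snd v))) (at (G z))"
        by (simp add: G_def E_def)
      moreover have "(fst has_derivative fst) (at (G z))"
        by (auto intro!: derivative_eq_intros)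
      ultimately show ?thesis
        unfolding f_def[abs_def] f'_def[abs_def] by (intro has_derivative_Pair)
    qed
    moreover have "f' \<circ> g' = id"
      using KJ[OF fst_T[OF z]] by (auto simp: f'_def g'_def g_def)
    moreover have "f (G z) = z"
      using KJ[OF fst_T[OF z]] by (simp add: f_def G_def g_def)
    moreover have "G z \<in> T" using z by (auto simp: G_def T_def)
    ultimately have "(G has_derivative g') (at z)"
      using has_derivative_inverse_strong_x[OF \<open>open T\<close>, of G z f f' g'] by blast
    from has_derivative_snd[OF this] show ?thesis by (simp add: G_def g'_def)
  qed
  have D_smooth: "smooth_on T (\<lambda>z. D b z w)" for b w
    unfolding D_def
    by (rule smooth_on_compose[OF \<open>open T\<close> \<open>open S\<close> smooth_on_fst smooth_on_derivative])
      (use fst_T in \<open>auto simp: \<open>open S\<close> \<open>open T\<close> smooth smooth_on_ident\<close>)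
  have "Ck_on k T g" for k
  proof (induction k)
    case 0
    have "isCont g z" if "z \<in> T" for z using has_derivative_continuous[OF g_diff[OF that]] .
    then show ?case by (simp add: continuous_at_imp_continuous_on)
  next
    case (Suc k)
    \<comment> \<open>The derivative of \<open>g\<close> is \<open>g\<close> composed with a map
      that involves \<open>g\<close> undifferentiated, so the induction hypothesis is used for both
      the outer and the inner map.\<close>
    have "Ck_on k T (\<lambda>z. g (fst z, snd v - E z (fst v)))" for v
    proof (rule Ck_on_compose[OF \<open>open T\<close> \<open>open T\<close> _ Suc.IH])
      have "Ck_on k T (\<lambda>z. - (\<Sum>b\<in>Basis. (g z \<bullet> b) *\<^sub>R D b z (fst v)))"
        using D_smooth Suc.IH \<open>open T\<close>
        by (intro Ck_on_bounded_linear[OF bounded_linear_minus[OF bounded_linear_ident]]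
            Ck_on_sum Ck_on_bilinear[OF bounded_bilinear_scaleR]
            Ck_on_bounded_linear[OF bounded_linear_inner_left]) (auto simp: smooth_on_def)
      then have "Ck_on k T (\<lambda>z. (fst z, snd v + - (\<Sum>b\<in>Basis. (g z \<bullet> b) *\<^sub>R D b z (fst v))))"
        by (intro Ck_on_Pair[OF \<open>open T\<close>] Ck_on_add[OF \<open>open T\<close>] Ck_on_const[OF \<open>open T\<close>]
            Ck_on_bounded_linear[OF bounded_linear_fst \<open>open T\<close> Ck_on_ident[OF \<open>open T\<close>]])
      moreover have "(fst z, snd v + - (\<Sum>b\<in>Basis. (g z \<bullet> b) *\<^sub>R D b z (fst v))) =
          (fst z, snd v - E z (fst v))" if "z \<in> T" for z
        by (simp add: E_def D_def frechet_derivative_linear_param[OF \<open>open S\<close> lin smooth fst_T[OF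
            that], of "g z"])
      ultimately show "Ck_on k T (\<lambda>z. (fst z, snd v - E z (fst v)))"
        by (rule iffD1[OF Ck_on_cong, rotated])
    qed (auto simp: T_def)
    then show ?case by (rule Ck_on_SucI[OF \<open>open T\<close> g_diff, rotated])
  qed
  then show ?thesis by (simp add: smooth_on_def g_def[abs_def] T_def)
qed

section \<open>Symmetry of second derivatives\<close>

lemma has_real_derivative_along_line:
  assumes "(f has_derivative f') (at (a + s *\<^sub>R h))"
  shows "((\<lambda>s. f (a + s *\<^sub>R h)) has_real_derivative f' h) (at s)"
proof -
  have "((\<lambda>s. a + s *\<^sub>R h) has_derivative (\<lambda>r. r *\<^sub>R h)) (at s)"
    by (auto intro!: derivative_eq_intros)
  from has_derivative_compose[OF this assms]
  have "((\<lambda>s. f (a + s *\<^sub>R h)) has_derivative (\<lambda>r. f' (r *\<^sub>R h))) (at s)" .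
  moreover have "(\<lambda>r. f' (r *\<^sub>R h)) = (*) (f' h)"
    using linear_scale[OF has_derivative_linear[OF assms]] by (auto simp: mult.commute)
  ultimately show ?thesis by (simp add: has_field_derivative_def)
qed

text \<open>The second difference is symmetric in \<open>h\<close> and \<open>k\<close>; this yields the symmetry of second
  derivatives.\<close>

lemma second_difference_tendsto:
  fixes f :: "'a::euclidean_space \<Rightarrow> real"
  assumes "open S" "smooth_on S f" "x \<in> S"
  shows "((\<lambda>t. (f (x + t *\<^sub>R h + t *\<^sub>R k) - f (x + t *\<^sub>R h) - f (x + t *\<^sub>R k) + f x) / t\<^sup>2) \<longlongrightarrow>
    frechet_derivative (\<lambda>y. frechet_derivative f (at y) h) (at x) k) (at_right 0)"
proof -
  define F where "F y = frechet_derivative f (at y) h" for y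
  define G where "G y = frechet_derivative F (at y) k" for y
  have F: "smooth_on S F" unfolding F_def using assms smooth_on_derivative by blast
  then have "smooth_on S G" unfolding G_def using assms smooth_on_derivative by blast
  then have "isCont G x"
    using assms smooth_on_continuous_on continuous_on_eq_continuous_at by blast
  have "\<forall>\<^sub>F t in at_right 0. dist ((f (x + t *\<^sub>R h + t *\<^sub>R k) - f (x + t *\<^sub>R h) - f (x + t *\<^sub>R k) +
      f x) / t\<^sup>2)
      (G x) < e" if "e > 0" for e
  proof -
    obtain d where d: "d > 0" "\<And>y. dist y x < d \<Longrightarrow> dist (G y) (G x) < e"
      using \<open>isCont G x\<close> \<open>e > 0\<close> unfolding continuous_at_eps_delta dist_norm by blast
    obtain d' where d': "d' > 0" "ball x d' \<subseteq> S" using assms open_contains_ball by blast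
    \<comment> \<open>With this bound all points \<open>x + a *\<^sub>R h + b *\<^sub>R k\<close>
      with \<open>a\<close>, \<open>b\<close> in \<open>[0, r)\<close> lie in \<open>S\<close> and
      in the ball where \<open>G\<close> differs from \<open>G x\<close> by less than
      \<open>e\<close>.\<close>
    define r where "r = min d d' / (norm h + norm k + 1)"
    have pos: "norm h + norm k + 1 > 0" by (simp add: add_nonneg_pos)
    have "r > 0" using d d' pos by (simp add: r_def)
    have near: "dist (x + a *\<^sub>R h + b *\<^sub>R k) x < min d d'"
      if "0 \<le> a" "a < r" "0 \<le> b" "b < r" for a b
    proof -
      have "norm (a *\<^sub>R h + b *\<^sub>R k) \<le> a * norm h + b * norm k"
        using norm_triangle_ineq[of "a *\<^sub>R h" "b *\<^sub>R k"] that by simp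
      also have "\<dots> \<le> r * norm h + r * norm k"
        using that by (intro add_mono mult_right_mono) auto
      also have "\<dots> < r * (norm h + norm k + 1)" using \<open>r > 0\<close> by (simp add: algebra_simps)
      also have "\<dots> = min d d'" using pos by (simp add: r_def)
      finally show ?thesis by (simp add: dist_norm add.assoc)
    qed
    have inS: "x + a *\<^sub>R h + b *\<^sub>R k \<in> S" if "0 \<le> a" "a < r" "0 \<le> b" "b < r" for a b
      using near[OF that] d'(2) by (auto simp: dist_commute)
    have "dist ((f (x + t *\<^sub>R h + t *\<^sub>R k) - f (x + t *\<^sub>R h) - f (x + t *\<^sub>R k) + f x) / t\<^sup>2) (G x) < e"
      if t: "0 < t" "t < r" for t
    proof -
      \<comment> \<open>The second difference is the increment along \<open>h\<close> of the
        difference along \<open>k\<close>. The mean value theorem resolves the increment along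
        \<open>h\<close>, and a second application below the one along \<open>k\<close>.\<close>
      have "((\<lambda>s. f (x + t *\<^sub>R k + s *\<^sub>R h) - f (x + s *\<^sub>R h)) has_real_derivative
          F (x + t *\<^sub>R k + s *\<^sub>R h) - F (x + s *\<^sub>R h)) (at s)" if "0 \<le> s" "s \<le> t" for s
        unfolding F_def
        using inS[of s t] inS[of s 0] that t
        by (intro DERIV_diff has_real_derivative_along_line
            smooth_on_has_derivative[OF assms(1,2)]) (auto simp: algebra_simps)
      from MVT2[OF \<open>0 < t\<close> this] obtain s where s: "0 < s" "s < t"
        and eq1: "(f (x + t *\<^sub>R k + t *\<^sub>R h) - f (x + t *\<^sub>R h)) - (f (x + t *\<^sub>R k) - f x) =
          t * (F (x + t *\<^sub>R k + s *\<^sub>R h) - F (x + s *\<^sub>R h))" by auto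
      have "((\<lambda>u. F (x + s *\<^sub>R h + u *\<^sub>R k)) has_real_derivative G (x + s *\<^sub>R h + u *\<^sub>R k)) (at u)"
        if "0 \<le> u" "u \<le> t" for u
        unfolding G_def
        using inS[of s u] that t s
        by (intro has_real_derivative_along_line smooth_on_has_derivative[OF assms(1) F]) auto
      from MVT2[OF \<open>0 < t\<close> this] obtain u where u: "0 < u" "u < t"
        and eq2: "F (x + s *\<^sub>R h + t *\<^sub>R k) - F (x + s *\<^sub>R h) = t * G (x + s *\<^sub>R h + u *\<^sub>R k)" by auto
      have "f (x + t *\<^sub>R h + t *\<^sub>R k) - f (x + t *\<^sub>R h) - f (x + t *\<^sub>R k) + f x =
          t\<^sup>2 * G (x + s *\<^sub>R h + u *\<^sub>R k)"
        using eq1 eq2 by (simp add: algebra_simps power2_eq_square)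
      then show ?thesis using d(2) near[of s u] t s u by simp
    qed
    then show ?thesis using \<open>r > 0\<close> by (auto simp: eventually_at_right)
  qed
  then show ?thesis unfolding tendsto_iff G_def F_def by blast
qed

lemma second_derivative_symmetric_real:
  fixes f :: "'a::euclidean_space \<Rightarrow> real"
  assumes "open S" "smooth_on S f" "x \<in> S"
  shows "frechet_derivative (\<lambda>y. frechet_derivative f (at y) h) (at x) k =
    frechet_derivative (\<lambda>y. frechet_derivative f (at y) k) (at x) h"
proof (rule tendsto_unique)
  show "((\<lambda>t. (f (x + t *\<^sub>R h + t *\<^sub>R k) - f (x + t *\<^sub>R h) - f (x + t *\<^sub>R k) + f x) / t\<^sup>2) \<longlongrightarrow>
    frechet_derivative (\<lambda>y. frechet_derivative f (at y) h) (at x) k) (at_right 0)"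
    by (rule second_difference_tendsto[OF assms])
  show "((\<lambda>t. (f (x + t *\<^sub>R h + t *\<^sub>R k) - f (x + t *\<^sub>R h) - f (x + t *\<^sub>R k) + f x) / t\<^sup>2) \<longlongrightarrow>
    frechet_derivative (\<lambda>y. frechet_derivative f (at y) k) (at x) h) (at_right 0)"
    using second_difference_tendsto[OF assms, of k h] by (simp add: algebra_simps)
qed simp

lemma frechet_derivative_inner:
  "f differentiable (at x) \<Longrightarrow>
    frechet_derivative (\<lambda>y. f y \<bullet> b) (at x) v = frechet_derivative f (at x) v \<bullet> b"
  using frechet_derivative_at[OF has_derivative_inner_left] frechet_derivative_works by metis

text \<open>Reduction to real values: pairing with a basis vector \<open>b\<close> commutes with
  both derivatives.\<close>

lemma second_derivative_symmetric:
  fixes f :: "'a::euclidean_space \<Rightarrow> 'b::euclidean_space"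
  assumes "open S" "smooth_on S f" "x \<in> S"
  shows "frechet_derivative (\<lambda>y. frechet_derivative f (at y) h) (at x) k =
    frechet_derivative (\<lambda>y. frechet_derivative f (at y) k) (at x) h"
proof (rule euclidean_eqI)
  fix b :: 'b
  have "frechet_derivative (\<lambda>y. frechet_derivative f (at y) h) (at x) k \<bullet> b =
    frechet_derivative (\<lambda>y. frechet_derivative (\<lambda>z. f z \<bullet> b) (at y) h) (at x) k" for h k
  proof -
    have "((\<lambda>y. frechet_derivative f (at y) h \<bullet> b) has_derivative
      (\<lambda>k. frechet_derivative (\<lambda>y. frechet_derivative f (at y) h) (at x) k \<bullet> b)) (at x)"
      using assms smooth_on_derivative
      by (intro has_derivative_inner_left smooth_on_has_derivative) blast+
    then have "((\<lambda>y. frechet_derivative (\<lambda>z. f z \<bullet> b) (at y) h) has_derivative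
      (\<lambda>k. frechet_derivative (\<lambda>y. frechet_derivative f (at y) h) (at x) k \<bullet> b)) (at x)"
      by (rule has_derivative_transform_within_open[OF _ assms(1,3)])
        (use smooth_on_differentiable[OF assms(1,2)] in \<open>simp add: frechet_derivative_inner\<close>)
    from frechet_derivative_at[OF this] show ?thesis by metis
  qed
  then show "frechet_derivative (\<lambda>y. frechet_derivative f (at y) h) (at x) k \<bullet> b =
    frechet_derivative (\<lambda>y. frechet_derivative f (at y) k) (at x) h \<bullet> b"
    using second_derivative_symmetric_real[OF assms(1) smooth_on_inner[OF assms(1,2)] assms(3)] by metis
qed

section \<open>Alternating forms and nondegeneracy\<close>

text \<open>Arguments are infinite sequences. The second conjunct allows entries of index
  \<open>k\<close> and beyond to be changed, as happens when \<open>wedge\<close> distributes one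
  sequence over two factors.\<close>

definition multilinear_form :: "nat \<Rightarrow> ((nat \<Rightarrow> 'v::real_vector) \<Rightarrow> real) \<Rightarrow> bool" where
  "multilinear_form k \<alpha> \<longleftrightarrow>
     (\<forall>i<k. \<forall>v. linear (\<lambda>x. \<alpha> (v(i := x)))) \<and>
     (\<forall>v w. (\<forall>i<k. v i = w i) \<longrightarrow> \<alpha> v = \<alpha> w)"

lemma multilinear_formD:
  assumes "multilinear_form k \<alpha>"
  shows "i < k \<Longrightarrow> linear (\<lambda>x. \<alpha> (v(i := x)))"
    and "(\<And>i. i < k \<Longrightarrow> v i = w i) \<Longrightarrow> \<alpha> v = \<alpha> w"
  using assms by (auto simp: multilinear_form_def)

text \<open>In each summand the permutation puts entry \<open>i\<close> into exactly one slot,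
  \<open>inv \<sigma> i\<close>. That slot belongs to \<alpha> or to \<beta>, and the other factor
  does not see the entry.\<close>

lemma multilinear_form_wedge:
  assumes \<alpha>: "multilinear_form k \<alpha>" and \<beta>: "multilinear_form l \<beta>"
  shows "multilinear_form (k + l) (wedge k l \<alpha> \<beta>)"
  unfolding multilinear_form_def
proof (intro conjI allI impI)
  fix i v assume i: "i < k + l"
  have "linear (\<lambda>x. of_int (sign \<sigma>) * \<alpha> (\<lambda>j. (v(i := x)) (\<sigma> j)) * \<beta> (\<lambda>j. (v(i := x)) (\<sigma> (k + j))))"
    if \<sigma>: "\<sigma> permutes {..<k + l}" for \<sigma>
  proof -
    define m where "m = inv \<sigma> i"
    have m: "\<sigma> j = i \<longleftrightarrow> j = m" for j
      using permutes_inverses[OF \<sigma>] unfolding m_def by metis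
    have "m < k + l" using permutes_in_image[OF permutes_inv[OF \<sigma>], of i] i by (simp add: m_def)
    then consider "m < k" | "m \<ge> k" "m - k < l" by linarith
    then show ?thesis
    proof cases
      case 1
      have "(\<lambda>j. (v(i := x)) (\<sigma> j)) = (\<lambda>j. v (\<sigma> j))(m := x)" for x using m by auto
      moreover have "(\<lambda>j. (v(i := x)) (\<sigma> (k + j))) = (\<lambda>j. v (\<sigma> (k + j)))" for x using 1 m by auto
      ultimately show ?thesis
        using multilinear_formD(1)[OF \<alpha> 1, of "\<lambda>j. v (\<sigma> j)"]
        by (auto simp: linear_iff algebra_simps)
    next
      case 2
      have "\<alpha> (\<lambda>j. (v(i := x)) (\<sigma> j)) = \<alpha> (\<lambda>j. v (\<sigma> j))" for x
        by (rule multilinear_formD(2)[OF \<alpha>]) (use 2 m in auto)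
      moreover have "(\<lambda>j. (v(i := x)) (\<sigma> (k + j))) = (\<lambda>j. v (\<sigma> (k + j)))(m - k := x)" for x
        using m 2 by (auto simp: fun_eq_iff)
      ultimately show ?thesis
        using multilinear_formD(1)[OF \<beta> 2(2), of "\<lambda>j. v (\<sigma> (k + j))"]
        by (auto simp: linear_iff algebra_simps)
    qed
  qed
  then have "linear (\<lambda>x. \<Sum>\<sigma> | \<sigma> permutes {..<k + l}. of_int (sign \<sigma>) *
      \<alpha> (\<lambda>j. (v(i := x)) (\<sigma> j)) * \<beta> (\<lambda>j. (v(i := x)) (\<sigma> (k + j))))"
    by (intro linear_compose_sum) auto
  then show "linear (\<lambda>x. wedge k l \<alpha> \<beta> (v(i := x)))"
    unfolding wedge_def linear_iff by (simp add: add_divide_distrib)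
next
  fix v w :: "nat \<Rightarrow> 'a" assume vw: "\<forall>i<k + l. v i = w i"
  have "of_int (sign \<sigma>) * \<alpha> (\<lambda>j. v (\<sigma> j)) * \<beta> (\<lambda>j. v (\<sigma> (k + j))) =
      of_int (sign \<sigma>) * \<alpha> (\<lambda>j. w (\<sigma> j)) * \<beta> (\<lambda>j. w (\<sigma> (k + j)))"
    if \<sigma>: "\<sigma> permutes {..<k + l}" for \<sigma>
  proof -
    have "\<sigma> j < k + l" if "j < k + l" for j using permutes_in_image[OF \<sigma>, of j] that by simp
    then have "\<alpha> (\<lambda>j. v (\<sigma> j)) = \<alpha> (\<lambda>j. w (\<sigma> j))" "\<beta> (\<lambda>j. v (\<sigma> (k + j))) = \<beta> (\<lambda>j. w (\<sigma> (k + j)))"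
      using vw by (auto intro!: multilinear_formD(2)[OF \<alpha>] multilinear_formD(2)[OF \<beta>])
    then show ?thesis by simp
  qed
  then show "wedge k l \<alpha> \<beta> v = wedge k l \<alpha> \<beta> w"
    unfolding wedge_def by (intro arg_cong2[where f = "(/)"] sum.cong) auto
qed

text \<open>Composing every permutation with the transposition of \<open>i\<close> and
  \<open>j\<close> keeps the arguments and flips the sign, so the sum equals its own
  negative.\<close>

lemma wedge_alternating:
  assumes "i < k + l" "j < k + l" "i \<noteq> j" "v i = v j"
  shows "wedge k l \<alpha> \<beta> v = 0"
proof -
  define \<tau> where "\<tau> = Transposition.transpose i j"
  define f where "f \<sigma> = of_int (sign \<sigma>) * \<alpha> (\<lambda>i. v (\<sigma> i)) * \<beta> (\<lambda>i. v (\<sigma> (k + i)))" for \<sigma>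
  have \<tau>: "\<tau> permutes {..<k + l}" using assms by (simp add: \<tau>_def permutes_swap_id)
  have v: "v (\<tau> m) = v m" for m using assms(4) by (auto simp: \<tau>_def Transposition.transpose_def)
  have "sum f {\<sigma>. \<sigma> permutes {..<k + l}} = (\<Sum>\<sigma> | \<sigma> permutes {..<k + l}. f (\<tau> \<circ> \<sigma>))"
    by (rule setum_permutations_compose_left[OF \<tau>])
  also have "\<dots> = (\<Sum>\<sigma> | \<sigma> permutes {..<k + l}. - f \<sigma>)"
  proof (rule sum.cong)
    fix \<sigma> assume "\<sigma> \<in> {\<sigma>. \<sigma> permutes {..<k + l}}"
    then have "permutation \<sigma>" "permutation \<tau>" using \<tau> permutation_permutes by blast+
    then have "sign (\<tau> \<circ> \<sigma>) = - sign \<sigma>"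
      using assms(3) by (simp add: sign_compose \<tau>_def sign_swap_id)
    then show "f (\<tau> \<circ> \<sigma>) = - f \<sigma>" by (simp add: f_def v)
  qed simp
  finally have "sum f {\<sigma>. \<sigma> permutes {..<k + l}} = 0" by (simp add: sum_negf)
  then show ?thesis by (simp add: wedge_def f_def)
qed

text \<open>Whatever the permutation, \<open>e\<close> lands in an argument of one of the two
  factors.\<close>

lemma wedge_kernel:
  assumes "\<And>v i. i < k \<Longrightarrow> v i = e \<Longrightarrow> \<alpha> v = 0" and "\<And>v i. i < l \<Longrightarrow> v i = e \<Longrightarrow> \<beta> v = 0"
    and "i < k + l" "v i = e"
  shows "wedge k l \<alpha> \<beta> v = 0"
proof -
  have "of_int (sign \<sigma>) * \<alpha> (\<lambda>j. v (\<sigma> j)) * \<beta> (\<lambda>j. v (\<sigma> (k + j))) = 0"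
    if \<sigma>: "\<sigma> permutes {..<k + l}" for \<sigma>
  proof -
    define m where "m = inv \<sigma> i"
    have m: "\<sigma> m = i" using permutes_inverses[OF \<sigma>] by (simp add: m_def)
    have "m < k + l" using permutes_in_image[OF permutes_inv[OF \<sigma>], of i] assms(3) by (simp add: m_def)
    then consider "m < k" | "m \<ge> k" "m - k < l" by linarith
    then show ?thesis
      using assms(1)[of m "\<lambda>j. v (\<sigma> j)"] assms(2)[of "m - k" "\<lambda>j. v (\<sigma> (k + j))"] m assms(4)
      by cases auto
  qed
  then show ?thesis by (auto simp: wedge_def intro!: sum.neutral)
qed

text \<open>With \<open>g\<close> a coordinate vector map, this and the next lemma carry the contact
  condition from a tangent space to the model space.\<close>

lemma wedge_comp: "wedge k l \<alpha> \<beta> (\<lambda>i. g (v i)) = wedge k l (\<lambda>w. \<alpha> (\<lambda>i. g (w i))) (\<lambda>w. \<beta> (\<lambda>i. g (w i))) v"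
  by (simp add: wedge_def)

lemma two_form_power_comp:
  "two_form_power \<omega> n (\<lambda>i. g (v i)) = two_form_power (\<lambda>w. \<omega> (\<lambda>i. g (w i))) n v"
proof (induction n arbitrary: v)
  case (Suc n)
  then show ?case by (simp add: wedge_comp)
qed simp

lemma multilinear_form_two_form_power:
  assumes "multilinear_form 2 \<omega>"
  shows "multilinear_form (2 * n) (two_form_power \<omega> n)"
proof (induction n)
  case 0
  then show ?case by (simp add: multilinear_form_def)
next
  case (Suc n)
  then show ?case using multilinear_form_wedge[OF assms Suc] by simp
qed

lemma two_form_power_kernel:
  assumes "\<And>v i. i < 2 \<Longrightarrow> v i = e \<Longrightarrow> \<omega> v = 0" and "i < 2 * n" "v i = e"
  shows "two_form_power \<omega> n v = 0"
  using assms(2,3)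
proof (induction n arbitrary: v i)
  case (Suc n)
  have "wedge 2 (2 * n) \<omega> (two_form_power \<omega> n) v = 0"
    by (rule wedge_kernel[where e = e]) (use assms(1) Suc in auto)
  then show ?case by simp
qed simp

text \<open>If one entry lay in the span of the others, the form would vanish: it is linear in that
  slot and zero whenever the slot repeats another entry.\<close>

lemma independent_if_alternating_nonzero:
  fixes \<Omega> :: "(nat \<Rightarrow> 'v::real_vector) \<Rightarrow> real"
  assumes ml: "multilinear_form m \<Omega>"
    and alt: "\<And>v i j. i < m \<Longrightarrow> j < m \<Longrightarrow> i \<noteq> j \<Longrightarrow> v i = v j \<Longrightarrow> \<Omega> v = 0"
    and "\<Omega> v \<noteq> 0"
  shows "inj_on v {..<m}" and "independent (v ` {..<m})"
proof -
  show inj: "inj_on v {..<m}" using alt \<open>\<Omega> v \<noteq> 0\<close> by (intro inj_onI) blast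
  show "independent (v ` {..<m})"
  proof
    assume "dependent (v ` {..<m})"
    then obtain j where j: "j < m" "v j \<in> span (v ` {..<m} - {v j})" by (auto simp: dependent_def)
    have lin: "linear (\<lambda>x. \<Omega> (v(j := x)))" using multilinear_formD(1)[OF ml j(1)] .
    have "\<Omega> (v(j := x)) = 0" if "x \<in> v ` {..<m} - {v j}" for x
    proof -
      from that obtain i where "i < m" "i \<noteq> j" "x = v i" by auto
      then show ?thesis using alt[of i j "v(j := x)"] j by auto
    qed
    then have "\<Omega> (v(j := x)) = 0" if "x \<in> span (v ` {..<m} - {v j})" for x
      using linear_eq_0_on_span[OF lin _ that] by blast
    from this[OF j(2)] show False using \<open>\<Omega> v \<noteq> 0\<close> by simp
  qed
qed

text \<open>If \<open>\<Omega> v \<noteq> 0\<close>, then \<open>v\<close> is a basis; replacing a suitable \<open>v\<^sub>j\<close> by \<open>e\<close> multiplies \<open>\<Omega> v\<close> by a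
  coordinate of \<open>e\<close>.\<close>

lemma alternating_kernel_trivial:
  fixes \<Omega> :: "(nat \<Rightarrow> 'v::euclidean_space) \<Rightarrow> real"
  assumes ml: "multilinear_form DIM('v) \<Omega>"
    and alt: "\<And>v i j. i < DIM('v) \<Longrightarrow> j < DIM('v) \<Longrightarrow> i \<noteq> j \<Longrightarrow> v i = v j \<Longrightarrow> \<Omega> v = 0"
    and ker: "\<And>v i. i < DIM('v) \<Longrightarrow> v i = e \<Longrightarrow> \<Omega> v = 0"
    and "\<Omega> v \<noteq> 0"
  shows "e = 0"
proof (rule ccontr)
  assume "e \<noteq> 0"
  let ?I = "{..<DIM('v)}"
  have ind: "inj_on v ?I" "independent (v ` ?I)"
    by (rule independent_if_alternating_nonzero[OF ml _ \<open>\<Omega> v \<noteq> 0\<close>], rule alt; assumption)+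
  have "card (v ` ?I) = DIM('v)" using ind(1) by (simp add: card_image)
  then have span: "span (v ` ?I) = UNIV"
    using ind(2) card_ge_dim_independent[of "v ` ?I" "UNIV :: 'v set"] by auto
  have "\<exists>j<DIM('v). \<Omega> (v(j := e)) \<noteq> 0"
  proof (rule ccontr)
    assume none: "\<not> ?thesis"
    have "e \<in> span (v ` ?I)" using span by simp
    then obtain c where c: "e = (\<Sum>x\<in>v ` ?I. c x *\<^sub>R x)"
      by (auto simp: span_finite)
    then have e: "e = (\<Sum>i\<in>?I. c (v i) *\<^sub>R v i)" by (simp add: sum.reindex[OF ind(1)])
    have "c (v j) = 0" if j: "j < DIM('v)" for j
    proof -
      have lin: "linear (\<lambda>x. \<Omega> (v(j := x)))" using multilinear_formD(1)[OF ml j] .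
      have "\<Omega> (v(j := e)) = (\<Sum>i\<in>?I. c (v i) * \<Omega> (v(j := v i)))"
        by (subst e) (simp add: linear_sum[OF lin] linear_scale[OF lin])
      also have "\<dots> = (\<Sum>i\<in>?I. if i = j then c (v j) * \<Omega> v else 0)"
        using alt[of _ j "v(j := v _)"] j by (intro sum.cong) auto
      also have "\<dots> = c (v j) * \<Omega> v" using j by simp
      finally show ?thesis using none j \<open>\<Omega> v \<noteq> 0\<close> by simp
    qed
    then show False using e \<open>e \<noteq> 0\<close> by simp
  qed
  then show False using ker[of _ "v(_ := e)"] by auto
qed

section \<open>Nondegenerate skew forms and the contact condition\<close>

text \<open>Symplectic Gram-Schmidt: two vectors that pair to 1 span a plane, and \<omega> stays
  nondegenerate on the orthogonal complement \<open>W\<close> of that plane in \<open>V\<close>,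
  whose dimension is smaller by 2.\<close>

lemma even_dim_if_nondegenerate_skew:
  fixes \<omega> :: "'v::euclidean_space \<Rightarrow> 'v \<Rightarrow> real"
  assumes lin: "\<And>x. linear (\<omega> x)" and skew: "\<And>x y. \<omega> x y = - \<omega> y x"
    and "subspace V" and nondeg: "\<And>x. x \<in> V \<Longrightarrow> (\<And>y. y \<in> V \<Longrightarrow> \<omega> x y = 0) \<Longrightarrow> x = 0"
  shows "even (dim V)"
  using assms(3,4)
proof (induction "dim V" arbitrary: V rule: less_induct)
  case less
  note [simp] = linear_add[OF lin] linear_diff[OF lin] linear_scale[OF lin] linear_0[OF lin]
  have add1: "\<omega> (x + y) z = \<omega> x z + \<omega> y z" and scale1: "\<omega> (c *\<^sub>R x) z = c * \<omega> x z"
    and diff1: "\<omega> (x - y) z = \<omega> x z - \<omega> y z" for x y z c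
    using skew[of _ z] by simp_all
  have self: "\<omega> x x = 0" for x using skew[of x x] by simp
  show ?case
  proof (cases "V \<subseteq> {0}")
    case True
    then have "dim V = 0" by simp
    then show ?thesis by (simp only: even_zero)
  next
    case False
    then obtain e where e: "e \<in> V" "e \<noteq> 0" by auto
    with less.prems(2) obtain f0 where f0: "f0 \<in> V" "\<omega> e f0 \<noteq> 0" by blast
    define f where "f = (1 / \<omega> e f0) *\<^sub>R f0"
    have f: "f \<in> V" "\<omega> e f = 1" using f0 less.prems(1) by (auto simp: f_def subspace_scale)
    have fe: "\<omega> f e = - 1" using skew[of f e] f by simp
    define W where "W = {x \<in> V. \<omega> e x = 0 \<and> \<omega> f x = 0}"
    have subW: "subspace W" using less.prems(1)
      by (auto simp: W_def subspace_def)
    \<comment> \<open>The projection of \<open>V\<close> onto \<open>W\<close> along the plane of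
      \<open>e\<close> and \<open>f\<close>. The signs come from \<open>\<omega> e f = 1\<close> and
      \<open>\<omega> f e = - 1\<close>.\<close>
    define P where "P x = x - \<omega> e x *\<^sub>R f + \<omega> f x *\<^sub>R e" for x
    have PW: "P x \<in> W" if "x \<in> V" for x
      using that e f fe less.prems(1)
      by (auto simp: W_def P_def self intro!: subspace_add subspace_diff subspace_scale)
    have nondegW: "x = 0" if x: "x \<in> W" and 0: "\<And>y. y \<in> W \<Longrightarrow> \<omega> x y = 0" for x
    proof (rule less.prems(2))
      show "x \<in> V" using x by (simp add: W_def)
      fix y assume "y \<in> V"
      have "\<omega> x e = 0" "\<omega> x f = 0" using x skew[of x e] skew[of x f] by (auto simp: W_def)
      \<comment> \<open>Elements of \<open>W\<close> pair to zero with everything that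
        \<open>P\<close> removes, so testing against \<open>W\<close> is as good as testing against
        \<open>V\<close>.\<close>
      then have "\<omega> x (P y) = \<omega> x y" by (simp add: P_def)
      then show "\<omega> x y = 0" using 0[OF PW[OF \<open>y \<in> V\<close>]] by simp
    qed
    obtain B where B: "B \<subseteq> W" "independent B" "W \<subseteq> span B" "card B = dim W"
      using basis_exists[of W] by blast
    have finB: "finite B" using B(2) independent_bound by blast
    have spanB: "span B = W" using B(1,3) subW span_minimal by blast
    have f_notin: "f \<notin> span B" using f by (auto simp: spanB W_def)
    have e_notin: "e \<notin> span (insert f B)"
    proof
      assume "e \<in> span (insert f B)"
      then obtain c where "e - c *\<^sub>R f \<in> W" using span_breakdown_eq[of e f B] spanB by auto
      then show False using fe by (simp add: W_def self)
    qed
    have "independent (insert e (insert f B))"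
      using B(2) f_notin e_notin by (auto simp: independent_insert)
    moreover have "span (insert e (insert f B)) = V"
    proof
      show "span (insert e (insert f B)) \<subseteq> V"
        using B(1) e f less.prems(1) by (intro span_minimal) (auto simp: W_def)
      show "V \<subseteq> span (insert e (insert f B))"
      proof
        fix x assume "x \<in> V"
        have "P x \<in> span B" using PW[OF \<open>x \<in> V\<close>] spanB by simp
        moreover have "span B \<subseteq> span (insert e (insert f B))" by (intro span_mono) auto
        ultimately have "P x + \<omega> e x *\<^sub>R f - \<omega> f x *\<^sub>R e \<in> span (insert e (insert f B))"
          by (intro span_add[OF _ span_scale] span_diff[OF _ span_scale] span_base[of e] span_base[of f])
            auto
        then show "x \<in> span (insert e (insert f B))" by (simp add: P_def)
      qed
    qed
    moreover have "card (insert e (insert f B)) = dim W + 2"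
    proof -
      have "e \<notin> insert f B" "f \<notin> B" using e_notin f_notin span_base by blast+
      then show ?thesis using finB B(4) by simp
    qed
    ultimately have dim: "dim V = dim W + 2"
      by (metis dim_eq_card_independent dim_span)
    then have "even (dim W)" using less.hyps[of W] subW nondegW by simp
    then show ?thesis using dim by simp
  qed
qed

text \<open>As the dimension is odd, \<open>\<omega>\<close> has a kernel vector \<open>k\<close>, and \<open>\<eta> k \<noteq> 0\<close> because a common kernel
  vector of \<open>\<omega>\<close> and \<open>\<eta>\<close> would annihilate the top form. Evaluating the equation for \<open>(v, u)\<close> at
  \<open>k\<close> gives \<open>u = 0\<close>, and then \<open>v\<close> itself is a common kernel vector.\<close>

lemma contact_form_injective:
  fixes \<omega> :: "'v::euclidean_space \<Rightarrow> 'v \<Rightarrow> real" and \<eta> :: "'v \<Rightarrow> real"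
  assumes lin: "\<And>x. linear (\<omega> x)" and skew: "\<And>x y. \<omega> x y = - \<omega> y x" and "linear \<eta>"
    and dim: "DIM('v) = 2 * n + 1"
    and nz: "wedge 1 (2 * n) (\<lambda>w. \<eta> (w 0)) (two_form_power (\<lambda>w. \<omega> (w 0) (w 1)) n) h \<noteq> 0"
    and v: "\<And>w. \<omega> v w + u * \<eta> w = 0" "\<eta> v = 0"
  shows "v = 0 \<and> u = 0"
proof -
  have self: "\<omega> x x = 0" for x using skew[of x x] by simp
  let ?\<Omega> = "wedge 1 (2 * n) (\<lambda>w. \<eta> (w 0)) (two_form_power (\<lambda>w. \<omega> (w 0) (w 1)) n)"
  have lin1: "linear (\<lambda>x. \<omega> x y)" for y
    using linear_compose_neg[OF lin[of y]] skew[of _ y] by simp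
  have m2: "multilinear_form 2 (\<lambda>w. \<omega> (w 0) (w 1))"
    using lin lin1 by (auto simp: multilinear_form_def less_2_cases_iff)
  have m1: "multilinear_form 1 (\<lambda>w. \<eta> (w 0))"
    using \<open>linear \<eta>\<close> by (auto simp: multilinear_form_def)
  have ml: "multilinear_form DIM('v) ?\<Omega>"
    using multilinear_form_wedge[OF m1 multilinear_form_two_form_power[OF m2]] dim by simp
  have trivial: "e = 0" if e: "\<And>w. \<omega> e w = 0" "\<eta> e = 0" for e
  proof (rule alternating_kernel_trivial[OF ml _ _ nz])
    fix v :: "nat \<Rightarrow> 'v" and i j
    show "i < DIM('v) \<Longrightarrow> j < DIM('v) \<Longrightarrow> i \<noteq> j \<Longrightarrow> v i = v j \<Longrightarrow> ?\<Omega> v = 0"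
      using wedge_alternating[of i 1 "2 * n" j v] dim by simp
    \<comment> \<open>By skewness \<open>e\<close> kills the second slot as well, so it may sit in
      either argument of the two-form.\<close>
    have "\<omega> w e = 0" for w using skew[of w e] e by simp
    then have 2: "\<omega> (v 0) (v 1) = 0" if "i < 2" "v i = e" for v :: "nat \<Rightarrow> 'v" and i :: nat
      using that e by (auto simp: less_2_cases_iff)
    have "two_form_power (\<lambda>w. \<omega> (w 0) (w 1)) n v = 0" if "i < 2 * n" "v i = e" for v i
      by (rule two_form_power_kernel[where e = e and v = v and i = i]) (use 2 that in blast)+
    then show "i < DIM('v) \<Longrightarrow> v i = e \<Longrightarrow> ?\<Omega> v = 0"
      using wedge_kernel[of 1 e "\<lambda>w. \<eta> (w 0)" "2 * n" _ i v] dim e by simp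
  qed
  have "\<exists>k. k \<noteq> 0 \<and> (\<forall>w. \<omega> k w = 0)"
  proof (rule ccontr)
    assume "\<not> ?thesis"
    then have "even (dim (UNIV :: 'v set))"
      by (intro even_dim_if_nondegenerate_skew[OF lin skew]) auto
    then show False using dim by simp
  qed
  then obtain k where k: "k \<noteq> 0" "\<And>w. \<omega> k w = 0" by blast
  with trivial have "\<eta> k \<noteq> 0" by blast
  moreover have "\<omega> v k = 0" using skew[of v k] k by simp
  ultimately have "u = 0" using v(1)[of k] by simp
  then show ?thesis using trivial[of v] v by simp
qed

section \<open>Smooth maps between manifolds\<close>

text \<open>Being Hausdorff and second countable plays no role for the bundles, so it is left out here.\<close>

definition smooth_atlas :: "('a, 'e::euclidean_space) atlas \<Rightarrow> bool" where
  "smooth_atlas A \<longleftrightarrow>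
     (\<forall>c\<in>A. inj_on (snd c) (fst c)) \<and>
     (\<forall>c\<in>A. \<forall>c'\<in>A. open (snd c ` (fst c \<inter> fst c')) \<and>
        smooth_on (snd c ` (fst c \<inter> fst c')) (snd c' \<circ> chart_inv c))"

text \<open>\<open>F\<close> must send the whole domain of \<open>c\<close> into \<open>c'\<close>,
  and \<open>f\<close> may be any formula agreeing with \<open>F\<close> in coordinates. This avoids
  expressions with \<open>chart_inv\<close> and restricted domains.\<close>

definition local_representative ::
  "('a, 'e::euclidean_space) chart \<Rightarrow> ('b, 'f::euclidean_space) chart \<Rightarrow> ('a \<Rightarrow> 'b) \<Rightarrow> ('e \<Rightarrow> 'f) \<Rightarrow> bool"
      where
  "local_representative c c' F f \<longleftrightarrow>
     F ` fst c \<subseteq> fst c' \<and> smooth_on (snd c ` fst c) f \<and> (\<forall>p\<in>fst c. snd c' (F p) = f (snd c p))"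

lemma local_representativeI:
  assumes "\<And>p. p \<in> fst c \<Longrightarrow> F p \<in> fst c'" "smooth_on (snd c ` fst c) f"
    and "\<And>p. p \<in> fst c \<Longrightarrow> snd c' (F p) = f (snd c p)"
  shows "local_representative c c' F f"
  using assms by (auto simp: local_representative_def)

lemma smooth_manifold_imp_smooth_atlas: "smooth_manifold A \<Longrightarrow> smooth_atlas A"
  by (simp add: smooth_manifold_def smooth_atlas_def)

lemma chart_inv_snd: "inj_on (snd c) (fst c) \<Longrightarrow> p \<in> fst c \<Longrightarrow> chart_inv c (snd c p) = p"
  by (simp add: chart_inv_def)

text \<open>Coordinate changes are supplied as explicit formulas \<open>\<tau>\<close>, which agree
  with \<open>snd c' \<circ> chart_inv c\<close> on the overlap.\<close>

lemma smooth_atlasI: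
  assumes "\<And>c. c \<in> A \<Longrightarrow> inj_on (snd c) (fst c)"
    and "\<And>c c'. c \<in> A \<Longrightarrow> c' \<in> A \<Longrightarrow> open (snd c ` (fst c \<inter> fst c'))"
    and "\<And>c c'. c \<in> A \<Longrightarrow> c' \<in> A \<Longrightarrow> \<exists>\<tau>. smooth_on (snd c ` (fst c \<inter> fst c')) \<tau> \<and>
      (\<forall>p\<in>fst c \<inter> fst c'. snd c' p = \<tau> (snd c p))"
  shows "smooth_atlas A"
  unfolding smooth_atlas_def
proof (intro conjI ballI)
  fix c c' assume c: "c \<in> A" "c' \<in> A"
  from assms(3)[OF this] obtain \<tau> where \<tau>: "smooth_on (snd c ` (fst c \<inter> fst c')) \<tau>"
    "\<And>p. p \<in> fst c \<inter> fst c' \<Longrightarrow> snd c' p = \<tau> (snd c p)" by blast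
  have "(snd c' \<circ> chart_inv c) x = \<tau> x" if "x \<in> snd c ` (fst c \<inter> fst c')" for x
    using that \<tau>(2) chart_inv_snd[OF assms(1)[OF c(1)]] by auto
  with \<tau>(1) show "smooth_on (snd c ` (fst c \<inter> fst c')) (snd c' \<circ> chart_inv c)"
    by (subst smooth_on_cong)
qed (use assms in auto)

lemma chart_at:
  assumes "p \<in> points A"
  shows "chart_at A p \<in> A" "p \<in> fst (chart_at A p)"
proof -
  have "\<exists>c. c \<in> A \<and> p \<in> fst c" using assms by (auto simp: points_def)
  then have "chart_at A p \<in> A \<and> p \<in> fst (chart_at A p)" unfolding chart_at_def by (rule someI_ex)
  then show "chart_at A p \<in> A" "p \<in> fst (chart_at A p)" by auto
qed

lemma in_points: "c \<in> A \<Longrightarrow> p \<in> fst c \<Longrightarrow> p \<in> points A"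
  by (auto simp: points_def)

section \<open>Tangent vectors and maps computed in one chart\<close>

lemma fst_coord_vec [simp]: "fst (coord_vec A c p h) = p"
  by (simp add: coord_vec_def)

lemma tangent_spaceD:
  assumes "V \<in> tangent_space A p"
  shows "fst V = p" "p \<in> points A"
    and "c \<in> A \<Longrightarrow> c' \<in> A \<Longrightarrow> p \<in> fst c \<Longrightarrow> p \<in> fst c' \<Longrightarrow>
      snd V c' = frechet_derivative (snd c' \<circ> chart_inv c) (at (snd c p)) (snd V c)"
    and "\<not> (c \<in> A \<and> p \<in> fst c) \<Longrightarrow> snd V c = 0"
  using assms unfolding tangent_space_def mem_Collect_eq case_prod_beta by blast+

context
  fixes A :: "('a, 'e::euclidean_space) atlas"
  assumes A: "smooth_atlas A"
begin

lemma inj_on_chart: "c \<in> A \<Longrightarrow> inj_on (snd c) (fst c)"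
  using A by (simp add: smooth_atlas_def)

lemma chart_inv_chart: "c \<in> A \<Longrightarrow> p \<in> fst c \<Longrightarrow> chart_inv c (snd c p) = p"
  by (simp add: chart_inv_snd inj_on_chart)

lemma open_chart_overlap: "c \<in> A \<Longrightarrow> c' \<in> A \<Longrightarrow> open (snd c ` (fst c \<inter> fst c'))"
  using A by (simp add: smooth_atlas_def)

lemma open_chart_image: "c \<in> A \<Longrightarrow> open (snd c ` fst c)"
  using open_chart_overlap[of c c] by simp

lemma smooth_on_transition:
  "c \<in> A \<Longrightarrow> c' \<in> A \<Longrightarrow> smooth_on (snd c ` (fst c \<inter> fst c')) (snd c' \<circ> chart_inv c)"
  using A by (simp add: smooth_atlas_def)

lemma transition_has_derivative:
  assumes "c \<in> A" "c' \<in> A" "p \<in> fst c" "p \<in> fst c'"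
  shows "((snd c' \<circ> chart_inv c) has_derivative
    frechet_derivative (snd c' \<circ> chart_inv c) (at (snd c p))) (at (snd c p))"
  by (rule smooth_on_has_derivative[OF open_chart_overlap smooth_on_transition]) (use assms in auto)

text \<open>The cocycle identity, by the chain rule on the overlap. It makes the component family of
  \<open>coord_vec\<close> compatible, hence a tangent vector.\<close>

lemma transition_derivative_compose:
  assumes "c \<in> A" "c' \<in> A" "c'' \<in> A" "p \<in> fst c" "p \<in> fst c'" "p \<in> fst c''"
  shows "frechet_derivative (snd c'' \<circ> chart_inv c') (at (snd c' p))
      (frechet_derivative (snd c' \<circ> chart_inv c) (at (snd c p)) h) =
    frechet_derivative (snd c'' \<circ> chart_inv c) (at (snd c p)) h"
proof -
  have "((snd c'' \<circ> chart_inv c') has_derivative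
      frechet_derivative (snd c'' \<circ> chart_inv c') (at (snd c' p)))
      (at ((snd c' \<circ> chart_inv c) (snd c p)))"
    using transition_has_derivative[of c' c'' p] assms chart_inv_chart by simp
  from has_derivative_compose[OF transition_has_derivative[OF assms(1,2,4,5)] this]
  have "((snd c'' \<circ> chart_inv c) has_derivative
      (\<lambda>h. frechet_derivative (snd c'' \<circ> chart_inv c') (at (snd c' p))
        (frechet_derivative (snd c' \<circ> chart_inv c) (at (snd c p)) h))) (at (snd c p))"
    by (rule has_derivative_transform_within_open[OF _ open_chart_overlap[OF assms(1,2)]])
      (use assms in \<open>auto simp: chart_inv_chart\<close>)
  from frechet_derivative_at[OF this] show ?thesis by metis
qed

lemma transition_derivative_self:
  assumes "c \<in> A" "p \<in> fst c"
  shows "frechet_derivative (snd c \<circ> chart_inv c) (at (snd c p)) h = h"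
proof -
  have "((\<lambda>x. x) has_derivative (\<lambda>h. h)) (at (snd c p))" by simp
  then have "((snd c \<circ> chart_inv c) has_derivative (\<lambda>h. h)) (at (snd c p))"
    by (rule has_derivative_transform_within_open[OF _ open_chart_image[OF assms(1)]])
      (use assms in \<open>auto simp: chart_inv_chart\<close>)
  from frechet_derivative_at[OF this] show ?thesis by metis
qed

lemma snd_coord_vec:
  "c' \<in> A \<Longrightarrow> p \<in> fst c' \<Longrightarrow>
    snd (coord_vec A c p h) c' = frechet_derivative (snd c' \<circ> chart_inv c) (at (snd c p)) h"
  by (simp add: coord_vec_def)

lemma snd_coord_vec_self: "c \<in> A \<Longrightarrow> p \<in> fst c \<Longrightarrow> snd (coord_vec A c p h) c = h"
  by (simp add: snd_coord_vec transition_derivative_self)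

lemma coord_vec_in_tangent_space:
  assumes "c \<in> A" "p \<in> fst c"
  shows "coord_vec A c p h \<in> tangent_space A p"
  using assms transition_derivative_compose[of c _ _ p]
  by (auto simp: tangent_space_def coord_vec_def in_points)

text \<open>One component determines those in all charts around \<open>p\<close> through the
  transition derivatives; the components in all other charts are 0 by convention.\<close>

lemma tangent_vector_eqI:
  assumes "V \<in> tangent_space A p" "W \<in> tangent_space A p" "c \<in> A" "p \<in> fst c" "snd V c = snd W c"
  shows "V = W"
proof (rule prod_eqI)
  show "fst V = fst W" using tangent_spaceD(1) assms by metis
  show "snd V = snd W"
  proof
    fix c'
    show "snd V c' = snd W c'"
    proof (cases "c' \<in> A \<and> p \<in> fst c'")
      case True
      then show ?thesis
        using tangent_spaceD(3)[OF assms(1), of c c'] tangent_spaceD(3)[OF assms(2), of c c']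
            assms by simp
    next
      case False
      then show ?thesis using tangent_spaceD(4) assms(1,2) by metis
    qed
  qed
qed

lemma coord_vec_component:
  assumes "V \<in> tangent_space A p" "c \<in> A" "p \<in> fst c"
  shows "coord_vec A c p (snd V c) = V"
  by (rule tangent_vector_eqI[OF coord_vec_in_tangent_space assms])
    (use assms snd_coord_vec_self in auto)

lemma coord_vec_change:
  assumes "c \<in> A" "c' \<in> A" "p \<in> fst c" "p \<in> fst c'"
  shows "coord_vec A c' p (frechet_derivative (snd c' \<circ> chart_inv c) (at (snd c p)) h) =
      coord_vec A c p h"
  using coord_vec_component[OF coord_vec_in_tangent_space, of c p c' h] snd_coord_vec assms by simp

text \<open>\<open>pushforward\<close> starts from the chart selected by \<open>chart_at\<close> and
  ends in every chart of \<open>B\<close>. The chain rule along \<open>d\<close>, \<open>c\<close>,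
  \<open>c'\<close>, \<open>c''\<close> lets it be computed with any local representative
  instead.\<close>

lemma pushforward_eq:
  fixes B :: "('b, 'f::euclidean_space) atlas"
  assumes B: "smooth_atlas B" and c: "c \<in> A" "c' \<in> B" "p \<in> fst c" and V: "V \<in> tangent_space A p"
    and f: "local_representative c c' F f"
  shows "pushforward A B F V =
    coord_vec B c' (F p) (frechet_derivative f (at (snd c p)) (snd V c))"
proof -
  define d where "d = chart_at A p"
  have d: "d \<in> A" "p \<in> fst d" using chart_at in_points[OF c(1,3)] by (auto simp: d_def)
  note f' = f[unfolded local_representative_def]
  have "frechet_derivative (snd c'' \<circ> F \<circ> chart_inv d) (at (snd d p)) (snd V d) =
      frechet_derivative (snd c'' \<circ> chart_inv c') (at (snd c' (F p)))
        (frechet_derivative f (at (snd c p)) (snd V c))" if c'': "c'' \<in> B" "F p \<in> fst c''" for c''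
  proof -
    have "(f has_derivative frechet_derivative f (at (snd c p))) (at ((snd c \<circ> chart_inv d) (snd d p)))"
      using smooth_on_has_derivative[OF open_chart_image[OF c(1)], of f "snd c p"] f' c
      by (simp add: chart_inv_chart d)
    note D1 = has_derivative_compose[OF transition_has_derivative[OF d(1) c(1) d(2) c(3)] this]
    have "((snd c'' \<circ> chart_inv c') has_derivative
        frechet_derivative (snd c'' \<circ> chart_inv c') (at (snd c' (F p))))
      (at (f ((snd c \<circ> chart_inv d) (snd d p))))"
    proof -
      have "((snd c'' \<circ> chart_inv c') has_derivative
          frechet_derivative (snd c'' \<circ> chart_inv c') (at (snd c' (F p))))
        (at (snd c' (F p)))"
      proof (rule smooth_on_has_derivative[of "snd c' ` (fst c' \<inter> fst c'')"])
        show "snd c' (F p) \<in> snd c' ` (fst c' \<inter> fst c'')" using f' c c'' by blast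
      qed (use B c c'' in \<open>auto simp: smooth_atlas_def\<close>)
      then show ?thesis using f' c by (simp add: chart_inv_chart d)
    qed
    from has_derivative_compose[OF D1 this]
    have "((snd c'' \<circ> F \<circ> chart_inv d) has_derivative
      (\<lambda>h. frechet_derivative (snd c'' \<circ> chart_inv c') (at (snd c' (F p)))
        (frechet_derivative f (at (snd c p))
          (frechet_derivative (snd c \<circ> chart_inv d) (at (snd d p)) h)))) (at (snd d p))"
    proof (rule has_derivative_transform_within_open[OF _ open_chart_overlap[OF d(1) c(1)]])
      show "snd d p \<in> snd d ` (fst d \<inter> fst c)" using c d by auto
      fix x assume "x \<in> snd d ` (fst d \<inter> fst c)"
      then obtain q where q: "x = snd d q" "q \<in> fst d" "q \<in> fst c" by auto
      then have "chart_inv c' (snd c' (F q)) = F q"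
        using f' B c by (intro chart_inv_snd) (auto simp: smooth_atlas_def)
      then show "(snd c'' \<circ> chart_inv c') (f ((snd c \<circ> chart_inv d) x)) = (snd c'' \<circ> F \<circ> chart_inv d) x"
        using q d f' by (simp add: chart_inv_chart)
    qed
    from frechet_derivative_at[OF this]
    have "frechet_derivative (snd c'' \<circ> F \<circ> chart_inv d) (at (snd d p)) =
      (\<lambda>h. frechet_derivative (snd c'' \<circ> chart_inv c') (at (snd c' (F p)))
        (frechet_derivative f (at (snd c p))
          (frechet_derivative (snd c \<circ> chart_inv d) (at (snd d p)) h)))" by (rule sym)
    then show ?thesis using tangent_spaceD(3)[OF V d(1) c(1) d(2) c(3)] by simp
  qed
  then show ?thesis
    using tangent_spaceD(1)[OF V]
    by (intro prod_eqI ext) (simp_all add: pushforward_def Let_def coord_vec_def d_def)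
qed

lemma dfun_eq:
  assumes c: "c \<in> A" "p \<in> fst c" and V: "V \<in> tangent_space A p"
    and h: "h differentiable (at (snd c p))" "\<And>q. q \<in> fst c \<Longrightarrow> H q = h (snd c q)"
  shows "dfun A H V = frechet_derivative h (at (snd c p)) (snd V c)"
proof -
  define d where "d = chart_at A p"
  have d: "d \<in> A" "p \<in> fst d" using chart_at in_points[OF c] by (auto simp: d_def)
  have "(h has_derivative frechet_derivative h (at (snd c p))) (at ((snd c \<circ> chart_inv d) (snd d p)))"
    using h(1) d by (simp add: chart_inv_chart frechet_derivative_works)
  from has_derivative_compose[OF transition_has_derivative[OF d(1) c(1) d(2) c(2)] this]
  have "((H \<circ> chart_inv d) has_derivative
    (\<lambda>v. frechet_derivative h (at (snd c p)) (frechet_derivative (snd c \<circ> chart_inv d) (at (snd d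
        p)) v)))
    (at (snd d p))"
    by (rule has_derivative_transform_within_open[OF _ open_chart_overlap[OF d(1) c(1)]])
      (use c d h(2) in \<open>auto simp: chart_inv_chart\<close>)
  from frechet_derivative_at[OF this] show ?thesis
    using tangent_spaceD(1)[OF V] tangent_spaceD(3)[OF V d(1) c(1) d(2) c(2)]
    by (simp add: dfun_def Let_def flip: d_def) metis
qed

section \<open>The topology of an atlas\<close>

lemma openin_manifold_topology:
  "openin (manifold_topology A) W \<longleftrightarrow> W \<subseteq> points A \<and> (\<forall>c\<in>A. open (snd c ` (W \<inter> fst c)))"
proof -
  have "istopology (\<lambda>W. W \<subseteq> points A \<and> (\<forall>c\<in>A. open (snd c ` (W \<inter> fst c))))"
    unfolding istopology_def
  proof (intro conjI allI impI ballI)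
    fix S T assume *: "S \<subseteq> points A \<and> (\<forall>c\<in>A. open (snd c ` (S \<inter> fst c)))"
      "T \<subseteq> points A \<and> (\<forall>c\<in>A. open (snd c ` (T \<inter> fst c)))"
    then show "S \<inter> T \<subseteq> points A" by auto
    fix c assume c: "c \<in> A"
    have "snd c ` (S \<inter> T \<inter> fst c) = snd c ` (S \<inter> fst c) \<inter> snd c ` (T \<inter> fst c)"
      using inj_on_chart[OF c] by (auto dest: inj_onD)
    then show "open (snd c ` (S \<inter> T \<inter> fst c))" using * c by auto
  next
    fix K assume *: "\<forall>S\<in>K. S \<subseteq> points A \<and> (\<forall>c\<in>A. open (snd c ` (S \<inter> fst c)))"
    then show "\<Union>K \<subseteq> points A" by auto
    fix c assume c: "c \<in> A"
    have "snd c ` (\<Union>K \<inter> fst c) = (\<Union>S\<in>K. snd c ` (S \<inter> fst c))" by auto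
    then show "open (snd c ` (\<Union>K \<inter> fst c))" using * c by auto
  qed
  then show ?thesis by (simp add: manifold_topology_def)
qed

text \<open>Openness may be tested in a single chart around each point, since continuous coordinate
  changes carry it to all others.\<close>

lemma openin_manifold_topology_local:
  assumes "W \<subseteq> points A" and "\<And>p. p \<in> W \<Longrightarrow> \<exists>c\<in>A. p \<in> fst c \<and> open (snd c ` (W \<inter> fst c))"
  shows "openin (manifold_topology A) W"
  unfolding openin_manifold_topology
proof (intro conjI ballI)
  fix c' assume c': "c' \<in> A"
  show "open (snd c' ` (W \<inter> fst c'))"
  proof (subst open_subopen, intro ballI)
    fix y assume "y \<in> snd c' ` (W \<inter> fst c')"
    then obtain p where p: "p \<in> W" "p \<in> fst c'" "y = snd c' p" by auto
    then obtain c where c: "c \<in> A" "p \<in> fst c" "open (snd c ` (W \<inter> fst c))" using assms(2) by blast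
    let ?T = "snd c' ` (fst c' \<inter> fst c)"
    have "open (?T \<inter> (snd c \<circ> chart_inv c') -` (snd c ` (W \<inter> fst c)))"
      by (rule continuous_open_preimage[OF smooth_on_continuous_on[OF smooth_on_transition[OF c' c(1)]]
            open_chart_overlap[OF c' c(1)] c(3)])
    moreover have "y \<in> ?T \<inter> (snd c \<circ> chart_inv c') -` (snd c ` (W \<inter> fst c))"
      using p c c' by (simp add: chart_inv_chart)
    moreover have "?T \<inter> (snd c \<circ> chart_inv c') -` (snd c ` (W \<inter> fst c)) \<subseteq> snd c' ` (W \<inter> fst c')"
    proof
      fix z assume "z \<in> ?T \<inter> (snd c \<circ> chart_inv c') -` (snd c ` (W \<inter> fst c))"
      then obtain q w where "q \<in> fst c'" "q \<in> fst c" "z = snd c' q" "w \<in> W" "w \<in> fst c" "snd c q =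
          snd c w"
        using c' by (auto simp: chart_inv_chart)
      moreover from this have "q = w" using inj_on_chart[OF c(1)] by (auto dest: inj_onD)
      ultimately show "z \<in> snd c' ` (W \<inter> fst c')" by blast
    qed
    ultimately show "\<exists>T. open T \<and> y \<in> T \<and> T \<subseteq> snd c' ` (W \<inter> fst c')" by blast
  qed
qed (use assms in auto)

lemma openin_chart: "c \<in> A \<Longrightarrow> openin (manifold_topology A) (fst c)"
  using open_chart_overlap by (auto simp: openin_manifold_topology in_points Int_commute)

lemma topspace_manifold_topology: "topspace (manifold_topology A) = points A"
proof
  show "topspace (manifold_topology A) \<subseteq> points A"
    using openin_topspace openin_manifold_topology by blast
  show "points A \<subseteq> topspace (manifold_topology A)"
    using openin_chart openin_subset by (fastforce simp: points_def)
qed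

end

text \<open>\<open>smooth_map\<close> asks for continuity and for smoothness in every pair of
  charts. One representative around each point yields both, since coordinate changes are smooth and
  smoothness is local.\<close>

lemma smooth_mapI:
  fixes A :: "('a, 'e::euclidean_space) atlas" and B :: "('b, 'f::euclidean_space) atlas"
  assumes A: "smooth_atlas A" and B: "smooth_atlas B"
    and loc: "\<And>p. p \<in> points A \<Longrightarrow> \<exists>c\<in>A. \<exists>c'\<in>B. \<exists>f. p \<in> fst c \<and> local_representative c c' F f"
  shows "smooth_map A B F"
proof -
  have im: "F ` points A \<subseteq> points B"
    using loc by (fastforce simp: local_representative_def points_def)
  \<comment> \<open>Used twice: for continuity of \<open>F\<close>, and to see that the points
    mapped into a given chart domain form an open set.\<close>
  have pre: "openin (manifold_topology A) {p \<in> points A. F p \<in> W}" if W: "W \<subseteq> points B"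
    "\<And>c'. c' \<in> B \<Longrightarrow> open (snd c' ` (W \<inter> fst c'))" for W
  proof (rule openin_manifold_topology_local[OF A])
    fix p assume "p \<in> {p \<in> points A. F p \<in> W}"
    then obtain c c' f where c: "c \<in> A" "c' \<in> B" "p \<in> fst c" and f: "local_representative c c' F f"
      using loc by blast
    note f' = f[unfolded local_representative_def]
    have inj: "inj_on (snd c') (fst c')" using B c by (simp add: smooth_atlas_def)
    have "open (snd c ` fst c \<inter> f -` (snd c' ` (W \<inter> fst c')))"
      using continuous_open_preimage[OF smooth_on_continuous_on open_chart_image[OF A]] f' c W by blast
    also have "snd c ` fst c \<inter> f -` (snd c' ` (W \<inter> fst c')) = snd c ` ({p \<in> points A. F p \<in> W} \<inter> fst c)"
    proof (intro set_eqI iffI)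
      fix x assume "x \<in> snd c ` fst c \<inter> f -` (snd c' ` (W \<inter> fst c'))"
      then obtain q w where q: "q \<in> fst c" "x = snd c q" "w \<in> W" "w \<in> fst c'" "f x = snd c' w" by auto
      then have "snd c' (F q) = snd c' w" "F q \<in> fst c'" using f' by auto
      then have "F q = w" using inj q by (auto dest: inj_onD)
      then show "x \<in> snd c ` ({p \<in> points A. F p \<in> W} \<inter> fst c)" using q in_points[OF c(1)] by auto
    next
      fix x assume "x \<in> snd c ` ({p \<in> points A. F p \<in> W} \<inter> fst c)"
      then obtain q where q: "q \<in> fst c" "x = snd c q" "F q \<in> W" by auto
      then have "f x = snd c' (F q)" "F q \<in> fst c'" using f' by auto
      with q show "x \<in> snd c ` fst c \<inter> f -` (snd c' ` (W \<inter> fst c'))" by auto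
    qed
    finally show "\<exists>c\<in>A. p \<in> fst c \<and> open (snd c ` ({p \<in> points A. F p \<in> W} \<inter> fst c))" using c by blast
  qed auto
  have cont: "continuous_map (manifold_topology A) (manifold_topology B) F"
    using im pre by (auto simp: continuous_map_def topspace_manifold_topology[OF A]
        topspace_manifold_topology[OF B] openin_manifold_topology[OF B])
  have "smooth_on (snd d ` {p \<in> fst d. F p \<in> fst d'}) (snd d' \<circ> F \<circ> chart_inv d)"
    if d: "d \<in> A" "d' \<in> B" for d d'
  proof -
    define W where "W = {p \<in> points A. F p \<in> fst d'}"
    have W: "openin (manifold_topology A) W"
      unfolding W_def using d(2) B
      by (intro pre) (auto simp: in_points smooth_atlas_def Int_commute)
    have Wd: "{p \<in> fst d. F p \<in> fst d'} = W \<inter> fst d" using in_points[OF d(1)] by (auto simp: W_def)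
    show ?thesis unfolding Wd
    proof (rule smooth_on_local)
      show "open (snd d ` (W \<inter> fst d))" using W d by (simp add: openin_manifold_topology[OF A])
      fix x assume "x \<in> snd d ` (W \<inter> fst d)"
      then obtain p where p: "p \<in> W" "p \<in> fst d" "x = snd d p" by auto
      then obtain c c' f where c: "c \<in> A" "c' \<in> B" "p \<in> fst c" and f: "local_representative c c' F f"
        using loc by (force simp: W_def)
      note f' = f[unfolded local_representative_def]
      \<comment> \<open>On \<open>T\<close> the coordinate expression in the charts
        \<open>d\<close>, \<open>d'\<close> factors into the change from \<open>d\<close> to
        \<open>c\<close>, the representative \<open>f\<close>, and the change from \<open>c'\<close>
        to \<open>d'\<close>.\<close>
      define T where "T = snd d ` ((W \<inter> fst c) \<inter> fst d)"
      have opT: "open T" unfolding T_def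
        using openin_Int[OF W openin_chart[OF A c(1)]] d by (simp add: openin_manifold_topology[OF A])
      have "smooth_on T (snd c \<circ> chart_inv d)"
        by (rule smooth_on_subset[OF open_chart_overlap[OF A] opT _ smooth_on_transition[OF A]])
          (use d c in \<open>auto simp: T_def\<close>)
      then have sm1: "smooth_on T (\<lambda>y. f ((snd c \<circ> chart_inv d) y))"
        by (rule smooth_on_compose[OF opT open_chart_image[OF A c(1)]])
          (use f' d in \<open>auto simp: T_def chart_inv_chart[OF A]\<close>)
      have op2: "open (snd c' ` (fst c' \<inter> fst d'))" and sm2:
          "smooth_on (snd c' ` (fst c' \<inter> fst d')) (snd d' \<circ> chart_inv c')"
        using B c d by (auto simp: smooth_atlas_def)
      have "smooth_on T (\<lambda>y. (snd d' \<circ> chart_inv c') (f ((snd c \<circ> chart_inv d) y)))"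
      proof (rule smooth_on_compose[OF opT op2 sm1 sm2])
        show "(\<lambda>y. f ((snd c \<circ> chart_inv d) y)) ` T \<subseteq> snd c' ` (fst c' \<inter> fst d')"
        proof
          fix z assume "z \<in> (\<lambda>y. f ((snd c \<circ> chart_inv d) y)) ` T"
          then obtain q where q: "q \<in> W" "q \<in> fst c" "q \<in> fst d" "z = f (snd c q)"
            using d by (auto simp: T_def chart_inv_chart[OF A])
          then have "z = snd c' (F q)" "F q \<in> fst c' \<inter> fst d'" using f' by (auto simp: W_def)
          then show "z \<in> snd c' ` (fst c' \<inter> fst d')" by blast
        qed
      qed
      moreover have "(snd d' \<circ> chart_inv c') (f ((snd c \<circ> chart_inv d) y)) =
          (snd d' \<circ> F \<circ> chart_inv d) y"
        if "y \<in> T" for y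
      proof -
        from that obtain q where q: "q \<in> fst c" "q \<in> fst d" "y = snd d q" by (auto simp: T_def)
        then have "chart_inv c' (snd c' (F q)) = F q"
          using f' B c by (intro chart_inv_snd) (auto simp: smooth_atlas_def)
        then show ?thesis using q d f' by (simp add: chart_inv_chart[OF A])
      qed
      ultimately have "smooth_on T (snd d' \<circ> F \<circ> chart_inv d)"
        by (rule iffD1[OF smooth_on_cong, rotated])
      moreover have "x \<in> T" using p c by (auto simp: T_def)
      ultimately show "\<exists>T. open T \<and> x \<in> T \<and> smooth_on T (snd d' \<circ> F \<circ> chart_inv d)"
        using opT by blast
    qed
  qed
  then show ?thesis using im cont by (simp add: smooth_map_def)
qed

section \<open>Tangent and cotangent bundles\<close>

text \<open>A single chart of \<open>times_real\<close>, written with projections in place of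
  pattern matching so that it simplifies on arbitrary points.\<close>

definition times_real_chart :: "('a, 'e) chart \<Rightarrow> ('a \<times> real, 'e \<times> real) chart" where
  "times_real_chart c = (fst c \<times> UNIV, \<lambda>z. (snd c (fst z), snd z))"

lemma times_real_eq: "times_real A = times_real_chart ` A"
  by (simp add: times_real_def times_real_chart_def case_prod_beta')

lemma fst_times_real_chart: "z \<in> fst (times_real_chart c) \<longleftrightarrow> fst z \<in> fst c"
  by (cases z) (simp add: times_real_chart_def)

lemma snd_times_real_chart: "snd (times_real_chart c) z = (snd c (fst z), snd z)"
  by (simp add: times_real_chart_def)

lemma points_times_real: "points (times_real A) = points A \<times> UNIV"
  by (auto simp: points_def times_real_eq fst_times_real_chart)

lemma times_real_chart_image:
  "snd (times_real_chart c) ` (fst (times_real_chart c) \<inter> fst (times_real_chart c')) =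
    (snd c ` (fst c \<inter> fst c')) \<times> UNIV"
  by (force simp: times_real_chart_def)

lemma smooth_atlas_times_real:
  fixes A :: "('a, 'e::euclidean_space) atlas"
  assumes A: "smooth_atlas A"
  shows "smooth_atlas (times_real A)"
proof (rule smooth_atlasI)
  fix k assume "k \<in> times_real A"
  then show "inj_on (snd k) (fst k)"
    using inj_on_chart[OF A]
    by (auto simp: times_real_eq inj_on_def fst_times_real_chart snd_times_real_chart)
next
  fix k k' assume "k \<in> times_real A" "k' \<in> times_real A"
  then obtain c c' where k: "k = times_real_chart c" "k' = times_real_chart c'" "c \<in> A" "c' \<in> A"
    by (auto simp: times_real_eq)
  show op: "open (snd k ` (fst k \<inter> fst k'))"
    using open_chart_overlap[OF A k(3,4)] by (simp add: k times_real_chart_image open_Times)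
  let ?\<tau> = "\<lambda>z. ((snd c' \<circ> chart_inv c) (fst z), snd z)"
  have "smooth_on (snd k ` (fst k \<inter> fst k')) ?\<tau>"
    using op open_chart_overlap[OF A k(3,4)] smooth_on_transition[OF A k(3,4)]
    by (intro smooth_on_Pair smooth_on_snd smooth_on_ident
        smooth_on_compose[where f = fst and g = "snd c' \<circ> chart_inv c"] smooth_on_fst)
      (auto simp: k times_real_chart_image)
  moreover have "\<forall>p\<in>fst k \<inter> fst k'. snd k' p = ?\<tau> (snd k p)"
    using k by (auto simp: fst_times_real_chart snd_times_real_chart chart_inv_chart[OF A])
  ultimately show "\<exists>\<tau>. smooth_on (snd k ` (fst k \<inter> fst k')) \<tau> \<and>
      (\<forall>p\<in>fst k \<inter> fst k'. snd k' p = \<tau> (snd k p))" by blast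
qed

section \<open>Charts of the tangent and cotangent bundles\<close>

lemma in_tangent_chart:
  "V \<in> fst (tangent_chart A c) \<longleftrightarrow> fst V \<in> fst c \<and> V \<in> tangent_space A (fst V)"
  using tangent_spaceD(1) by (fastforce simp: tangent_chart_def)

lemma snd_tangent_chart: "snd (tangent_chart A c) V = (snd c (fst V), snd V c)"
  by (simp add: tangent_chart_def)

lemma points_tangent_bundle: "V \<in> points (tangent_bundle A) \<longleftrightarrow> V \<in> tangent_space A (fst V)"
  using tangent_spaceD(2) by (fastforce simp: points_def tangent_bundle_def in_tangent_chart)

lemma in_cotangent_chart:
  "\<alpha> \<in> fst (cotangent_chart A c) \<longleftrightarrow> fst \<alpha> \<in> fst c \<and> \<alpha> \<in> cotangent_space A (fst \<alpha>)"
  by (auto simp: cotangent_chart_def cotangent_space_def)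

lemma snd_cotangent_chart:
  "snd (cotangent_chart A c) \<alpha> =
    (snd c (fst \<alpha>), \<Sum>b\<in>Basis. snd \<alpha> (coord_vec A c (fst \<alpha>) b) *\<^sub>R b)"
  by (simp add: cotangent_chart_def case_prod_beta)

lemma cotangent_spaceD:
  assumes "\<alpha> \<in> cotangent_space A p"
  shows "fst \<alpha> = p" "p \<in> points A"
    and "c \<in> A \<Longrightarrow> p \<in> fst c \<Longrightarrow> linear (\<lambda>h. snd \<alpha> (coord_vec A c p h))"
    and "V \<notin> tangent_space A p \<Longrightarrow> snd \<alpha> V = 0"
  using assms unfolding cotangent_space_def mem_Collect_eq case_prod_beta by blast+

lemma points_cotangent_bundle: "\<alpha> \<in> points (cotangent_bundle A) \<longleftrightarrow> \<alpha> \<in> cotangent_space A (fst \<alpha>)"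
  using cotangent_spaceD(2) by (fastforce simp: points_def cotangent_bundle_def in_cotangent_chart)

lemma fst_covector [simp]: "fst (covector A p \<alpha>) = p"
  by (simp add: covector_def)

lemma covector_eq_iff:
  "covector A p \<alpha> = covector A p \<beta> \<longleftrightarrow> (\<forall>W\<in>tangent_space A p. \<alpha> W = \<beta> W)"
  by (auto simp: covector_def fun_eq_iff)

lemma snd_covector: "V \<in> tangent_space A p \<Longrightarrow> snd (covector A p \<alpha>) V = \<alpha> V"
  by (simp add: covector_def)

context
  fixes A :: "('a, 'e::euclidean_space) atlas"
  assumes A: "smooth_atlas A"
begin

text \<open>\<open>coord_vec\<close> realises every component vector, so the image is a full
  cylinder over the base overlap, and openness reduces to the base.\<close>

lemma tangent_chart_image:
  assumes "c \<in> A"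
  shows "snd (tangent_chart A c) ` (fst (tangent_chart A c) \<inter> fst (tangent_chart A c')) =
    (snd c ` (fst c \<inter> fst c')) \<times> UNIV"
proof (intro set_eqI iffI)
  fix z assume "z \<in> (snd c ` (fst c \<inter> fst c')) \<times> (UNIV :: 'e set)"
  then obtain p v where p: "p \<in> fst c" "p \<in> fst c'" "z = (snd c p, v)" by auto
  then have "z = snd (tangent_chart A c) (coord_vec A c p v)"
    using assms by (simp add: snd_tangent_chart snd_coord_vec_self[OF A])
  moreover have "coord_vec A c p v \<in> fst (tangent_chart A c) \<inter> fst (tangent_chart A c')"
    using p coord_vec_in_tangent_space[OF A assms p(1)] by (simp add: in_tangent_chart)
  ultimately show "z \<in> snd (tangent_chart A c) ` (fst (tangent_chart A c) \<inter> fst (tangent_chart A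
      c'))" by blast
qed (auto simp: in_tangent_chart snd_tangent_chart)

lemma smooth_atlas_tangent_bundle: "smooth_atlas (tangent_bundle A)"
proof (rule smooth_atlasI)
  fix k assume "k \<in> tangent_bundle A"
  then obtain c where k: "k = tangent_chart A c" "c \<in> A" by (auto simp: tangent_bundle_def)
  show "inj_on (snd k) (fst k)"
  proof (rule inj_onI)
    fix V W assume *: "V \<in> fst k" "W \<in> fst k" "snd k V = snd k W"
    then have "fst V = fst W"
      using inj_on_chart[OF A k(2)] by (auto simp: k in_tangent_chart snd_tangent_chart dest: inj_onD)
    then show "V = W"
      using * k tangent_vector_eqI[OF A, of V "fst V" W c]
          by (simp add: in_tangent_chart snd_tangent_chart)
  qed
next
  fix k k' assume "k \<in> tangent_bundle A" "k' \<in> tangent_bundle A"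
  then obtain c c' where k: "k = tangent_chart A c" "k' = tangent_chart A c'" "c \<in> A" "c' \<in> A"
    by (auto simp: tangent_bundle_def)
  let ?S = "snd c ` (fst c \<inter> fst c')"
  note im = tangent_chart_image[OF k(3), of c']
  note S = open_chart_overlap[OF A k(3,4)] and tr = smooth_on_transition[OF A k(3,4)]
  show op: "open (snd k ` (fst k \<inter> fst k'))" using S by (simp add: k im open_Times)
  then have op': "open (?S \<times> (UNIV :: 'e set))" by (simp add: k im)
  note sm_fst = smooth_on_fst[OF op' smooth_on_ident[OF op']]
    and sm_snd = smooth_on_snd[OF op' smooth_on_ident[OF op']]
  \<comment> \<open>The tangent map of the base coordinate change: components transform by its
    derivative.\<close>
  let ?\<tau> = "\<lambda>z. ((snd c' \<circ> chart_inv c) (fst z),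
    frechet_derivative (snd c' \<circ> chart_inv c) (at (fst z)) (snd z))"
  have "smooth_on (?S \<times> UNIV) ?\<tau>"
    by (rule smooth_on_Pair[OF op' smooth_on_compose[OF op' S sm_fst tr]
        smooth_on_linear_apply[OF S op' smooth_on_linear_derivative[OF S tr]
            smooth_on_derivative[OF S tr]
          sm_fst sm_snd]]) auto
  moreover have "\<forall>V\<in>fst k \<inter> fst k'. snd k' V = ?\<tau> (snd k V)"
    using k tangent_spaceD(3)[OF _ k(3,4)]
    by (auto simp: in_tangent_chart snd_tangent_chart chart_inv_chart[OF A])
  ultimately show "\<exists>\<tau>. smooth_on (snd k ` (fst k \<inter> fst k')) \<tau> \<and>
      (\<forall>p\<in>fst k \<inter> fst k'. snd k' p = \<tau> (snd k p))" unfolding k im by blast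
qed

text \<open>Linearity in one chart suffices, as coordinate vectors of another chart arise from it by
  a linear transition derivative.\<close>

lemma covector_in_cotangent_space:
  assumes "c \<in> A" "p \<in> fst c" "linear (\<lambda>h. \<alpha> (coord_vec A c p h))"
  shows "covector A p \<alpha> \<in> cotangent_space A p"
proof -
  have "linear (\<lambda>h. \<alpha> (coord_vec A c' p h))" if c': "c' \<in> A" "p \<in> fst c'" for c'
  proof -
    have "linear (frechet_derivative (snd c \<circ> chart_inv c') (at (snd c' p)))"
      using has_derivative_linear[OF transition_has_derivative[OF A]] assms c' by blast
    from linear_compose[OF this assms(3)] show ?thesis
      using coord_vec_change[OF A c'(1) assms(1) c'(2) assms(2)] by (simp add: o_def)
  qed
  then show ?thesis
    using assms coord_vec_in_tangent_space[OF A]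
    by (auto simp: cotangent_space_def covector_def in_points)
qed

lemma covector_apply_coord_vec:
  assumes "\<alpha> \<in> cotangent_space A p" "c \<in> A" "p \<in> fst c"
  shows "snd \<alpha> (coord_vec A c p h) = (\<Sum>b\<in>Basis. snd \<alpha> (coord_vec A c p b) *\<^sub>R b) \<bullet> h"
  using linear_functional_eq_inner[OF cotangent_spaceD(3)[OF assms]] .

lemma covector_eqI:
  assumes "\<alpha> \<in> cotangent_space A p" "\<beta> \<in> cotangent_space A p" "c \<in> A" "p \<in> fst c"
    and "\<And>h. snd \<alpha> (coord_vec A c p h) = snd \<beta> (coord_vec A c p h)"
  shows "\<alpha> = \<beta>"
proof (rule prod_eqI)
  show "fst \<alpha> = fst \<beta>" using cotangent_spaceD(1) assms by metis
  show "snd \<alpha> = snd \<beta>"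
  proof
    fix V
    show "snd \<alpha> V = snd \<beta> V"
    proof (cases "V \<in> tangent_space A p")
      case True
      show ?thesis using assms(5)[of "snd V c"] coord_vec_component[OF A True assms(3,4)] by simp
    next
      case False
      then show ?thesis using cotangent_spaceD(4) assms by metis
    qed
  qed
qed

lemma covector_eqI_chart:
  assumes "\<alpha> \<in> cotangent_space A p" "\<beta> \<in> cotangent_space A p" "c \<in> A" "p \<in> fst c"
    and "snd (cotangent_chart A c) \<alpha> = snd (cotangent_chart A c) \<beta>"
  shows "\<alpha> = \<beta>"
proof (rule covector_eqI[OF assms(1-4)])
  fix h
  have "(\<Sum>b\<in>Basis. snd \<alpha> (coord_vec A c p b) *\<^sub>R b) = (\<Sum>b\<in>Basis. snd \<beta> (coord_vec A c p b) *\<^sub>R b)"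
    using assms(5) cotangent_spaceD(1)[OF assms(1)] cotangent_spaceD(1)[OF assms(2)]
    by (simp add: snd_cotangent_chart)
  then show "snd \<alpha> (coord_vec A c p h) = snd \<beta> (coord_vec A c p h)"
    by (subst (1 2) covector_apply_coord_vec) (use assms in auto)
qed

lemma cotangent_chart_covector:
  assumes "c \<in> A" "p \<in> fst c"
  shows "snd (cotangent_chart A c) (covector A p \<alpha>) =
    (snd c p, \<Sum>b\<in>Basis. \<alpha> (coord_vec A c p b) *\<^sub>R b)"
  using coord_vec_in_tangent_space[OF A assms] by (simp add: snd_cotangent_chart snd_covector)

text \<open>The covector with prescribed components \<open>a\<close>, a witness that the cotangent
  chart is onto its cylinder.\<close>

lemma covector_of_components:
  assumes "c \<in> A" "p \<in> fst c"
  shows "covector A p (\<lambda>V. a \<bullet> snd V c) \<in> cotangent_space A p"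
    and "snd (cotangent_chart A c) (covector A p (\<lambda>V. a \<bullet> snd V c)) = (snd c p, a)"
proof -
  show "covector A p (\<lambda>V. a \<bullet> snd V c) \<in> cotangent_space A p"
    using assms
    by (intro covector_in_cotangent_space[of c])
      (auto simp: snd_coord_vec_self[OF A] inner_add_right intro: linearI)
  show "snd (cotangent_chart A c) (covector A p (\<lambda>V. a \<bullet> snd V c)) = (snd c p, a)"
    using assms
    by (simp add: cotangent_chart_covector snd_coord_vec_self[OF A] euclidean_representation)
qed

lemma cotangent_chart_image:
  assumes "c \<in> A"
  shows "snd (cotangent_chart A c) ` (fst (cotangent_chart A c) \<inter> fst (cotangent_chart A c')) =
    (snd c ` (fst c \<inter> fst c')) \<times> UNIV"
proof (intro set_eqI iffI)
  fix z assume "z \<in> (snd c ` (fst c \<inter> fst c')) \<times> (UNIV :: 'e set)"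
  then obtain p a where p: "p \<in> fst c" "p \<in> fst c'" "z = (snd c p, a)" by auto
  let ?\<alpha> = "covector A p (\<lambda>V. a \<bullet> snd V c)"
  have "z = snd (cotangent_chart A c) ?\<alpha>" "?\<alpha> \<in> fst (cotangent_chart A c) \<inter> fst (cotangent_chart A c')"
    using covector_of_components[OF assms p(1), of a] p by (auto simp: in_cotangent_chart)
  then show "z \<in> snd (cotangent_chart A c) ` (fst (cotangent_chart A c) \<inter> fst (cotangent_chart A
      c'))" by blast
qed (auto simp: in_cotangent_chart snd_cotangent_chart)

lemma smooth_atlas_cotangent_bundle: "smooth_atlas (cotangent_bundle A)"
proof (rule smooth_atlasI)
  fix k assume "k \<in> cotangent_bundle A"
  then obtain c where k: "k = cotangent_chart A c" "c \<in> A" by (auto simp: cotangent_bundle_def)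
  show "inj_on (snd k) (fst k)"
  proof (rule inj_onI)
    fix \<alpha> \<beta> assume *: "\<alpha> \<in> fst k" "\<beta> \<in> fst k" "snd k \<alpha> = snd k \<beta>"
    then have "fst \<alpha> = fst \<beta>"
      using inj_on_chart[OF A k(2)]
          by (auto simp: k in_cotangent_chart snd_cotangent_chart dest: inj_onD)
    then show "\<alpha> = \<beta>"
      using * k covector_eqI_chart[of \<alpha> "fst \<alpha>" \<beta> c] by (simp add: in_cotangent_chart)
  qed
next
  fix k k' assume "k \<in> cotangent_bundle A" "k' \<in> cotangent_bundle A"
  then obtain c c' where k: "k = cotangent_chart A c" "k' = cotangent_chart A c'" "c \<in> A" "c' \<in> A"
    by (auto simp: cotangent_bundle_def)
  let ?S = "snd c ` (fst c \<inter> fst c')" and ?S' = "snd c' ` (fst c' \<inter> fst c)"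
  note im = cotangent_chart_image[OF k(3), of c']
  note S = open_chart_overlap[OF A k(3,4)] and tr = smooth_on_transition[OF A k(3,4)]
  note S' = open_chart_overlap[OF A k(4,3)] and tr' = smooth_on_transition[OF A k(4,3)]
  show op: "open (snd k ` (fst k \<inter> fst k'))" using S by (simp add: k im open_Times)
  then have op': "open (?S \<times> (UNIV :: 'e set))" by (simp add: k im)
  \<comment> \<open>Covectors transform contragrediently: the sum over the basis is the adjoint of
    the derivative of the inverse coordinate change, applied to the old components.\<close>
  let ?\<tau> = "\<lambda>z. ((snd c' \<circ> chart_inv c) (fst z),
    \<Sum>b\<in>Basis. (snd z \<bullet> frechet_derivative (snd c \<circ> chart_inv c') (at ((snd c' \<circ> chart_inv c) (fst
        z))) b) *\<^sub>R b)"
  have tr_fst: "smooth_on (?S \<times> (UNIV :: 'e set)) (\<lambda>z. (snd c' \<circ> chart_inv c) (fst z))"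
    by (rule smooth_on_compose[OF op' S smooth_on_fst[OF op' smooth_on_ident[OF op']] tr]) auto
  have "smooth_on (?S \<times> (UNIV :: 'e set))
      (\<lambda>z. frechet_derivative (snd c \<circ> chart_inv c') (at ((snd c' \<circ> chart_inv c) (fst z))) b)" for b
    by (rule smooth_on_compose[OF op' S' tr_fst smooth_on_derivative[OF S' tr']])
      (use k in \<open>auto simp: chart_inv_chart[OF A]\<close>)
  then have "smooth_on (?S \<times> (UNIV :: 'e set))
      (\<lambda>z. snd z \<bullet> frechet_derivative (snd c \<circ> chart_inv c') (at ((snd c' \<circ> chart_inv c) (fst z)))
          b)" for b
    using smooth_on_snd[OF op' smooth_on_ident[OF op']]
    by (auto simp: smooth_on_def intro: Ck_on_bilinear[OF bounded_bilinear_inner op'])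
  then have "smooth_on (?S \<times> UNIV) ?\<tau>"
    by (intro smooth_on_Pair[OF op' tr_fst] smooth_on_sum[OF op'] smooth_on_scaleR[OF op' _
        smooth_on_const[OF op']])
  moreover have "\<forall>\<alpha>\<in>fst k \<inter> fst k'. snd k' \<alpha> = ?\<tau> (snd k \<alpha>)"
  proof
    fix \<alpha> assume "\<alpha> \<in> fst k \<inter> fst k'"
    then have \<alpha>: "fst \<alpha> \<in> fst c" "fst \<alpha> \<in> fst c'" "\<alpha> \<in> cotangent_space A (fst \<alpha>)"
      by (auto simp: k in_cotangent_chart)
    have "snd \<alpha> (coord_vec A c' (fst \<alpha>) b) = snd (snd k \<alpha>) \<bullet>
        frechet_derivative (snd c \<circ> chart_inv c') (at (snd c' (fst \<alpha>))) b" for b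
      unfolding coord_vec_change[OF A k(4,3) \<alpha>(2,1), of b, symmetric]
        covector_apply_coord_vec[OF \<alpha>(3) k(3) \<alpha>(1), of "frechet_derivative _ _ b"]
      by (simp add: k(1) snd_cotangent_chart)
    moreover have "(snd c' \<circ> chart_inv c) (fst (snd k \<alpha>)) = snd c' (fst \<alpha>)"
      using k \<alpha> by (simp add: snd_cotangent_chart chart_inv_chart[OF A])
    ultimately show "snd k' \<alpha> = ?\<tau> (snd k \<alpha>)"
      by (simp add: snd_cotangent_chart k(2))
  qed
  ultimately show "\<exists>\<tau>. smooth_on (snd k ` (fst k \<inter> fst k')) \<tau> \<and>
      (\<forall>p\<in>fst k \<inter> fst k'. snd k' p = \<tau> (snd k p))" unfolding k im by blast
qed

end

section \<open>One-forms and the exterior derivative in charts\<close>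

text \<open>The formula of \<open>ext_deriv\<close> with the chart as a parameter instead of the
  selection by \<open>chart_at\<close>.\<close>

definition local_ext_deriv ::
  "('a, 'e::euclidean_space) atlas \<Rightarrow> (('a, 'e) tvec \<Rightarrow> real) \<Rightarrow> ('a, 'e) chart \<Rightarrow> 'e \<Rightarrow> 'e \<Rightarrow> 'e \<Rightarrow> real" where
  "local_ext_deriv A \<eta> c x v w =
    frechet_derivative (\<lambda>y. local_form A \<eta> c y w) (at x) v -
    frechet_derivative (\<lambda>y. local_form A \<eta> c y v) (at x) w"

lemma local_ext_deriv_skew: "local_ext_deriv A \<eta> c x v w = - local_ext_deriv A \<eta> c x w v"
  by (simp add: local_ext_deriv_def)

context
  fixes A :: "('a, 'e::euclidean_space) atlas" and \<eta> :: "('a, 'e) tvec \<Rightarrow> real"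
  assumes A: "smooth_atlas A" and \<eta>: "one_form A \<eta>"
begin

lemma local_form_chart: "c \<in> A \<Longrightarrow> p \<in> fst c \<Longrightarrow> local_form A \<eta> c (snd c p) h = \<eta> (coord_vec A c p h)"
  by (simp add: local_form_def chart_inv_chart[OF A])

lemma linear_local_form: "c \<in> A \<Longrightarrow> x \<in> snd c ` fst c \<Longrightarrow> linear (local_form A \<eta> c x)"
  using \<eta> by (auto simp: one_form_def)

lemma smooth_on_local_form: "c \<in> A \<Longrightarrow> smooth_on (snd c ` fst c) (\<lambda>x. local_form A \<eta> c x h)"
  using \<eta> by (simp add: one_form_def)

lemma one_form_component:
  "c \<in> A \<Longrightarrow> p \<in> fst c \<Longrightarrow> V \<in> tangent_space A p \<Longrightarrow> \<eta> V = local_form A \<eta> c (snd c p) (snd V c)"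
  by (simp add: local_form_chart coord_vec_component[OF A])

text \<open>Changing charts adds a term with the second derivative of the transition map, which the
  antisymmetrisation cancels.\<close>

lemma local_ext_deriv_change:
  assumes "c \<in> A" "d \<in> A" "p \<in> fst c" "p \<in> fst d"
  shows "local_ext_deriv A \<eta> d (snd d p)
      (frechet_derivative (snd d \<circ> chart_inv c) (at (snd c p)) v)
      (frechet_derivative (snd d \<circ> chart_inv c) (at (snd c p)) w) =
    local_ext_deriv A \<eta> c (snd c p) v w"
proof -
  define \<tau> where "\<tau> = snd d \<circ> chart_inv c"
  define S where "S = snd c ` (fst c \<inter> fst d)"
  define x where "x = snd c p"
  have \<tau>x: "\<tau> x = snd d p" using assms by (simp add: \<tau>_def x_def chart_inv_chart[OF A])
  have S: "open S" and \<tau>: "smooth_on S \<tau>" and x: "x \<in> S"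
    using open_chart_overlap[OF A] smooth_on_transition[OF A] assms by (auto simp: S_def \<tau>_def x_def)
  \<comment> \<open>The transformation rule of \<eta>, stated on the whole overlap so that it can be
    differentiated at \<open>x\<close>.\<close>
  have eq: "local_form A \<eta> d (\<tau> y) (frechet_derivative \<tau> (at y) h) = local_form A \<eta> c y h"
    if "y \<in> S" for y h
    using that assms
        by (auto simp: S_def \<tau>_def chart_inv_chart[OF A] local_form_chart coord_vec_change[OF A])
  have D: "frechet_derivative (\<lambda>y. local_form A \<eta> c y h) (at x) k =
      frechet_derivative (\<lambda>z. local_form A \<eta> d z (frechet_derivative \<tau> (at x) h)) (at (\<tau> x))
        (frechet_derivative \<tau> (at x) k) +
      local_form A \<eta> d (\<tau> x) (frechet_derivative (\<lambda>y. frechet_derivative \<tau> (at y) h) (at x) k)" for h k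
  proof -
    have "((\<lambda>y. local_form A \<eta> d (\<tau> y) (frechet_derivative \<tau> (at y) h)) has_derivative
      (\<lambda>k. frechet_derivative (\<lambda>z. local_form A \<eta> d z (frechet_derivative \<tau> (at x) h)) (at (\<tau> x))
        (frechet_derivative \<tau> (at x) k) +
      local_form A \<eta> d (\<tau> x) (frechet_derivative (\<lambda>y. frechet_derivative \<tau> (at y) h) (at x) k))) (at x)"
      by (rule has_derivative_linear_apply[where z = x and a = \<tau> and S = "snd d ` fst d"
            and g = "\<lambda>y. frechet_derivative \<tau> (at y) h"])
        (use assms in \<open>auto intro: open_chart_image[OF A] linear_local_form smooth_on_local_form
           smooth_on_has_derivative[OF S \<tau> x] smooth_on_has_derivative[OF S
               smooth_on_derivative[OF S \<tau>] x]
           simp: \<tau>x\<close>)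
    then have "((\<lambda>y. local_form A \<eta> c y h) has_derivative
      (\<lambda>k. frechet_derivative (\<lambda>z. local_form A \<eta> d z (frechet_derivative \<tau> (at x) h)) (at (\<tau> x))
        (frechet_derivative \<tau> (at x) k) +
      local_form A \<eta> d (\<tau> x) (frechet_derivative (\<lambda>y. frechet_derivative \<tau> (at y) h) (at x) k))) (at x)"
      by (rule has_derivative_transform_within_open[OF _ S x]) (rule eq)
    from fun_cong[OF frechet_derivative_at[OF this], of k] show ?thesis by (rule sym)
  qed
  show ?thesis
    using second_derivative_symmetric[OF S \<tau> x, of w v]
    by (simp add: local_ext_deriv_def D flip: \<tau>_def x_def \<tau>x)
qed

text \<open>Allows one fixed chart for all base points in its domain; without it the arbitrary
  selection by \<open>chart_at\<close> would block any statement about smooth dependence on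
  \<open>p\<close>.\<close>

lemma ext_deriv_eq:
  assumes "c \<in> A" "p \<in> fst c" "V \<in> tangent_space A p" "W \<in> tangent_space A p"
  shows "ext_deriv A \<eta> V W = local_ext_deriv A \<eta> c (snd c p) (snd V c) (snd W c)"
proof -
  define d where "d = chart_at A p"
  have d: "d \<in> A" "p \<in> fst d" using chart_at in_points[OF assms(1,2)] by (auto simp: d_def)
  have "ext_deriv A \<eta> V W = local_ext_deriv A \<eta> d (snd d p) (snd V d) (snd W d)"
    using tangent_spaceD(1)[OF assms(3)] by (simp add: ext_deriv_def local_ext_deriv_def Let_def d_def)
  then show ?thesis
    using local_ext_deriv_change[OF assms(1) d(1) assms(2) d(2), of "snd V c" "snd W c"]
      tangent_spaceD(3)[OF assms(3,1) d(1) assms(2) d(2)]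
      tangent_spaceD(3)[OF assms(4,1) d(1) assms(2) d(2)] by simp
qed

lemma linear_local_ext_deriv:
  assumes "c \<in> A" "x \<in> snd c ` fst c"
  shows "linear (local_ext_deriv A \<eta> c x v)"
  unfolding local_ext_deriv_def
  by (intro linear_compose_sub linear_frechet_derivative_param[where S = "snd c ` fst c"]
      smooth_on_linear_derivative[where S = "snd c ` fst c"] open_chart_image[OF A]
      linear_local_form smooth_on_local_form assms) 

lemma smooth_on_local_ext_deriv:
  assumes "c \<in> A"
  shows "smooth_on (snd c ` fst c) (\<lambda>x. local_ext_deriv A \<eta> c x v w)"
  unfolding local_ext_deriv_def
  using open_chart_image[OF A assms] smooth_on_local_form[OF assms]
  by (intro smooth_on_diff smooth_on_derivative)

end

text \<open>\<open>\<pi>\<close> is meant to be a left inverse of \<open>s\<close>.\<close>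

definition image_atlas :: "('a \<Rightarrow> 'b) \<Rightarrow> ('b \<Rightarrow> 'a) \<Rightarrow> ('a, 'e) atlas \<Rightarrow> ('b, 'e) atlas" where
  "image_atlas s \<pi> A = (\<lambda>c. (s ` fst c, snd c \<circ> \<pi>)) ` A"

lemma points_image_atlas: "points (image_atlas s \<pi> A) = s ` points A"
  by (auto simp: points_def image_atlas_def)

lemma smooth_atlas_image_atlas:
  fixes A :: "('a, 'e::euclidean_space) atlas"
  assumes A: "smooth_atlas A" and s: "\<And>p. p \<in> points A \<Longrightarrow> \<pi> (s p) = p"
  shows "smooth_atlas (image_atlas s \<pi> A)"
proof (rule smooth_atlasI)
  fix k assume "k \<in> image_atlas s \<pi> A"
  then show "inj_on (snd k) (fst k)"
    using inj_on_chart[OF A] by (force simp: image_atlas_def inj_on_def s in_points)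
next
  fix k k' assume "k \<in> image_atlas s \<pi> A" "k' \<in> image_atlas s \<pi> A"
  then obtain c c' where k: "k = (s ` fst c, snd c \<circ> \<pi>)" "k' = (s ` fst c', snd c' \<circ> \<pi>)" "c \<in> A" "c' \<in> A"
    by (auto simp: image_atlas_def)
  have \<pi>s: "\<pi> (s p) = p" if "p \<in> fst c" for p using s in_points[OF k(3) that] .
  have \<pi>s': "\<pi> (s p) = p" if "p \<in> fst c'" for p using s in_points[OF k(4) that] .
  have int: "fst k \<inter> fst k' = s ` (fst c \<inter> fst c')"
    using \<pi>s \<pi>s' by (auto simp: k) (metis IntI image_eqI)
  have im: "snd k ` (fst k \<inter> fst k') = snd c ` (fst c \<inter> fst c')"
    unfolding int unfolding k(1) snd_conv image_image o_def by (rule image_cong) (auto simp: \<pi>s)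
  show "open (snd k ` (fst k \<inter> fst k'))" unfolding im by (rule open_chart_overlap[OF A k(3,4)])
  show "\<exists>\<tau>. smooth_on (snd k ` (fst k \<inter> fst k')) \<tau> \<and> (\<forall>p\<in>fst k \<inter> fst k'. snd k' p = \<tau> (snd k p))"
  proof (intro exI conjI ballI)
    show "smooth_on (snd k ` (fst k \<inter> fst k')) (snd c' \<circ> chart_inv c)"
      unfolding im by (rule smooth_on_transition[OF A k(3,4)])
    show "snd k' z = (snd c' \<circ> chart_inv c) (snd k z)" if "z \<in> fst k \<inter> fst k'" for z
      using that \<pi>s unfolding int by (auto simp: k chart_inv_chart[OF A k(3)])
  qed
qed

text \<open>In the transported charts \<open>s\<close> and \<open>\<pi>\<close> are both the
  identity, so they are inverse homeomorphisms, and the two topological axioms carry over.\<close>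

lemma smooth_manifold_image_atlas:
  fixes A :: "('a, 'e::euclidean_space) atlas"
  assumes A: "smooth_manifold A" and s: "\<And>p. p \<in> points A \<Longrightarrow> \<pi> (s p) = p"
  shows "smooth_manifold (image_atlas s \<pi> A)"
proof -
  note A' = smooth_manifold_imp_smooth_atlas[OF A]
  note C = smooth_atlas_image_atlas[where s = s and \<pi> = \<pi>, OF A' s]
  have "smooth_map A (image_atlas s \<pi> A) s"
  proof (rule smooth_mapI[OF A' C])
    fix p assume "p \<in> points A"
    then obtain c where c: "c \<in> A" "p \<in> fst c" by (auto simp: points_def)
    have "local_representative c (s ` fst c, snd c \<circ> \<pi>) s (\<lambda>x. x)"
      using smooth_on_ident[OF open_chart_image[OF A' c(1)]] c
      by (intro local_representativeI) (auto simp: s in_points)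
    then show "\<exists>c\<in>A. \<exists>c'\<in>image_atlas s \<pi> A. \<exists>f. p \<in> fst c \<and> local_representative c c' s f"
      using c by (force simp: image_atlas_def)
  qed
  moreover have "smooth_map (image_atlas s \<pi> A) A \<pi>"
  proof (rule smooth_mapI[OF C A'])
    fix z assume "z \<in> points (image_atlas s \<pi> A)"
    then obtain c where c: "c \<in> A" "z \<in> s ` fst c" by (auto simp: points_def image_atlas_def)
    have im: "(snd c \<circ> \<pi>) ` s ` fst c = snd c ` fst c"
      using c by (force simp: s in_points)
    have "local_representative (s ` fst c, snd c \<circ> \<pi>) c \<pi> (\<lambda>x. x)"
    proof (rule local_representativeI)
      show "smooth_on (snd (s ` fst c, snd c \<circ> \<pi>) ` fst (s ` fst c, snd c \<circ> \<pi>)) (\<lambda>x. x)"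
        unfolding fst_conv snd_conv im by (rule smooth_on_ident[OF open_chart_image[OF A' c(1)]])
    qed (use c in \<open>auto simp: s in_points\<close>)
    then show "\<exists>c\<in>image_atlas s \<pi> A. \<exists>c'\<in>A. \<exists>f. z \<in> fst c \<and> local_representative c c' \<pi> f"
      using c by (force simp: image_atlas_def)
  qed
  ultimately have "homeomorphic_maps (manifold_topology A) (manifold_topology (image_atlas s \<pi> A)) s \<pi>"
    using s by (auto simp: homeomorphic_maps_def smooth_map_def topspace_manifold_topology[OF A']
        topspace_manifold_topology[OF C] points_image_atlas)
  then have "manifold_topology A homeomorphic_space manifold_topology (image_atlas s \<pi> A)"
    using homeomorphic_space_def by blast
  then show ?thesis
    using A C homeomorphic_Hausdorff_space homeomorphic_space_second_countability
    unfolding smooth_manifold_def smooth_atlas_def by blast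
qed

section \<open>Bundles times the real line and the two contact forms in coordinates\<close>

abbreviation (input) tangent_times_real ::
    "('a, 'e::euclidean_space) atlas \<Rightarrow> (('a, 'e) tvec \<times> real, ('e \<times> 'e) \<times> real) atlas"
  where "tangent_times_real A \<equiv> times_real (tangent_bundle A)"

abbreviation (input) cotangent_times_real ::
    "('a, 'e::euclidean_space) atlas \<Rightarrow> (('a, 'e) covec \<times> real, ('e \<times> 'e) \<times> real) atlas"
  where "cotangent_times_real A \<equiv> times_real (cotangent_bundle A)"

abbreviation (input) tangent_real_chart ::
  "('a, 'e::euclidean_space) atlas \<Rightarrow> ('a, 'e) chart \<Rightarrow> (('a, 'e) tvec \<times> real, ('e \<times> 'e) \<times> real) chart"
  where "tangent_real_chart A c \<equiv> times_real_chart (tangent_chart A c)"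

abbreviation (input) cotangent_real_chart ::
  "('a, 'e::euclidean_space) atlas \<Rightarrow> ('a, 'e) chart \<Rightarrow> (('a, 'e) covec \<times> real, ('e \<times> 'e) \<times> real) chart"
  where "cotangent_real_chart A c \<equiv> times_real_chart (cotangent_chart A c)"

lemma tangent_real_chart_in:
  "c \<in> A \<Longrightarrow> tangent_real_chart A c \<in> tangent_times_real A"
  "c \<in> A \<Longrightarrow> cotangent_real_chart A c \<in> cotangent_times_real A"
  by (auto simp: times_real_eq tangent_bundle_def cotangent_bundle_def)

lemma mem_tangent_real_chart: "z \<in> fst (tangent_real_chart A c) \<longleftrightarrow>
    fst (fst z) \<in> fst c \<and> fst z \<in> tangent_space A (fst (fst z))"
  by (simp add: fst_times_real_chart in_tangent_chart)

lemma mem_cotangent_real_chart: "w \<in> fst (cotangent_real_chart A c) \<longleftrightarrow>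
    fst (fst w) \<in> fst c \<and> fst w \<in> cotangent_space A (fst (fst w))"
  by (simp add: fst_times_real_chart in_cotangent_chart)

lemma snd_tangent_real_chart:
    "snd (tangent_real_chart A c) z = ((snd c (fst (fst z)), snd (fst z) c), snd z)"
  by (simp add: snd_times_real_chart snd_tangent_chart)

lemma mem_points_tangent_times_real: "z \<in> points (tangent_times_real A) \<longleftrightarrow>
    fst z \<in> tangent_space A (fst (fst z))"
  by (cases z) (simp add: points_times_real points_tangent_bundle)

lemma mem_points_cotangent_times_real: "w \<in> points (cotangent_times_real A) \<longleftrightarrow>
    fst w \<in> cotangent_space A (fst (fst w))"
  by (cases w) (simp add: points_times_real points_cotangent_bundle)

lemma local_representative_fst_times_real:
  assumes "smooth_atlas B" "k \<in> B"
  shows "local_representative (times_real_chart k) k fst fst"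
proof (rule local_representativeI)
  note op = open_chart_image[OF smooth_atlas_times_real[OF assms(1)], of "times_real_chart k"]
  show "smooth_on (snd (times_real_chart k) ` fst (times_real_chart k)) fst"
    using smooth_on_fst[OF op smooth_on_ident[OF op]] assms(2) by (simp add: times_real_eq)
qed (auto simp: fst_times_real_chart snd_times_real_chart)

context
  fixes A :: "('a, 'e::euclidean_space) atlas"
  assumes A: "smooth_atlas A"
begin

private lemmas tb = smooth_atlas_tangent_bundle[OF A] and cb = smooth_atlas_cotangent_bundle[OF A]
private lemmas tbr = smooth_atlas_times_real[OF tb] and cbr = smooth_atlas_times_real[OF cb]

lemma tangent_real_chart_image:
  assumes "c \<in> A"
  shows "snd (tangent_real_chart A c) ` fst (tangent_real_chart A c) = (snd c ` fst c \<times> UNIV) \<times> UNIV"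
  using times_real_chart_image[of "tangent_chart A c" "tangent_chart A c"]
    tangent_chart_image[OF A assms, of c] by simp

lemma cotangent_real_chart_image:
  assumes "c \<in> A"
  shows "snd (cotangent_real_chart A c) ` fst (cotangent_real_chart A c) = (snd c ` fst c \<times> UNIV) \<times> UNIV"
  using times_real_chart_image[of "cotangent_chart A c" "cotangent_chart A c"]
    cotangent_chart_image[OF A assms, of c] by simp

lemma local_representative_tangent_projection:
  assumes "c \<in> A"
  shows "local_representative (tangent_chart A c) c fst fst"
proof (rule local_representativeI)
  note op = open_chart_image[OF tb, of "tangent_chart A c"]
  show "smooth_on (snd (tangent_chart A c) ` fst (tangent_chart A c)) fst"
    using smooth_on_fst[OF op smooth_on_ident[OF op]] assms by (simp add: tangent_bundle_def)
qed (auto simp: in_tangent_chart snd_tangent_chart)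

lemma local_representative_cotangent_projection:
  assumes "c \<in> A"
  shows "local_representative (cotangent_chart A c) c fst fst"
proof (rule local_representativeI)
  note op = open_chart_image[OF cb, of "cotangent_chart A c"]
  show "smooth_on (snd (cotangent_chart A c) ` fst (cotangent_chart A c)) fst"
    using smooth_on_fst[OF op smooth_on_ident[OF op]] assms by (simp add: cotangent_bundle_def)
qed (auto simp: in_cotangent_chart snd_cotangent_chart)

text \<open>Both pushforwards are along projections, represented by \<open>fst\<close>. What remains
  is the dw-component minus the base-point covector applied to the dx-component.\<close>

lemma canonical_contact_form_eq:
  assumes Y: "Y \<in> tangent_space (cotangent_times_real A) w" and c: "c \<in> A" "fst (fst w) \<in> fst c"
  shows "canonical_contact_form A Y = snd (snd Y (cotangent_real_chart A c)) -
    snd (fst w) (coord_vec A c (fst (fst w)) (fst (fst (snd Y (cotangent_real_chart A c)))))"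
proof -
  have w: "fst w \<in> cotangent_space A (fst (fst w))" using tangent_spaceD(2)[OF Y]
      by (simp add: mem_points_cotangent_times_real)
  have cc: "cotangent_chart A c \<in> cotangent_bundle A" using c by (simp add: cotangent_bundle_def)
  have wcc: "fst w \<in> fst (cotangent_chart A c)" using w c by (simp add: in_cotangent_chart)
  have wch: "w \<in> fst (cotangent_real_chart A c)" using w c by (simp add: mem_cotangent_real_chart)
  let ?k = "snd Y (cotangent_real_chart A c)"
  have "pushforward (cotangent_times_real A) (cotangent_bundle A) fst Y =
      coord_vec (cotangent_bundle A) (cotangent_chart A c) (fst w) (fst ?k)"
    using pushforward_eq[OF cbr cb tangent_real_chart_in(2)[OF c(1)] cc wch Y
        local_representative_fst_times_real[OF cb cc]]
    by (simp add: frechet_derivative_fst)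
  moreover have "pushforward (cotangent_bundle A) A fst
      (coord_vec (cotangent_bundle A) (cotangent_chart A c) (fst w) (fst ?k)) =
      coord_vec A c (fst (fst w)) (fst (fst ?k))"
    using pushforward_eq[OF cb A cc c(1) wcc coord_vec_in_tangent_space[OF cb cc wcc]
        local_representative_cotangent_projection[OF c(1)], of "fst ?k"]
    by (simp add: frechet_derivative_fst snd_coord_vec_self[OF cb cc wcc])
  moreover have "dfun (cotangent_times_real A) snd Y = snd ?k"
    using dfun_eq[OF cbr tangent_real_chart_in(2)[OF c(1)] wch Y
        bounded_linear_imp_differentiable[OF bounded_linear_snd], of snd]
    by (simp add: frechet_derivative_snd snd_times_real_chart)
  ultimately show ?thesis
    by (simp add: canonical_contact_form_def pullback_def liouville_form_def)
qed

context
  fixes \<eta> :: "('a, 'e) tvec \<Rightarrow> real"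
  assumes \<eta>: "one_form A \<eta>"
begin

text \<open>\<open>c\<close> is the chart in which \<open>complete_lift\<close> is written, and
  \<open>k\<close> holds the components ((dx, dxdot), du) of \<open>Z\<close>. The two lifts then
  evaluate literally.\<close>

lemma tangent_contact_form_eq:
  assumes Z: "Z \<in> tangent_space (tangent_times_real A) z"
  defines "c \<equiv> chart_at A (fst (fst z))"
  defines "x \<equiv> snd c (fst (fst z))" and "k \<equiv> snd Z (tangent_real_chart A c)"
  shows "tangent_contact_form A \<eta> Z = snd z * local_form A \<eta> c x (fst (fst k)) +
    (frechet_derivative (\<lambda>y. local_form A \<eta> c y (fst (fst k))) (at x) (snd (fst z) c) +
     local_form A \<eta> c x (snd (fst k)))"
proof -
  have z: "fst z \<in> tangent_space A (fst (fst z))" using tangent_spaceD(2)[OF Z]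
      by (simp add: mem_points_tangent_times_real)
  note c = chart_at[OF tangent_spaceD(2)[OF z], folded c_def]
  have tc: "tangent_chart A c \<in> tangent_bundle A" using c by (simp add: tangent_bundle_def)
  have ztc: "fst z \<in> fst (tangent_chart A c)" using z c by (simp add: in_tangent_chart)
  have zch: "z \<in> fst (tangent_real_chart A c)" using z c by (simp add: mem_tangent_real_chart)
  have push: "pushforward (tangent_times_real A) (tangent_bundle A) fst Z =
      coord_vec (tangent_bundle A) (tangent_chart A c) (fst z) (fst k)"
    using pushforward_eq[OF tbr tb tangent_real_chart_in(1)[OF c(1)] tc zch Z
        local_representative_fst_times_real[OF tb tc]]
    by (simp add: frechet_derivative_fst k_def)
  have "pushforward (tangent_bundle A) A fst (coord_vec (tangent_bundle A) (tangent_chart A c)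
      (fst z) (fst k)) =
      coord_vec A c (fst (fst z)) (fst (fst k))"
    using pushforward_eq[OF tb A tc c(1) ztc coord_vec_in_tangent_space[OF tb tc ztc]
        local_representative_tangent_projection[OF c(1)], of "fst k"]
    by (simp add: frechet_derivative_fst snd_coord_vec_self[OF tb tc ztc])
  then have "vertical_lift A \<eta> (pushforward (tangent_times_real A) (tangent_bundle A) fst Z) =
      local_form A \<eta> c x (fst (fst k))"
    by (simp add: vertical_lift_def pullback_def push x_def local_form_chart[OF A \<eta> c])
  moreover have "complete_lift A \<eta> (pushforward (tangent_times_real A) (tangent_bundle A) fst Z) =
    frechet_derivative (\<lambda>y. local_form A \<eta> c y (fst (fst k))) (at x) (snd (fst z) c) +
     local_form A \<eta> c x (snd (fst k))"
    by (simp add: complete_lift_def push Let_def case_prod_beta snd_coord_vec_self[OF tb tc ztc] x_def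
        flip: c_def)
  ultimately show ?thesis
    using tangent_spaceD(1)[OF Z] by (simp add: tangent_contact_form_def pullback_def)
qed

end

end

section \<open>The contact map in a fibre\<close>

text \<open>The fibre of \<open>contact_beta\<close> over \<open>x\<close> as an endomorphism of one
  vector space: the covector part is encoded by its values on the basis, as in
  \<open>cotangent_chart\<close>.\<close>

definition local_contact_beta ::
  "('a, 'e::euclidean_space) atlas \<Rightarrow> (('a, 'e) tvec \<Rightarrow> real) \<Rightarrow> ('a, 'e) chart \<Rightarrow> 'e \<Rightarrow> 'e \<times> real \<Rightarrow>
      'e \<times> real" where
  "local_contact_beta A \<eta> c x y =
    (\<Sum>b\<in>Basis. (- local_ext_deriv A \<eta> c x (fst y) b - snd y * local_form A \<eta> c x b) *\<^sub>R b,
     local_form A \<eta> c x (fst y))"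

lemma snd_contact_beta: "snd (contact_beta A \<eta> z) = \<eta> (fst z)"
  by (simp add: contact_beta_def case_prod_beta)

lemma fst_contact_beta:
  "fst (contact_beta A \<eta> z) = covector A (fst (fst z)) (\<lambda>W. - ext_deriv A \<eta> (fst z) W - snd z * \<eta> W)"
  by (simp add: contact_beta_def case_prod_beta)

context
  fixes A :: "('a, 'e::euclidean_space) atlas" and \<eta> :: "('a, 'e) tvec \<Rightarrow> real" and n :: nat
  assumes contact: "contact_manifold n A \<eta>"
begin

lemma contact_smooth_atlas: "smooth_atlas A"
  using contact by (simp add: contact_manifold_def smooth_manifold_imp_smooth_atlas)

lemma contact_one_form: "one_form A \<eta>"
  using contact by (simp add: contact_manifold_def)

private lemmas A = contact_smooth_atlas and \<eta> = contact_one_form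

lemma linear_local_contact_beta:
  assumes "c \<in> A" "x \<in> snd c ` fst c"
  shows "linear (local_contact_beta A \<eta> c x)"
proof -
  have 1: "linear (\<lambda>v. local_ext_deriv A \<eta> c x v w)" for w
    using linear_compose_neg[OF linear_local_ext_deriv[OF A \<eta> assms, of w]]
      local_ext_deriv_skew[of A \<eta> c x _ w] by simp
  note 2 = linear_local_form[OF A \<eta> assms]
  show ?thesis
    by (intro linearI)
      (simp_all add: local_contact_beta_def linear_add[OF 1] linear_scale[OF 1] linear_add[OF 2]
         linear_scale[OF 2] scaleR_sum_right algebra_simps flip: sum.distrib)
qed

lemma smooth_on_local_contact_beta:
  assumes "c \<in> A"
  shows "smooth_on (snd c ` fst c) (\<lambda>x. local_contact_beta A \<eta> c x y)"
proof -
  note op = open_chart_image[OF A assms]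
  show ?thesis
    unfolding local_contact_beta_def
    by (intro smooth_on_Pair[OF op] smooth_on_sum[OF op] smooth_on_scaleR[OF op] smooth_on_const[OF op]
        smooth_on_diff[OF op] smooth_on_minus[OF op] smooth_on_mult[OF op]
        smooth_on_local_ext_deriv[OF A \<eta> assms] smooth_on_local_form[OF A \<eta> assms])
qed

text \<open>Decodes the component vector back into the functional, which depends linearly on
  \<open>w\<close>.\<close>

lemma local_contact_beta_inner:
  assumes "c \<in> A" "x \<in> snd c ` fst c"
  shows "fst (local_contact_beta A \<eta> c x y) \<bullet> w =
    - local_ext_deriv A \<eta> c x (fst y) w - snd y * local_form A \<eta> c x w"
proof -
  have "linear (\<lambda>w. - local_ext_deriv A \<eta> c x (fst y) w - snd y * local_form A \<eta> c x w)"
    using linear_local_form[OF A \<eta> assms] linear_local_ext_deriv[OF A \<eta> assms]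
    by (intro linearI) (simp_all add: linear_add linear_scale algebra_simps)
  from linear_functional_eq_inner[OF this, of w, symmetric] show ?thesis
    by (simp add: local_contact_beta_def)
qed

text \<open>The contact condition concerns tangent vectors; once written in the chart
  \<open>c\<close> it becomes the hypothesis of \<open>contact_form_injective\<close> for the local
  expressions of \<eta> and d\<eta>.\<close>

lemma local_contact_beta_eq_0:
  assumes c: "c \<in> A" "x \<in> snd c ` fst c" and "local_contact_beta A \<eta> c x y = 0"
  shows "y = 0"
proof -
  from c obtain p where p: "p \<in> fst c" "x = snd c p" by auto
  have dim: "DIM('e) = 2 * n + 1" using contact by (simp add: contact_manifold_def)
  let ?v = "\<lambda>h. coord_vec A c p h"
  from contact in_points[OF c(1) p(1)] obtain v where v: "\<And>i. v i \<in> tangent_space A p"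
    "wedge 1 (2 * n) (\<lambda>w. \<eta> (w 0)) (two_form_power (\<lambda>w. ext_deriv A \<eta> (w 0) (w 1)) n) v \<noteq> 0"
    unfolding contact_manifold_def by blast
  \<comment> \<open>Writing the vectors through their components exhibits the top form as a
    composition with \<open>coord_vec\<close>, to which \<open>wedge_comp\<close> and
    \<open>two_form_power_comp\<close> apply.\<close>
  have "v = (\<lambda>i. ?v (snd (v i) c))"
    using coord_vec_component[OF A v(1) c(1) p(1)] by simp
  with v(2) have "wedge 1 (2 * n) (\<lambda>w. \<eta> (w 0)) (two_form_power (\<lambda>w. ext_deriv A \<eta> (w 0) (w 1)) n)
      (\<lambda>i. ?v (snd (v i) c)) \<noteq> 0" by simp
  then have "wedge 1 (2 * n) (\<lambda>w. \<eta> (?v (w 0)))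
      (two_form_power (\<lambda>w. ext_deriv A \<eta> (?v (w 0)) (?v (w 1))) n) (\<lambda>i. snd (v i) c) \<noteq> 0"
    by (simp add: wedge_comp[where g = ?v] two_form_power_comp[where g = ?v])
  moreover have "\<eta> (?v h) = local_form A \<eta> c x h" for h
    using p c by (simp add: local_form_chart[OF A \<eta>])
  moreover have "ext_deriv A \<eta> (?v h) (?v k) = local_ext_deriv A \<eta> c x h k" for h k
    using p c coord_vec_in_tangent_space[OF A]
    by (simp add: ext_deriv_eq[OF A \<eta> c(1) p(1)] snd_coord_vec_self[OF A])
  ultimately have nz: "wedge 1 (2 * n) (\<lambda>w. local_form A \<eta> c x (w 0))
      (two_form_power (\<lambda>w. local_ext_deriv A \<eta> c x (w 0) (w 1)) n) (\<lambda>i. snd (v i) c) \<noteq> 0"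
    by simp
  have "fst y = 0 \<and> snd y = 0"
  proof (rule contact_form_injective[OF _ _ _ dim nz])
    show "linear (local_ext_deriv A \<eta> c x v)" for v by (rule linear_local_ext_deriv[OF A \<eta> c])
    show "local_ext_deriv A \<eta> c x v w = - local_ext_deriv A \<eta> c x w v" for v w
      by (rule local_ext_deriv_skew)
    show "linear (local_form A \<eta> c x)" by (rule linear_local_form[OF A \<eta> c])
    show "local_ext_deriv A \<eta> c x (fst y) w + snd y * local_form A \<eta> c x w = 0" for w
      using local_contact_beta_inner[OF c, of y w] assms(3) by simp
    show "local_form A \<eta> c x (fst y) = 0"
      using assms(3) by (simp add: local_contact_beta_def prod_eq_iff)
  qed
  then show ?thesis by (simp add: prod_eq_iff)
qed

lemma bij_local_contact_beta:
  assumes "c \<in> A" "x \<in> snd c ` fst c"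
  shows "bij (local_contact_beta A \<eta> c x)"
proof -
  note lin = linear_local_contact_beta[OF assms]
  have "inj (local_contact_beta A \<eta> c x)"
    using local_contact_beta_eq_0[OF assms] by (subst linear_injective_0[OF lin]) blast
  then show ?thesis using linear_injective_imp_surjective[OF lin] by (simp add: bij_def)
qed

lemma smooth_on_inv_local_contact_beta:
  assumes "c \<in> A"
  shows "smooth_on (snd c ` fst c \<times> UNIV) (\<lambda>z. inv (local_contact_beta A \<eta> c (fst z)) (snd z))"
  by (rule smooth_on_linear_inverse[OF open_chart_image[OF A assms] linear_local_contact_beta[OF assms]
        smooth_on_local_contact_beta[OF assms]])
    (use bij_local_contact_beta[OF assms] in \<open>auto simp: bij_def\<close>)

lemma ext_deriv_skew:
  assumes "V \<in> tangent_space A p" "W \<in> tangent_space A p"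
  shows "ext_deriv A \<eta> V W = - ext_deriv A \<eta> W V"
proof -
  note c = chart_at[OF tangent_spaceD(2)[OF assms(1)]]
  show ?thesis
    unfolding ext_deriv_eq[OF A \<eta> c assms] ext_deriv_eq[OF A \<eta> c assms(2,1)]
    by (rule local_ext_deriv_skew)
qed

lemma contact_beta_in_cotangent_space:
  assumes "V \<in> tangent_space A p"
  shows "fst (contact_beta A \<eta> (V, u)) \<in> cotangent_space A p"
proof -
  note c = chart_at[OF tangent_spaceD(2)[OF assms]]
  have x: "snd (chart_at A p) p \<in> snd (chart_at A p) ` fst (chart_at A p)" using c by blast
  have "ext_deriv A \<eta> V (coord_vec A (chart_at A p) p h) =
      local_ext_deriv A \<eta> (chart_at A p) (snd (chart_at A p) p) (snd V (chart_at A p)) h" for h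
    using ext_deriv_eq[OF A \<eta> c assms coord_vec_in_tangent_space[OF A c]]
    by (simp add: snd_coord_vec_self[OF A c])
  moreover have "linear (\<lambda>h. - local_ext_deriv A \<eta> (chart_at A p) (snd (chart_at A p) p) (snd V
      (chart_at A p)) h -
      u * local_form A \<eta> (chart_at A p) (snd (chart_at A p) p) h)"
    using linear_local_ext_deriv[OF A \<eta> c(1) x] linear_local_form[OF A \<eta> c(1) x]
    by (intro linearI) (simp_all add: linear_add linear_scale algebra_simps)
  ultimately have "linear (\<lambda>h. - ext_deriv A \<eta> V (coord_vec A (chart_at A p) p h) -
      u * \<eta> (coord_vec A (chart_at A p) p h))"
    by (simp add: local_form_chart[OF A \<eta> c])
  then show ?thesis
    using covector_in_cotangent_space[OF A c] tangent_spaceD(1)[OF assms]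
    by (simp add: fst_contact_beta)
qed

lemma contact_beta_chart:
  assumes c: "c \<in> A" "p \<in> fst c" and V: "V \<in> tangent_space A p"
  shows "snd (times_real_chart (cotangent_chart A c)) (contact_beta A \<eta> (V, u)) =
    ((snd c p, fst (local_contact_beta A \<eta> c (snd c p) (snd V c, u))),
      snd (local_contact_beta A \<eta> c (snd c p) (snd V c, u)))"
  using coord_vec_in_tangent_space[OF A c] V tangent_spaceD(1)[OF V]
  by (simp add: snd_times_real_chart fst_contact_beta snd_contact_beta cotangent_chart_covector[OF A c]
      ext_deriv_eq[OF A \<eta> c] snd_coord_vec_self[OF A c] local_contact_beta_def
      one_form_component[OF A \<eta> c])

lemma inj_on_contact_beta:
  assumes V: "V \<in> tangent_space A p" "V' \<in> tangent_space A p'"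
    and eq: "contact_beta A \<eta> (V, u) = contact_beta A \<eta> (V', u')"
  shows "V = V' \<and> u = u'"
proof -
  have "fst (fst (contact_beta A \<eta> (V, u))) = fst (fst (contact_beta A \<eta> (V', u')))" using eq by simp
  then have p: "p' = p" using tangent_spaceD(1)[OF V(1)] tangent_spaceD(1)[OF V(2)]
    by (simp add: fst_contact_beta)
  let ?c = "chart_at A p"
  note c = chart_at[OF tangent_spaceD(2)[OF V(1)]]
  have "local_contact_beta A \<eta> ?c (snd ?c p) (snd V ?c, u) =
      local_contact_beta A \<eta> ?c (snd ?c p) (snd V' ?c, u')"
    using contact_beta_chart[OF c V(1), of u] contact_beta_chart[OF c V(2)[unfolded p], of u'] eq
    by (simp add: prod_eq_iff)
  then have "(snd V ?c, u) = (snd V' ?c, u')"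
    using bij_local_contact_beta[OF c(1)] c(2) by (auto simp: bij_def dest: injD)
  then show ?thesis using tangent_vector_eqI[OF A V(1) V(2)[unfolded p] c] by simp
qed

lemma contact_beta_surj:
  assumes \<alpha>: "\<alpha> \<in> cotangent_space A p"
  obtains V u where "V \<in> tangent_space A p" "contact_beta A \<eta> (V, u) = (\<alpha>, t)"
proof -
  let ?c = "chart_at A p"
  note c = chart_at[OF cotangent_spaceD(2)[OF \<alpha>]]
  have bij: "bij (local_contact_beta A \<eta> ?c (snd ?c p))" using bij_local_contact_beta c by blast
  then obtain y where y:
      "local_contact_beta A \<eta> ?c (snd ?c p) y = (snd (snd (cotangent_chart A ?c) \<alpha>), t)"
    unfolding bij_def surj_def by metis
  define V where "V = coord_vec A ?c p (fst y)"
  have V: "V \<in> tangent_space A p" using coord_vec_in_tangent_space[OF A c] by (simp add: V_def)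
  have *: "snd (times_real_chart (cotangent_chart A ?c)) (contact_beta A \<eta> (V, snd y)) =
      ((snd ?c p, snd (snd (cotangent_chart A ?c) \<alpha>)), t)"
    using y by (simp add: contact_beta_chart[OF c V]) (simp add: V_def snd_coord_vec_self[OF A c])
  have "fst (contact_beta A \<eta> (V, snd y)) = \<alpha>"
    by (rule covector_eqI_chart[OF A contact_beta_in_cotangent_space[OF V] \<alpha> c])
      (use * cotangent_spaceD(1)[OF \<alpha>] in \<open>simp add: snd_times_real_chart snd_cotangent_chart\<close>)
  moreover have "snd (contact_beta A \<eta> (V, snd y)) = t" using * by (simp add: snd_times_real_chart)
  ultimately have "contact_beta A \<eta> (V, snd y) = (\<alpha>, t)" by (simp add: prod_eq_iff)
  with V that show thesis by blast
qed

lemma contact_beta_eq_iff: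
  assumes "V \<in> tangent_space A p"
  shows "contact_beta A \<eta> (V, u) = (covector A p \<gamma>, t) \<longleftrightarrow>
    (\<forall>W\<in>tangent_space A p. - ext_deriv A \<eta> V W - u * \<eta> W = \<gamma> W) \<and> \<eta> V = t"
  using tangent_spaceD(1)[OF assms]
  by (simp add: prod_eq_iff[of "contact_beta A \<eta> (V, u)"] fst_contact_beta snd_contact_beta
      covector_eq_iff)

section \<open>The Reeb field and the contact Hamiltonian field\<close>

lemma reeb:
  assumes p: "p \<in> points A"
  shows "reeb A \<eta> p \<in> tangent_space A p" "\<eta> (reeb A \<eta> p) = 1"
    and "\<And>W. W \<in> tangent_space A p \<Longrightarrow> ext_deriv A \<eta> (reeb A \<eta> p) W = 0"
proof -
  have "covector A p (\<lambda>_. 0) \<in> cotangent_space A p"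
    by (rule covector_in_cotangent_space[OF A chart_at[OF p]]) (rule linear_zero)
  then obtain R u where R: "R \<in> tangent_space A p" "contact_beta A \<eta> (R, u) = (covector A p (\<lambda>_. 0), 1)"
    by (rule contact_beta_surj)
  have *: "\<forall>W\<in>tangent_space A p. - ext_deriv A \<eta> R W - u * \<eta> W = 0" "\<eta> R = 1"
    using R(2) unfolding contact_beta_eq_iff[OF R(1)] by blast+
  \<comment> \<open>Surjectivity gives a preimage with unknown second entry \<open>u\<close>.
    Evaluating its equation at \<open>R\<close> itself, where \<open>\<eta> R = 1\<close>, forces
    \<open>u = 0\<close>.\<close>
  have "ext_deriv A \<eta> R R = 0" using ext_deriv_skew[OF R(1) R(1)] by simp
  then have "u = 0" using * R(1) by force
  have "\<exists>!V. V \<in> tangent_space A p \<and> \<eta> V = 1 \<and> (\<forall>W \<in> tangent_space A p. ext_deriv A \<eta> V W = 0)"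
  proof (rule ex1I[of _ R])
    fix V assume V: "V \<in> tangent_space A p \<and> \<eta> V = 1 \<and> (\<forall>W \<in> tangent_space A p. ext_deriv A \<eta> V W = 0)"
    then have "contact_beta A \<eta> (V, 0) = (covector A p (\<lambda>_. 0), 1)"
      by (subst contact_beta_eq_iff) auto
    then show "V = R" using inj_on_contact_beta[of V p R p 0 u] V R by simp
  qed (use R * \<open>u = 0\<close> in auto)
  from theI'[OF this] show "reeb A \<eta> p \<in> tangent_space A p" "\<eta> (reeb A \<eta> p) = 1"
    "\<And>W. W \<in> tangent_space A p \<Longrightarrow> ext_deriv A \<eta> (reeb A \<eta> p) W = 0"
    unfolding reeb_def by blast+
qed

lemma dfun_coord_vec:
  assumes H: "smooth_fun A H" and c: "c \<in> A" "p \<in> fst c"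
  shows "dfun A H (coord_vec A c p h) = frechet_derivative (H \<circ> chart_inv c) (at (snd c p)) h"
proof -
  have "(H \<circ> chart_inv c) differentiable (at (snd c p))"
    using smooth_on_differentiable[OF open_chart_image[OF A c(1)]] H c by (auto simp: smooth_fun_def)
  then show ?thesis
    using dfun_eq[OF A c coord_vec_in_tangent_space[OF A c], of "H \<circ> chart_inv c" H h]
    by (simp add: chart_inv_chart[OF A c(1)] snd_coord_vec_self[OF A c])
qed

lemma minus_dfun_in_cotangent_space:
  assumes H: "smooth_fun A H" and p: "p \<in> points A"
  shows "covector A p (\<lambda>W. - dfun A H W) \<in> cotangent_space A p"
proof (rule covector_in_cotangent_space[OF A chart_at[OF p]])
  note c = chart_at[OF p]
  have "linear (frechet_derivative (H \<circ> chart_inv (chart_at A p)) (at (snd (chart_at A p) p)))"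
    using smooth_on_linear_derivative[OF open_chart_image[OF A c(1)]] H c by (auto simp: smooth_fun_def)
  then show "linear (\<lambda>h. - dfun A H (coord_vec A (chart_at A p) p h))"
    by (simp add: dfun_coord_vec[OF H c] linear_compose_neg)
qed

lemma contact_ham_field:
  assumes H: "smooth_fun A H" and p: "p \<in> points A"
  shows "contact_ham_field A \<eta> H p \<in> tangent_space A p"
    and "contact_beta A \<eta> (contact_ham_field A \<eta> H p, reeb_deriv A \<eta> H p) =
      (covector A p (\<lambda>W. - dfun A H W), - H p)"
proof -
  let ?R = "reeb A \<eta> p"
  obtain X u where X: "X \<in> tangent_space A p"
    "contact_beta A \<eta> (X, u) = (covector A p (\<lambda>W. - dfun A H W), - H p)"
    by (rule contact_beta_surj[OF minus_dfun_in_cotangent_space[OF assms]])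
  have *: "\<forall>W\<in>tangent_space A p. - ext_deriv A \<eta> X W - u * \<eta> W = - dfun A H W" "\<eta> X = - H p"
    using X(2) unfolding contact_beta_eq_iff[OF X(1)] by blast+
  \<comment> \<open>Evaluating the equation for \<open>X\<close> at the Reeb vector removes d\<eta>
    and identifies the unknown \<open>u\<close> with the Reeb derivative of
    \<open>H\<close>.\<close>
  have "ext_deriv A \<eta> X ?R = 0" using ext_deriv_skew[OF X(1) reeb(1)[OF p]] reeb(3)[OF p X(1)] by simp
  then have u: "u = reeb_deriv A \<eta> H p" using * reeb[OF p] by (force simp: reeb_deriv_def)
  let ?P = "\<lambda>V. V \<in> tangent_space A p \<and> \<eta> V = - H p \<and>
        (\<forall>W \<in> tangent_space A p. ext_deriv A \<eta> V W = dfun A H W - reeb_deriv A \<eta> H p * \<eta> W)"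
  have "?P X" using X * u by (auto simp: algebra_simps)
  moreover have "V = X" if V: "?P V" for V
  proof -
    have "contact_beta A \<eta> (V, u) = (covector A p (\<lambda>W. - dfun A H W), - H p)"
      using V u by (subst contact_beta_eq_iff) auto
    then show ?thesis using inj_on_contact_beta[of V p X p u u] V X by simp
  qed
  ultimately have "contact_ham_field A \<eta> H p = X"
    unfolding contact_ham_field_def by (rule the_equality)
  then show "contact_ham_field A \<eta> H p \<in> tangent_space A p"
    and "contact_beta A \<eta> (contact_ham_field A \<eta> H p, reeb_deriv A \<eta> H p) =
      (covector A p (\<lambda>W. - dfun A H W), - H p)" using X u by auto
qed

subsection \<open>The contact map as a diffeomorphism\<close>

private abbreviation (input) K where "K \<equiv> local_contact_beta A \<eta>"

private lemmas ttr = smooth_atlas_times_real[OF smooth_atlas_tangent_bundle[OF A]]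
  and ctr = smooth_atlas_times_real[OF smooth_atlas_cotangent_bundle[OF A]]

lemma contact_beta_mem_points_cotangent_times_real: "z \<in> points (tangent_times_real A) \<Longrightarrow>
    contact_beta A \<eta> z \<in> points (cotangent_times_real A)"
  using contact_beta_in_cotangent_space[of "fst z" "fst (fst z)" "snd z"]
  by (simp add: mem_points_tangent_times_real mem_points_cotangent_times_real fst_contact_beta)

lemma local_representative_contact_beta:
  assumes c: "c \<in> A"
  shows "local_representative (tangent_real_chart A c) (cotangent_real_chart A c) (contact_beta A \<eta>)
    (\<lambda>z. ((fst (fst z), fst (K c (fst (fst z)) (snd (fst z), snd z))),
       snd (K c (fst (fst z)) (snd (fst z), snd z))))"
proof (rule local_representativeI)
  fix z assume z: "z \<in> fst (tangent_real_chart A c)"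
  then show "contact_beta A \<eta> z \<in> fst (cotangent_real_chart A c)"
    using contact_beta_in_cotangent_space[of "fst z" "fst (fst z)" "snd z"]
    by (simp add: mem_tangent_real_chart mem_cotangent_real_chart fst_contact_beta)
  show "snd (cotangent_real_chart A c) (contact_beta A \<eta> z) =
      (\<lambda>z. ((fst (fst z), fst (K c (fst (fst z)) (snd (fst z), snd z))),
       snd (K c (fst (fst z)) (snd (fst z), snd z)))) (snd (tangent_real_chart A c) z)"
    using contact_beta_chart[OF c, of "fst (fst z)" "fst z" "snd z"] z
    by (simp add: mem_tangent_real_chart snd_tangent_real_chart)
next
  let ?S = "(snd c ` fst c \<times> (UNIV :: 'e set)) \<times> (UNIV :: real set)"
  note op = open_chart_image[OF A c]
  have opS: "open ?S" using op by (intro open_Times) auto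
  note id = smooth_on_ident[OF opS]
  note sm = smooth_on_fst[OF opS smooth_on_fst[OF opS id]]
    smooth_on_snd[OF opS smooth_on_fst[OF opS id]] smooth_on_snd[OF opS id]
  have "smooth_on ?S (\<lambda>z. K c (fst (fst z)) (snd (fst z), snd z))"
    by (rule smooth_on_linear_apply[OF op opS linear_local_contact_beta[OF c]
          smooth_on_local_contact_beta[OF c] sm(1) smooth_on_Pair[OF opS sm(2,3)]]) auto
  then show "smooth_on (snd (tangent_real_chart A c) ` fst (tangent_real_chart A c)) (\<lambda>z. ((fst
      (fst z), fst (K c (fst (fst z)) (snd (fst z), snd z))),
       snd (K c (fst (fst z)) (snd (fst z), snd z))))"
    unfolding tangent_real_chart_image[OF A c]
    by (intro smooth_on_Pair[OF opS] sm smooth_on_fst[OF opS] smooth_on_snd[OF opS])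
qed

lemma smooth_map_contact_beta:
    "smooth_map (tangent_times_real A) (cotangent_times_real A) (contact_beta A \<eta>)"
proof (rule smooth_mapI[OF ttr ctr])
  fix z assume z: "z \<in> points (tangent_times_real A)"
  let ?c = "chart_at A (fst (fst z))"
  note c = chart_at[OF tangent_spaceD(2)[OF z[unfolded mem_points_tangent_times_real]]]
  have "z \<in> fst (tangent_real_chart A ?c)" using z c
      by (simp add: mem_tangent_real_chart mem_points_tangent_times_real)
  then show "\<exists>c\<in>tangent_times_real A. \<exists>c'\<in>cotangent_times_real A. \<exists>f. z \<in> fst c \<and>
      local_representative c c' (contact_beta A \<eta>) f"
    using tangent_real_chart_in[OF c(1)] local_representative_contact_beta[OF c(1)] by blast
qed

lemma bij_betw_contact_beta:
    "bij_betw (contact_beta A \<eta>) (points (tangent_times_real A)) (points (cotangent_times_real A))"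
proof (rule bij_betw_imageI)
  show "inj_on (contact_beta A \<eta>) (points (tangent_times_real A))"
    using inj_on_contact_beta by (auto simp: inj_on_def mem_points_tangent_times_real)
  show "contact_beta A \<eta> ` points (tangent_times_real A) = points (cotangent_times_real A)"
  proof
    show "points (cotangent_times_real A) \<subseteq> contact_beta A \<eta> ` points (tangent_times_real A)"
    proof
      fix w assume "w \<in> points (cotangent_times_real A)"
      then obtain V u where V:
          "V \<in> tangent_space A (fst (fst w))" "contact_beta A \<eta> (V, u) = (fst w, snd w)"
        using contact_beta_surj by (metis mem_points_cotangent_times_real)
      then have "(V, u) \<in> points (tangent_times_real A)" using tangent_spaceD(1)[OF V(1)]
          by (simp add: mem_points_tangent_times_real)
      with V(2) show "w \<in> contact_beta A \<eta> ` points (tangent_times_real A)" by force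
    qed
  qed (use contact_beta_mem_points_cotangent_times_real in blast)
qed

text \<open>Since \<open>contact_beta\<close> keeps base points, its inverse stays over the chart
  \<open>c\<close> and is there the fibrewise inverse of \<open>K c\<close>.\<close>

lemma local_representative_inv_contact_beta:
  assumes c: "c \<in> A"
  shows "local_representative (cotangent_real_chart A c) (tangent_real_chart A c) (inv_into
      (points (tangent_times_real A)) (contact_beta A \<eta>))
    (\<lambda>w. ((fst (fst w), fst (inv (K c (fst (fst w))) (snd (fst w), snd w))),
       snd (inv (K c (fst (fst w))) (snd (fst w), snd w))))"
proof (rule local_representativeI)
  fix w assume w: "w \<in> fst (cotangent_real_chart A c)"
  define z where "z = inv_into (points (tangent_times_real A)) (contact_beta A \<eta>) w"
  have "w \<in> contact_beta A \<eta> ` points (tangent_times_real A)"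
    using w bij_betw_contact_beta
        by (auto simp: mem_cotangent_real_chart mem_points_cotangent_times_real bij_betw_def)
  then have z: "z \<in> points (tangent_times_real A)" "contact_beta A \<eta> z = w"
    by (auto simp: z_def intro: inv_into_into f_inv_into_f)
  have fz: "fst (fst z) = fst (fst w)" by (simp add: fst_contact_beta flip: z(2))
  have zc: "z \<in> fst (tangent_real_chart A c)" using z fz w
      by (simp add: mem_tangent_real_chart mem_points_tangent_times_real mem_cotangent_real_chart)
  then show "z \<in> fst (tangent_real_chart A c)" .
  let ?x = "snd c (fst (fst z))"
  have "snd (cotangent_real_chart A c) w = ((?x, fst (K c ?x (snd (fst z) c, snd z))), snd (K c ?x
      (snd (fst z) c, snd z)))"
    using contact_beta_chart[OF c, of "fst (fst z)" "fst z" "snd z"] zc z(2)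
        by (simp add: mem_tangent_real_chart)
  moreover have "inv (K c ?x) (K c ?x y) = y" for y
    using bij_local_contact_beta[OF c, of ?x] zc by (simp add: mem_tangent_real_chart bij_def)
  ultimately show "snd (tangent_real_chart A c) z =
      (\<lambda>w. ((fst (fst w), fst (inv (K c (fst (fst w))) (snd (fst w), snd w))),
       snd (inv (K c (fst (fst w))) (snd (fst w), snd w)))) (snd (cotangent_real_chart A c) w)"
    by (simp add: snd_tangent_real_chart)
next
  let ?S = "(snd c ` fst c \<times> (UNIV :: 'e set)) \<times> (UNIV :: real set)"
  note op = open_chart_image[OF A c]
  have opS: "open ?S" and opT: "open (snd c ` fst c \<times> (UNIV :: ('e \<times> real) set))"
    using op by (auto intro!: open_Times)
  note id = smooth_on_ident[OF opS]
  note sm = smooth_on_fst[OF opS smooth_on_fst[OF opS id]]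
    smooth_on_snd[OF opS smooth_on_fst[OF opS id]] smooth_on_snd[OF opS id]
  have "smooth_on ?S (\<lambda>w. (\<lambda>z. inv (K c (fst z)) (snd z)) (fst (fst w), (snd (fst w), snd w)))"
    by (rule smooth_on_compose[OF opS opT _ smooth_on_inv_local_contact_beta[OF c]])
      (intro smooth_on_Pair[OF opS] sm, auto)
  then have "smooth_on ?S (\<lambda>w. inv (K c (fst (fst w))) (snd (fst w), snd w))" by simp
  then show "smooth_on (snd (cotangent_real_chart A c) ` fst (cotangent_real_chart A c)) (\<lambda>w.
      ((fst (fst w), fst (inv (K c (fst (fst w))) (snd (fst w), snd w))),
       snd (inv (K c (fst (fst w))) (snd (fst w), snd w))))"
    unfolding cotangent_real_chart_image[OF A c]
    by (intro smooth_on_Pair[OF opS] sm smooth_on_fst[OF opS] smooth_on_snd[OF opS])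
qed

lemma diffeomorphism_contact_beta:
    "diffeomorphism (tangent_times_real A) (cotangent_times_real A) (contact_beta A \<eta>)"
  unfolding diffeomorphism_def
proof (intro conjI bij_betw_contact_beta smooth_map_contact_beta smooth_mapI[OF ctr ttr])
  fix w assume w: "w \<in> points (cotangent_times_real A)"
  let ?c = "chart_at A (fst (fst w))"
  note c = chart_at[OF cotangent_spaceD(2)[OF w[unfolded mem_points_cotangent_times_real]]]
  have "w \<in> fst (cotangent_real_chart A ?c)" using w c
      by (simp add: mem_cotangent_real_chart mem_points_cotangent_times_real)
  then show "\<exists>c\<in>cotangent_times_real A. \<exists>c'\<in>tangent_times_real A. \<exists>f. w \<in> fst c \<and>
      local_representative c c' (inv_into (points (tangent_times_real A)) (contact_beta A \<eta>)) f"
    using tangent_real_chart_in[OF c(1)] local_representative_inv_contact_beta[OF c(1)] by blast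
qed

text \<open>dw pulls back to the derivative of \<eta>(V), and the Liouville form to -d\<eta>(V, dx)
  - u \<eta>(dx). The dx-derivative of \<eta>(V) cancels one half of d\<eta>; the other half is the
  derivative term of the complete lift.\<close>

lemma pullback_canonical_contact_form:
  assumes Z: "Z \<in> tangent_space (tangent_times_real A) z"
  shows "pullback (tangent_times_real A) (cotangent_times_real A) (contact_beta A \<eta>)
      (canonical_contact_form A) Z = tangent_contact_form A \<eta> Z"
proof -
  define p where "p = fst (fst z)"
  define V where "V = fst z"
  define u where "u = snd z"
  define c where "c = chart_at A p"
  define x where "x = snd c p"
  define k where "k = snd Z (tangent_real_chart A c)"
  define L where "L = local_form A \<eta> c"
  define f where "f z = ((fst (fst z), fst (K c (fst (fst z)) (snd (fst z), snd z))),
       snd (K c (fst (fst z)) (snd (fst z), snd z)))" for z :: "('e \<times> 'e) \<times> real"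
  define f' where "f' = frechet_derivative f (at (snd (tangent_real_chart A c) z))"
  have z: "V \<in> tangent_space A p"
    using tangent_spaceD(2)[OF Z] by (simp add: mem_points_tangent_times_real V_def p_def)
  note c = chart_at[OF tangent_spaceD(2)[OF z], folded c_def]
  have x: "x \<in> snd c ` fst c" using c by (simp add: x_def)
  have zch: "z \<in> fst (tangent_real_chart A c)" using z c
      by (simp add: mem_tangent_real_chart V_def p_def)
  have zc: "snd (tangent_real_chart A c) z = ((x, snd V c), u)"
      by (simp add: snd_tangent_real_chart x_def p_def V_def u_def)
  define w where "w = contact_beta A \<eta> z"
  have w: "w \<in> fst (cotangent_real_chart A c)" and fw: "fst (fst w) = p"
    using local_representative_contact_beta[OF c(1)] zch
    by (auto simp: local_representative_def w_def fst_contact_beta p_def)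
  have rep: "local_representative (tangent_real_chart A c) (cotangent_real_chart A c)
      (contact_beta A \<eta>) f"
    using local_representative_contact_beta[OF c(1)] by (simp add: f_def[abs_def])
  define Y where "Y = coord_vec (cotangent_times_real A) (cotangent_real_chart A c) w (f' k)"
  have push: "pushforward (tangent_times_real A) (cotangent_times_real A) (contact_beta A \<eta>) Z = Y"
    unfolding Y_def f'_def k_def w_def
    by (rule pushforward_eq[OF ttr ctr tangent_real_chart_in[OF c(1)] zch Z rep])
  have Y: "Y \<in> tangent_space (cotangent_times_real A) w"
    unfolding Y_def by (rule coord_vec_in_tangent_space[OF ctr tangent_real_chart_in(2)[OF c(1)] w])
  have sndY: "snd Y (cotangent_real_chart A c) = f' k"
    unfolding Y_def by (rule snd_coord_vec_self[OF ctr tangent_real_chart_in(2)[OF c(1)] w])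
  have f': "(f has_derivative f') (at (snd (tangent_real_chart A c) z))"
    unfolding f'_def
    by (rule smooth_on_has_derivative[OF open_chart_image[OF ttr tangent_real_chart_in(1)[OF c(1)]]])
      (use rep zch in \<open>auto simp: local_representative_def\<close>)
  have 1: "fst (fst (f' k)) = fst (fst k)"
  proof -
    have "((\<lambda>z. fst (fst (f z))) has_derivative
        (\<lambda>k. fst (fst (f' k)))) (at (snd (tangent_real_chart A c) z))"
      by (intro has_derivative_fst f')
    moreover have "((\<lambda>z. fst (fst (f z))) has_derivative
        (\<lambda>k. fst (fst k))) (at (snd (tangent_real_chart A c) z))"
      unfolding f_def by (auto intro!: derivative_eq_intros)
    ultimately have "(\<lambda>k. fst (fst (f' k))) = (\<lambda>k. fst (fst k))" by (rule has_derivative_unique)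
    from fun_cong[OF this, of k] show ?thesis .
  qed
  have 2: "snd (f' k) = frechet_derivative (\<lambda>y. L y (snd V c)) (at x) (fst (fst k)) + L x (snd (fst k))"
  proof -
    have "((\<lambda>z. snd (f z)) has_derivative (\<lambda>k. snd (f' k))) (at (snd (tangent_real_chart A c) z))"
      by (rule has_derivative_snd[OF f'])
    moreover have "(\<lambda>z. snd (f z)) = (\<lambda>z. L (fst (fst z)) (snd (fst z)))"
      by (simp add: fun_eq_iff f_def local_contact_beta_def L_def)
    ultimately have D1: "((\<lambda>z. L (fst (fst z)) (snd (fst z))) has_derivative (\<lambda>k. snd (f' k)))
        (at ((x, snd V c), u))"
      by (simp only: zc)
    have "((\<lambda>z. L (fst (fst z)) (snd (fst z))) has_derivative
      (\<lambda>k. frechet_derivative (\<lambda>y. L y (snd (fst ((x, snd V c), u)))) (at (fst (fst ((x, snd V c),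
          u)))) (fst (fst k)) +
        L (fst (fst ((x, snd V c), u))) (snd (fst k)))) (at ((x, snd V c), u))"
      unfolding L_def
      by (rule has_derivative_linear_apply[where a = "\<lambda>z. fst (fst z)" and K = "local_form A \<eta> c",
            OF open_chart_image[OF A c(1)] linear_local_form[OF A \<eta> c(1)] smooth_on_local_form[OF
                A \<eta> c(1)]])
        (use x in \<open>auto intro!: derivative_eq_intros\<close>)
    from fun_cong[OF has_derivative_unique[OF D1 this], of k] show ?thesis by simp
  qed
  have 3: "snd (fst w) (coord_vec A c p h) = - local_ext_deriv A \<eta> c x (snd V c) h - u * L x h" for h
    using coord_vec_in_tangent_space[OF A c] z
    using tangent_spaceD(1)[OF z]
    by (simp add: w_def fst_contact_beta snd_covector L_def x_def u_def local_form_chart[OF A \<eta> c]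
        ext_deriv_eq[OF A \<eta> c] snd_coord_vec_self[OF A c] flip: p_def V_def)
  have "pullback (tangent_times_real A) (cotangent_times_real A) (contact_beta A \<eta>)
      (canonical_contact_form A) Z =
      snd (f' k) - snd (fst w) (coord_vec A c p (fst (fst (f' k))))"
    using canonical_contact_form_eq[OF A Y c(1)] c(2) fw by (simp add: pullback_def push sndY)
  \<comment> \<open>\<open>1\<close> is the unchanged base component, \<open>2\<close> the
    derivative of the last component \<eta>(V), and \<open>3\<close> the covector part; the
    cancellation happens here.\<close>
  also have "\<dots> = u * L x (fst (fst k)) + (frechet_derivative (\<lambda>y. L y (fst (fst k))) (at x) (snd V c) +
      L x (snd (fst k)))"
    by (simp add: 1 2 3 local_ext_deriv_def flip: L_def)
  also have "\<dots> = tangent_contact_form A \<eta> Z"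
    using tangent_contact_form_eq[OF A \<eta> Z]
    by (simp add: L_def V_def x_def u_def k_def c_def p_def)
  finally show ?thesis .
qed

subsection \<open>The section of a contact Hamiltonian\<close>

context
  fixes H :: "'a \<Rightarrow> real"
  assumes H: "smooth_fun A H"
begin

private abbreviation (input) h where "h c \<equiv> H \<circ> chart_inv c"
private abbreviation (input) s where "s p \<equiv> (contact_ham_field A \<eta> H p, reeb_deriv A \<eta> H p)"
private abbreviation (input) \<pi> where "\<pi> z \<equiv> fst (fst z)"
private abbreviation (input) C where "C \<equiv> image_atlas s \<pi> A"

text \<open>The section \<open>s\<close> and its fibre part in the chart \<open>c\<close>. They are obtained by applying the inverse
  of the contact map to \<open>- (dH, H)\<close>, which makes smoothness evident.\<close>

private definition \<sigma> where
  "\<sigma> c x = inv (K c x) (\<Sum>b\<in>Basis. (- frechet_derivative (h c) (at x) b) *\<^sub>R b, - h c x)"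

private definition S where "S c x = ((x, fst (\<sigma> c x)), snd (\<sigma> c x))"

lemma local_contact_beta_section:
  assumes "c \<in> A" "x \<in> snd c ` fst c"
  shows "K c x (\<sigma> c x) = (\<Sum>b\<in>Basis. (- frechet_derivative (h c) (at x) b) *\<^sub>R b, - h c x)"
  unfolding \<sigma>_def using bij_local_contact_beta[OF assms] by (simp add: bij_def surj_f_inv_f)

lemma smooth_on_local_fun: "c \<in> A \<Longrightarrow> smooth_on (snd c ` fst c) (h c)"
  using H by (simp add: smooth_fun_def)

lemma smooth_on_local_section:
  assumes c: "c \<in> A"
  shows "smooth_on (snd c ` fst c) (\<sigma> c)" "smooth_on (snd c ` fst c) (S c)"
proof -
  note op = open_chart_image[OF A c]
  have opT: "open (snd c ` fst c \<times> (UNIV :: ('e \<times> real) set))" using op by (auto intro!: open_Times)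
  have "smooth_on (snd c ` fst c)
      (\<lambda>x. (x, (\<Sum>b\<in>Basis. (- frechet_derivative (h c) (at x) b) *\<^sub>R b, - h c x)))"
    by (intro smooth_on_Pair[OF op] smooth_on_sum[OF op] smooth_on_scaleR[OF op] smooth_on_minus[OF op]
        smooth_on_derivative[OF op smooth_on_local_fun[OF c]] smooth_on_local_fun[OF c]
        smooth_on_const[OF op] smooth_on_ident[OF op])
  from smooth_on_compose[OF op opT this smooth_on_inv_local_contact_beta[OF c]]
  show \<sigma>: "smooth_on (snd c ` fst c) (\<sigma> c)" by (auto simp: \<sigma>_def[abs_def])
  show "smooth_on (snd c ` fst c) (S c)"
    unfolding S_def[abs_def]
    by (intro smooth_on_Pair[OF op] smooth_on_fst[OF op] smooth_on_snd[OF op] \<sigma> smooth_on_ident[OF op])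
qed

text \<open>The section consists of pointwise descriptions that carry no regularity. Identifying it
  in a chart with \<open>S c\<close> is what makes it smooth.\<close>

lemma contact_ham_section_chart:
  assumes c: "c \<in> A" "p \<in> fst c"
  shows "snd (tangent_real_chart A c) (s p) = S c (snd c p)"
proof -
  note p = in_points[OF c]
  note X = contact_ham_field[OF H p]
  have fX: "fst (contact_ham_field A \<eta> H p) = p" using tangent_spaceD(1)[OF X(1)] .
  let ?y = "(snd (contact_ham_field A \<eta> H p) c, reeb_deriv A \<eta> H p)"
  have "K c (snd c p) ?y = (\<Sum>b\<in>Basis. (- frechet_derivative (h c) (at (snd c p)) b) *\<^sub>R b, - h c
      (snd c p))"
    using contact_beta_chart[OF c X(1), of "reeb_deriv A \<eta> H p"] X(2)
    by (simp add: prod_eq_iff snd_times_real_chart cotangent_chart_covector[OF A c]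
        dfun_coord_vec[OF H c] chart_inv_chart[OF A c])
  then have "\<sigma> c (snd c p) = inv (K c (snd c p)) (K c (snd c p) ?y)" by (simp add: \<sigma>_def)
  also have "\<dots> = ?y" using bij_local_contact_beta[OF c(1)] c(2) by (simp add: bij_def)
  finally show ?thesis
    by (simp add: snd_times_real_chart snd_tangent_chart S_def fX)
qed

lemma base_contact_ham_section: "p \<in> points A \<Longrightarrow> \<pi> (s p) = p"
  using tangent_spaceD(1)[OF contact_ham_field(1)[OF H]] by simp

lemma contact_ham_section_in_points: "p \<in> points A \<Longrightarrow> s p \<in> points (tangent_times_real A)"
  using contact_ham_field(1)[OF H] base_contact_ham_section
  by (simp add: points_times_real points_tangent_bundle)

private lemma C: "smooth_atlas C"
  by (rule smooth_atlas_image_atlas[OF A]) (rule base_contact_ham_section)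

private lemma chart_C: "c \<in> A \<Longrightarrow> (s ` fst c, snd c \<circ> \<pi>) \<in> C"
  by (auto simp: image_atlas_def)

private lemma chart_C_image:
  assumes "c \<in> A"
  shows "(snd c \<circ> \<pi>) ` s ` fst c = snd c ` fst c"
  using base_contact_ham_section in_points[OF assms] by (force simp: image_image)

private lemma rep_inclusion:
  assumes c: "c \<in> A"
  shows "local_representative (s ` fst c, snd c \<circ> \<pi>) (tangent_real_chart A c) (\<lambda>z. z) (S c)"
proof (rule local_representativeI)
  show "smooth_on (snd (s ` fst c, snd c \<circ> \<pi>) ` fst (s ` fst c, snd c \<circ> \<pi>)) (S c)"
    unfolding fst_conv snd_conv chart_C_image[OF c] by (rule smooth_on_local_section(2)[OF c])
next
  fix z assume "z \<in> fst (s ` fst c, snd c \<circ> \<pi>)"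
  then obtain p where p: "p \<in> fst c" "z = s p" by auto
  note pA = in_points[OF c p(1)]
  show "z \<in> fst (tangent_real_chart A c)"
    using contact_ham_field(1)[OF H pA] base_contact_ham_section[OF pA] p
    by (simp add: fst_times_real_chart in_tangent_chart)
  show "snd (tangent_real_chart A c) z = S c (snd (s ` fst c, snd c \<circ> \<pi>) z)"
    using contact_ham_section_chart[OF c p(1)] base_contact_ham_section[OF pA] p(2) by simp
qed

text \<open>The charts of the image are base coordinates, so the retraction onto it is represented
  by the projection to the base.\<close>

private lemma rep_retraction:
  assumes c: "c \<in> A"
  shows "local_representative (tangent_real_chart A c) (s ` fst c, snd c \<circ> \<pi>) (\<lambda>z. s (\<pi> z)) \<pi>"
proof (rule local_representativeI)
  note op = open_chart_image[OF ttr tangent_real_chart_in(1)[OF c]]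
  show "smooth_on (snd (tangent_real_chart A c) ` fst (tangent_real_chart A c)) \<pi>"
    by (rule smooth_on_fst[OF op smooth_on_fst[OF op smooth_on_ident[OF op]]])
next
  fix z assume "z \<in> fst (tangent_real_chart A c)"
  then have z: "\<pi> z \<in> fst c" by (simp add: fst_times_real_chart in_tangent_chart)
  then show "s (\<pi> z) \<in> fst (s ` fst c, snd c \<circ> \<pi>)" by simp
  show "snd (s ` fst c, snd c \<circ> \<pi>) (s (\<pi> z)) = \<pi> (snd (tangent_real_chart A c) z)"
    using base_contact_ham_section[OF in_points[OF c z]]
    by (simp add: snd_times_real_chart snd_tangent_chart)
qed

private lemma points_C_chart:
  assumes "z \<in> points C"
  shows "\<pi> z \<in> points A" "z = s (\<pi> z)" "z \<in> s ` fst (chart_at A (\<pi> z))"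
proof -
  obtain p where p: "p \<in> points A" "z = s p" using assms by (auto simp: points_image_atlas)
  have \<pi>: "\<pi> z = p" unfolding p(2) by (rule base_contact_ham_section[OF p(1)])
  show pA: "\<pi> z \<in> points A" and zs: "z = s (\<pi> z)" unfolding \<pi> by fact+
  show "z \<in> s ` fst (chart_at A (\<pi> z))"
      by (rule image_eqI[where f = s and x = "\<pi> z", OF zs chart_at(2)[OF pA]])
qed

private lemma pushforward_inclusion:
  assumes V: "V \<in> tangent_space C z"
  defines "c \<equiv> chart_at A (\<pi> z)"
  defines "k \<equiv> snd V (s ` fst c, snd c \<circ> \<pi>)"
  shows "pushforward C (tangent_times_real A) (\<lambda>z. z) V =
      coord_vec (tangent_times_real A) (tangent_real_chart A c) z (frechet_derivative (S c) (at
          (snd c (\<pi> z))) k)"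
    and "c \<in> A" "\<pi> z \<in> fst c" "z \<in> fst (tangent_real_chart A c)" "z \<in> s ` fst c"
proof -
  note z = points_C_chart[OF tangent_spaceD(2)[OF V], folded c_def]
  show c: "c \<in> A" "\<pi> z \<in> fst c" unfolding c_def by (rule chart_at[OF z(1)])+
  show "z \<in> s ` fst c" by (rule z(3))
  then show "z \<in> fst (tangent_real_chart A c)" using rep_inclusion[OF c(1)]
      by (auto simp: local_representative_def)
  show "pushforward C (tangent_times_real A) (\<lambda>z. z) V =
      coord_vec (tangent_times_real A) (tangent_real_chart A c) z (frechet_derivative (S c) (at
          (snd c (\<pi> z))) k)"
    using pushforward_eq[OF C ttr chart_C[OF c(1)] tangent_real_chart_in(1)[OF c(1)] _ V
        rep_inclusion[OF c(1)]] z(3)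
    by (simp add: k_def)
qed

private lemma S_has_derivative:
  assumes "c \<in> A" "x \<in> snd c ` fst c"
  shows "(S c has_derivative (\<lambda>k. ((k, fst (frechet_derivative (\<sigma> c) (at x) k)),
      snd (frechet_derivative (\<sigma> c) (at x) k)))) (at x)"
proof -
  note D = smooth_on_has_derivative[OF open_chart_image[OF A assms(1)]
      smooth_on_local_section(1)[OF assms(1)] assms(2)]
  show ?thesis unfolding S_def[abs_def]
    by (intro has_derivative_Pair has_derivative_fst has_derivative_snd D has_derivative_ident)
qed

lemma smooth_manifold_contact_ham_section: "smooth_manifold C"
  using contact base_contact_ham_section
  by (intro smooth_manifold_image_atlas) (auto simp: contact_manifold_def)

section \<open>The image of the section is Legendrian\<close>

lemma embedded_submanifold_contact_ham_section: "embedded_submanifold (tangent_times_real A) C"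
  unfolding embedded_submanifold_def
proof (intro conjI ballI smooth_manifold_contact_ham_section)
  show incl: "smooth_map C (tangent_times_real A) (\<lambda>z. z)"
  proof (rule smooth_mapI[OF C ttr])
    fix z assume "z \<in> points C"
    then obtain c where c: "c \<in> A" and z: "z \<in> s ` fst c"
      by (auto simp: points_def image_atlas_def)
    show "\<exists>c\<in>C. \<exists>c'\<in>tangent_times_real A. \<exists>f. z \<in> fst c \<and> local_representative c c' (\<lambda>z. z) f"
      by (rule bexI[OF _ chart_C[OF c]], rule bexI[OF _ tangent_real_chart_in(1)[OF c]], rule exI,
          rule conjI[OF _ rep_inclusion[OF c]]) (simp only: fst_conv z)
  qed
  \<comment> \<open>This map is a continuous left inverse of the inclusion, so the inclusion is a
    section of a retraction and thereby a topological embedding.\<close>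
  have "smooth_map (tangent_times_real A) C (\<lambda>z. s (\<pi> z))"
  proof (rule smooth_mapI[OF ttr C])
    fix z assume "z \<in> points (tangent_times_real A)"
    then obtain c where c: "c \<in> A" and z: "z \<in> fst (tangent_real_chart A c)"
      by (auto simp: points_def times_real_eq tangent_bundle_def)
    show "\<exists>c\<in>tangent_times_real A. \<exists>c'\<in>C. \<exists>f. z \<in> fst c \<and> local_representative c c' (\<lambda>z. s (\<pi> z)) f"
      by (rule bexI[OF _ tangent_real_chart_in(1)[OF c]], rule bexI[OF _ chart_C[OF c]], rule exI,
          rule conjI[OF z rep_retraction[OF c]])
  qed
  then have "retraction_maps (manifold_topology (tangent_times_real A)) (manifold_topology C) (\<lambda>z.
      s (\<pi> z)) (\<lambda>z. z)"
    using incl base_contact_ham_section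
    by (auto simp: retraction_maps_def smooth_map_def topspace_manifold_topology[OF C]
        points_image_atlas)
  then show "embedding_map (manifold_topology C) (manifold_topology (tangent_times_real A)) (\<lambda>z. z)"
    by (intro section_imp_embedding_map) (auto simp: section_map_def)
next
  fix z assume "z \<in> points C"
  show "inj_on (pushforward C (tangent_times_real A) (\<lambda>z. z)) (tangent_space C z)"
  proof (rule inj_onI)
    fix V W assume V: "V \<in> tangent_space C z" and W: "W \<in> tangent_space C z"
      and eq: "pushforward C (tangent_times_real A) (\<lambda>z. z) V =
          pushforward C (tangent_times_real A) (\<lambda>z. z) W"
    define c where "c = chart_at A (\<pi> z)"
    note V' = pushforward_inclusion[OF V, folded c_def] and W' =
        pushforward_inclusion(1)[OF W, folded c_def]
    let ?D = "frechet_derivative (S c) (at (snd c (\<pi> z)))"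
    have "?D (snd V (s ` fst c, snd c \<circ> \<pi>)) = ?D (snd W (s ` fst c, snd c \<circ> \<pi>))"
      using arg_cong[OF eq, of "\<lambda>X. snd X (tangent_real_chart A c)"]
      unfolding V'(1) W' snd_coord_vec_self[OF ttr tangent_real_chart_in(1)[OF V'(2)] V'(4)] .
    \<comment> \<open>The first component of the derivative returns \<open>k\<close> itself, because
      \<open>S c\<close> is a graph over the base; this gives the immersion property.\<close>
    moreover have "?D = (\<lambda>k. ((k, fst (frechet_derivative (\<sigma> c) (at (snd c (\<pi> z))) k)),
        snd (frechet_derivative (\<sigma> c) (at (snd c (\<pi> z))) k)))"
      by (rule frechet_derivative_at[OF S_has_derivative[OF V'(2)], symmetric]) (rule imageI[OF V'(3)])
    ultimately have "snd V (s ` fst c, snd c \<circ> \<pi>) = snd W (s ` fst c, snd c \<circ> \<pi>)"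
      by (simp only: prod.inject)
    then show "V = W"
      by (rule tangent_vector_eqI[OF C V W chart_C[OF V'(2)], rotated]) (simp only: fst_conv V'(5))
  qed
qed

lemma pullback_tangent_contact_form_contact_ham_section:
  assumes V: "V \<in> tangent_space C z"
  shows "pullback C (tangent_times_real A) (\<lambda>z. z) (tangent_contact_form A \<eta>) V = 0"
proof -
  define c where "c = chart_at A (\<pi> z)"
  define x where "x = snd c (\<pi> z)"
  define k where "k = snd V (s ` fst c, snd c \<circ> \<pi>)"
  define L where "L = local_form A \<eta> c"
  define \<sigma>' where "\<sigma>' = frechet_derivative (\<sigma> c) (at x)"
  note V' = pushforward_inclusion[OF V, folded c_def, folded x_def k_def]
  have x: "x \<in> snd c ` fst c" using V'(3) by (simp add: x_def)
  have DS: "frechet_derivative (S c) (at x) k = ((k, fst (\<sigma>' k)), snd (\<sigma>' k))"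
    using frechet_derivative_at[OF S_has_derivative[OF V'(2) x], symmetric] by (simp add: \<sigma>'_def)
  have Z: "pushforward C (tangent_times_real A) (\<lambda>z. z) V \<in> tangent_space (tangent_times_real A) z"
    unfolding V'(1) by (rule coord_vec_in_tangent_space[OF ttr tangent_real_chart_in(1)[OF V'(2)] V'(4)])
  have sndZ: "snd (pushforward C (tangent_times_real A) (\<lambda>z. z) V) (tangent_real_chart A c) =
      ((k, fst (\<sigma>' k)), snd (\<sigma>' k))"
    unfolding V'(1) DS by (rule snd_coord_vec_self[OF ttr tangent_real_chart_in(1)[OF V'(2)] V'(4)])
  obtain p where p: "p \<in> fst c" "z = s p" using V'(5) by blast
  have "snd (tangent_real_chart A c) z = S c x"
    using contact_ham_section_chart[OF V'(2) p(1)] base_contact_ham_section[OF in_points[OF V'(2) p(1)]]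
    by (simp add: p(2) x_def)
  then have zx: "snd (fst z) c = fst (\<sigma> c x)" "snd z = snd (\<sigma> c x)"
    by (simp_all add: snd_times_real_chart snd_tangent_chart S_def)
  \<comment> \<open>The scalar component of \<open>K c y (\<sigma> c y)\<close> says \<eta>(X) = -H
    throughout the chart, so it may be differentiated, here in the direction
    \<open>k\<close>.\<close>
  have 1: "frechet_derivative (\<lambda>y. L y (fst (\<sigma> c x))) (at x) k + L x (fst (\<sigma>' k)) =
      - frechet_derivative (h c) (at x) k"
  proof -
    note op = open_chart_image[OF A V'(2)]
    have "(\<sigma> c has_derivative \<sigma>') (at x)"
      unfolding \<sigma>'_def by (rule smooth_on_has_derivative[OF op smooth_on_local_section(1)[OF V'(2)] x])
    then have "((\<lambda>y. L y (fst (\<sigma> c y))) has_derivative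
        (\<lambda>k. frechet_derivative (\<lambda>y. L y (fst (\<sigma> c x))) (at x) k + L x (fst (\<sigma>' k)))) (at x)"
      unfolding L_def
      by (intro has_derivative_linear_apply[where a = "\<lambda>y. y" and K = "local_form A \<eta> c",
            OF op linear_local_form[OF A \<eta> V'(2)] smooth_on_local_form[OF A \<eta> V'(2)] x]
          has_derivative_fst has_derivative_ident)
    then have D1: "((\<lambda>y. - h c y) has_derivative
        (\<lambda>k. frechet_derivative (\<lambda>y. L y (fst (\<sigma> c x))) (at x) k + L x (fst (\<sigma>' k)))) (at x)"
    proof (rule has_derivative_transform_within_open[OF _ op x])
      fix y assume "y \<in> snd c ` fst c"
      from local_contact_beta_section[OF V'(2) this] show "L y (fst (\<sigma> c y)) = - h c y"
        by (simp add: local_contact_beta_def L_def)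
    qed
    have "((\<lambda>y. - h c y) has_derivative (\<lambda>k. - frechet_derivative (h c) (at x) k)) (at x)"
      by (intro has_derivative_minus smooth_on_has_derivative[OF op smooth_on_local_fun[OF V'(2)] x])
    from fun_cong[OF has_derivative_unique[OF D1 this], of k] show ?thesis .
  qed
  \<comment> \<open>The covector component of the same equation at the single point
    \<open>x\<close>, applied to \<open>k\<close>.\<close>
  have 2: "- local_ext_deriv A \<eta> c x (fst (\<sigma> c x)) k - snd (\<sigma> c x) * L x k =
      - frechet_derivative (h c) (at x) k"
  proof -
    have "linear (\<lambda>w. - frechet_derivative (h c) (at x) w)"
      using smooth_on_linear_derivative[OF open_chart_image[OF A V'(2)] smooth_on_local_fun[OF V'(2)] x]
      by (rule linear_compose_neg)
    from linear_functional_eq_inner[OF this, of k]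
    have "- frechet_derivative (h c) (at x) k = fst (K c x (\<sigma> c x)) \<bullet> k"
      by (simp only: local_contact_beta_section[OF V'(2) x] fst_conv)
    then show ?thesis
      by (simp only: local_contact_beta_inner[OF V'(2) x] L_def)
  qed
  have "tangent_contact_form A \<eta> (pushforward C (tangent_times_real A) (\<lambda>z. z) V) = snd (\<sigma> c x) * L x k +
      (frechet_derivative (\<lambda>y. L y k) (at x) (fst (\<sigma> c x)) + L x (fst (\<sigma>' k)))"
    using tangent_contact_form_eq[OF A \<eta> Z, folded c_def, folded x_def]
    by (simp add: sndZ zx L_def)
  \<comment> \<open>Subtracting \<open>2\<close> from \<open>1\<close> cancels the derivative of
    \<open>H\<close> and the \<open>k\<close>-derivative of the local form on
    \<open>fst (\<sigma> c x)\<close>, leaving exactly this sum.\<close>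
  also have "\<dots> = 0" using 1 2 by (simp add: local_ext_deriv_def L_def)
  finally show ?thesis by (simp add: pullback_def)
qed

text \<open>The image is modelled on the model space of \<open>A\<close> itself; the ambient model
  doubles it and adds one real coordinate, which is the dimension count required.\<close>

lemma legendrian_submanifold_contact_ham_section:
  "legendrian_submanifold TYPE('e) (tangent_times_real A) (tangent_contact_form A \<eta>) (s ` points A)"
  unfolding legendrian_submanifold_def
proof (intro conjI exI)
  show "points C = s ` points A" by (rule points_image_atlas)
  show "\<forall>z\<in>points C. \<forall>V\<in>tangent_space C z. pullback C (tangent_times_real A) (\<lambda>x. x)
      (tangent_contact_form A \<eta>) V = 0"
    using pullback_tangent_contact_form_contact_ham_section by blast
qed (use embedded_submanifold_contact_ham_section in auto)

lemma contact_ham_section_eq_preimage: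
  "s ` points A = {z \<in> points (tangent_times_real A). contact_beta A \<eta> z \<in>
    (\<lambda>p. (covector A p (\<lambda>W. - dfun A H W), - H p)) ` points A}" (is "_ = ?R")
proof
  show "s ` points A \<subseteq> ?R"
    using contact_ham_section_in_points contact_ham_field(2)[OF H] by auto
  show "?R \<subseteq> s ` points A"
  proof
    fix z assume "z \<in> ?R"
    then obtain p where z: "z \<in> points (tangent_times_real A)" and p: "p \<in> points A"
      and "contact_beta A \<eta> z = (covector A p (\<lambda>W. - dfun A H W), - H p)" by auto
    then have "contact_beta A \<eta> z = contact_beta A \<eta> (s p)"
      using contact_ham_field(2)[OF H p] by simp
    then have "z = s p"
      using bij_betw_imp_inj_on[OF bij_betw_contact_beta] z
        contact_ham_section_in_points[OF p] by (auto dest: inj_onD)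
    then show "z \<in> s ` points A" using p by blast
  qed
qed

lemma integral_curve_iff_contact_ham_section:
  assumes "\<gamma> ` I \<subseteq> points A"
  shows "integral_curve A (contact_ham_field A \<eta> H) I \<gamma> \<longleftrightarrow>
    (\<forall>t\<in>I. (velocity A I \<gamma> t, reeb_deriv A \<eta> H (\<gamma> t)) \<in> s ` points A)"
proof -
  have "velocity A I \<gamma> t = contact_ham_field A \<eta> H (\<gamma> t) \<longleftrightarrow>
      (velocity A I \<gamma> t, reeb_deriv A \<eta> H (\<gamma> t)) \<in> s ` points A" if t: "t \<in> I" for t
  proof
    assume "(velocity A I \<gamma> t, reeb_deriv A \<eta> H (\<gamma> t)) \<in> s ` points A"
    then obtain p where p: "p \<in> points A" "velocity A I \<gamma> t = contact_ham_field A \<eta> H p" by auto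
    have "\<gamma> t = fst (velocity A I \<gamma> t)" by (simp add: velocity_def)
    also have "\<dots> = p"
      unfolding p(2) by (rule tangent_spaceD(1)[OF contact_ham_field(1)[OF H p(1)]])
    finally have "\<gamma> t = p" .
    then show "velocity A I \<gamma> t = contact_ham_field A \<eta> H (\<gamma> t)" using p(2) by simp
  qed (use assms t in auto)
  then show ?thesis by (simp add: integral_curve_def)
qed

end

end

theorem mainTheorem1:
  fixes A :: "('a, 'e::euclidean_space) atlas"
    and \<eta> :: "('a, 'e) tvec \<Rightarrow> real"
    and n :: nat
  assumes "contact_manifold n A \<eta>"
  defines "TMR \<equiv> times_real (tangent_bundle A)"
    and "CMR \<equiv> times_real (cotangent_bundle A)"
  shows "diffeomorphism TMR CMR (contact_beta A \<eta>) \<and>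
    (\<forall>V u. (V, u) \<in> points TMR \<longrightarrow> fst (fst (contact_beta A \<eta> (V, u))) = fst V) \<and>
    (\<forall>z \<in> points TMR. \<forall>Z \<in> tangent_space TMR z.
       pullback TMR CMR (contact_beta A \<eta>) (canonical_contact_form A) Z = tangent_contact_form A \<eta> Z) \<and>
    (\<forall>H :: 'a \<Rightarrow> real. smooth_fun A H \<longrightarrow>
       (let s = (\<lambda>p. (contact_ham_field A \<eta> H p, reeb_deriv A \<eta> H p));
            d = (\<lambda>p. (covector A p (\<lambda>W. - dfun A H W), - H p));
            N = s ` points A
        in (\<forall>p \<in> points A. contact_beta A \<eta> (s p) = d p) \<and>
           N = {z \<in> points TMR. contact_beta A \<eta> z \<in> d ` points A} \<and>
           legendrian_submanifold TYPE('e) TMR (tangent_contact_form A \<eta>) N \<and>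
           (\<forall>I \<sigma>. is_interval I \<and> interior I \<noteq> {} \<and> smooth_curve A I \<sigma> \<longrightarrow>
              (integral_curve A (contact_ham_field A \<eta> H) I \<sigma> \<longleftrightarrow>
               (\<forall>t\<in>I. (velocity A I \<sigma> t, reeb_deriv A \<eta> H (\<sigma> t)) \<in> N)))))"
  unfolding TMR_def CMR_def Let_def
proof (intro conjI allI impI ballI)
  note contact = assms(1)
  show "diffeomorphism (times_real (tangent_bundle A)) (times_real (cotangent_bundle A))
      (contact_beta A \<eta>)"
    by (rule diffeomorphism_contact_beta[OF contact])
  show "fst (fst (contact_beta A \<eta> (V, u))) = fst V" for V u
    by (simp add: fst_contact_beta)
  show "pullback (times_real (tangent_bundle A)) (times_real (cotangent_bundle A)) (contact_beta A \<eta>)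
      (canonical_contact_form A) Z = tangent_contact_form A \<eta> Z"
    if "Z \<in> tangent_space (times_real (tangent_bundle A)) z" for z Z
    by (rule pullback_canonical_contact_form[OF contact that])
  fix H :: "'a \<Rightarrow> real" assume H: "smooth_fun A H"
  show "contact_beta A \<eta> (contact_ham_field A \<eta> H p, reeb_deriv A \<eta> H p) =
      (covector A p (\<lambda>W. - dfun A H W), - H p)" if "p \<in> points A" for p
    by (rule contact_ham_field(2)[OF contact H that])
  show "(\<lambda>p. (contact_ham_field A \<eta> H p, reeb_deriv A \<eta> H p)) ` points A =
      {z \<in> points (times_real (tangent_bundle A)). contact_beta A \<eta> z \<in>
        (\<lambda>p. (covector A p (\<lambda>W. - dfun A H W), - H p)) ` points A}"
    by (rule contact_ham_section_eq_preimage[OF contact H])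
  show "legendrian_submanifold TYPE('e) (times_real (tangent_bundle A)) (tangent_contact_form A \<eta>)
      ((\<lambda>p. (contact_ham_field A \<eta> H p, reeb_deriv A \<eta> H p)) ` points A)"
    by (rule legendrian_submanifold_contact_ham_section[OF contact H])
  fix I \<sigma> assume "is_interval I \<and> interior I \<noteq> {} \<and> smooth_curve A I \<sigma>"
  then have "\<sigma> ` I \<subseteq> points A" by (simp add: smooth_curve_def)
  then show "integral_curve A (contact_ham_field A \<eta> H) I \<sigma> \<longleftrightarrow>
      (\<forall>t\<in>I. (velocity A I \<sigma> t, reeb_deriv A \<eta> H (\<sigma> t)) \<in>
        (\<lambda>p. (contact_ham_field A \<eta> H p, reeb_deriv A \<eta> H p)) ` points A)"
    by (rule integral_curve_iff_contact_ham_section[OF contact H])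
qed

end
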